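(* Let $p_1,p_2\ge 2$, let $M\in\mathbb{R}^{p_1\times p_2}$, $\Sigma_1\in\mathcal{S}_+^{p_1}$, $\Sigma_2\in\mathcal{S}_+^{p_2}$, and let $F$ be an absolutely continuous, matrix spherical distribution on $\mathbb{R}^{p_1\times p_2}$ with $\mathrm{E}\|Z\|_F^4<\infty$ for $Z=(z_{jk})\sim F$. Let $X_1,X_2,\ldots$ be i.i.d. from $P(M,\Sigma_1,\Sigma_2,F)$ and let $V_n$ be the matrix computed from $X_1,\ldots,X_n$ as $$V_n := \left( \frac{S_n}{|S_n|^{1/(p_1 p_2)}} \right)^{-1/2} \left( \frac{S_{2n}}{| S_{2n} |^{1/p_2}} \otimes \frac{S_{1n}}{| S_{1n} |^{1/p_1}} \right) \left( \frac{S_n}{|S_n|^{1/(p_1 p_2)}} \right)^{-1/2}.$$ Then, as $n\to\infty$, $n\|V_n-I_{p_1p_2}\|_F^2$ converges in distribution to $$\frac{\mathrm{E}(z_{11}^2z_{22}^2)+\mathrm{E}(z_{11}^2z_{12}^2)}{\{\mathrm{E}(z_{11}^2)\}^2}\,\chi^2_{\frac14(p_1+2)(p_1-1)(p_2+2)(p_2-1)}+\frac{3\mathrm{E}(z_{11}^2z_{22}^2)-\mathrm{E}(z_{11}^2z_{12}^2)}{\{\mathrm{E}(z_{11}^2)\}^2}\,\chi^2_{\frac14p_1p_2(p_1-1)(p_2-1)},$$ where the two $\chi^2$-variates (with the indicated degrees of freedom) are independent.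
   Context: $\mathcal{S}_+^p$ is the set of symmetric positive definite $p\times p$ real matrices; $A^{1/2}$ and $A^{-1/2}$ denote the symmetric positive definite (inverse) square roots; $|\cdot|$ is the determinant, $\|\cdot\|_F$ the Frobenius norm, $\otimes$ the Kronecker product, $\mathrm{vec}$ column-wise vectorization. A distribution $F$ of a random $p_1\times p_2$ matrix $Z$ is matrix spherical if $O_1ZO_2^{\top}$ has the same distribution as $Z$ for all orthogonal $O_1\in\mathbb{R}^{p_1\times p_1}$, $O_2\in\mathbb{R}^{p_2\times p_2}$. $P(M,\Sigma_1,\Sigma_2,F)$ denotes the distribution of $X=M+\Sigma_1^{1/2}Z\Sigma_2^{1/2}$ with $Z\sim F$. Estimators: with $\bar X=\frac1n\sum_{i=1}^nX_i$, $S_n=\frac1n\sum_{i=1}^n\mathrm{vec}(X_i-\bar X)\mathrm{vec}(X_i-\bar X)^{\top}$, and $(S_{1n},S_{2n})\in\mathcal{S}_+^{p_1}\times\mathcal{S}_+^{p_2}$ is any solution of $$S_{1n}=\frac1{np_2}\sum_{i=1}^n(X_i-\bar X)S_{2n}^{-1}(X_i-\bar X)^{\top},\qquad S_{2n}=\frac1{np_1}\sum_{i=1}^n(X_i-\bar X)^{\top}S_{1n}^{-1}(X_i-\bar X).$$ For all sufficiently large $n$, almost surely $S_n$ is invertible and such a solution exists and is unique up to the scaling $(\lambda S_{1n},\lambda^{-1}S_{2n})$, $\lambda>0$, to which $V_n$ is invariant. *)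

theory Defs
  imports "HOL-Probability.Probability"
begin

text \<open>A \<open>p \<times> q\<close> matrix has type \<^typ>\<open>real^'q^'p\<close>. The Euclidean norm of this type is the
  Frobenius norm, and \<^const>\<open>lborel\<close> on it is the Lebesgue measure on the entries.\<close>

definition spd :: "real^'n^'n \<Rightarrow> bool" where
  "spd A \<longleftrightarrow> transpose A = A \<and> (\<forall>x. x \<noteq> 0 \<longrightarrow> x \<bullet> (A *v x) > 0)"

text \<open>Meaningful for positive definite arguments, whose positive definite root is unique.\<close>

definition mat_sqrt :: "real^'n^'n \<Rightarrow> real^'n^'n" where
  "mat_sqrt A = (THE B. spd B \<and> B ** B = A)"

definition mat_inv_sqrt :: "real^'n^'n \<Rightarrow> real^'n^'n" where
  "mat_inv_sqrt A = matrix_inv (mat_sqrt A)"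

text \<open>Column-wise vectorization stacks the columns, so its positions are pairs (column, row), with
  the column as the block index. This agrees with the indexing of the Kronecker product, whose
  first components are the block indices: \<open>vec (A X B\<^sup>T) = (B \<otimes> A) vec X\<close>.\<close>

definition vec_cols :: "real^'q^'p \<Rightarrow> real^('q \<times> 'p)" where
  "vec_cols X = (\<chi> a. X $ snd a $ fst a)"

definition kronecker :: "real^'n^'m \<Rightarrow> real^'l^'k \<Rightarrow> real^('n \<times> 'l)^('m \<times> 'k)" where
  "kronecker A B = (\<chi> a b. A $ fst a $ fst b * B $ snd a $ snd b)"

definition outer :: "real^'n \<Rightarrow> real^'n^'n" where
  "outer v = (\<chi> a b. v $ a * v $ b)"

definition det_normalize :: "real^'n^'n \<Rightarrow> real^'n^'n" where
  "det_normalize A = (1 / det A powr (1 / real CARD('n))) *\<^sub>R A"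

definition matrix_spherical :: "(real^'q^'p) measure \<Rightarrow> bool" where
  "matrix_spherical F \<longleftrightarrow> (\<forall>(O1::real^'p^'p) (O2::real^'q^'q).
     orthogonal_matrix O1 \<longrightarrow> orthogonal_matrix O2 \<longrightarrow>
     distr F borel (\<lambda>Z. O1 ** Z ** transpose O2) = F)"

definition matrix_elliptical ::
  "real^'q^'p \<Rightarrow> real^'p^'p \<Rightarrow> real^'q^'q \<Rightarrow> (real^'q^'p) measure \<Rightarrow> (real^'q^'p) measure" where
  "matrix_elliptical M \<Sigma>1 \<Sigma>2 F =
     distr F borel (\<lambda>Z. M + mat_sqrt \<Sigma>1 ** Z ** mat_sqrt \<Sigma>2)"

text \<open>The sample of size \<open>n\<close> is \<open>X 0, \<dots>, X (n - 1)\<close>.\<close>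

definition sample_mean :: "(nat \<Rightarrow> real^'q^'p) \<Rightarrow> nat \<Rightarrow> real^'q^'p" where
  "sample_mean X n = (1 / real n) *\<^sub>R (\<Sum>i<n. X i)"

definition sample_cov :: "(nat \<Rightarrow> real^'q^'p) \<Rightarrow> nat \<Rightarrow> real^('q \<times> 'p)^('q \<times> 'p)" where
  "sample_cov X n = (1 / real n) *\<^sub>R (\<Sum>i<n. outer (vec_cols (X i - sample_mean X n)))"

definition separable_solution ::
  "(nat \<Rightarrow> real^'q^'p) \<Rightarrow> nat \<Rightarrow> real^'p^'p \<Rightarrow> real^'q^'q \<Rightarrow> bool" where
  "separable_solution X n A B \<longleftrightarrow> spd A \<and> spd B \<and>
     A = (1 / (real n * real CARD('q))) *\<^sub>R
           (\<Sum>i<n. (X i - sample_mean X n) ** matrix_inv B ** transpose (X i - sample_mean X n)) \<and>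
     B = (1 / (real n * real CARD('p))) *\<^sub>R
           (\<Sum>i<n. transpose (X i - sample_mean X n) ** matrix_inv A ** (X i - sample_mean X n))"

definition separability_matrix ::
  "real^('q \<times> 'p)^('q \<times> 'p) \<Rightarrow> real^'p^'p \<Rightarrow> real^'q^'q \<Rightarrow> real^('q \<times> 'p)^('q \<times> 'p)" where
  "separability_matrix S S1 S2 =
     mat_inv_sqrt (det_normalize S) **
     kronecker (det_normalize S2) (det_normalize S1) **
     mat_inv_sqrt (det_normalize S)"

definition chi_square :: "nat \<Rightarrow> real measure" where
  "chi_square k = distr (PiM {..<k} (\<lambda>_. density lborel std_normal_density)) borel
                    (\<lambda>x. \<Sum>i<k. (x i)\<^sup>2)"

text \<open>The statistics of interest are only determined up to null sets, so they are random variables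
  on the completed probability space. Measurability is part of the notion since \<^const>\<open>distr\<close> is
  meaningless for nonmeasurable functions; it is required only for all sufficiently large indices.\<close>

definition converges_in_distribution ::
  "'a measure \<Rightarrow> (nat \<Rightarrow> 'a \<Rightarrow> real) \<Rightarrow> real measure \<Rightarrow> bool" where
  "converges_in_distribution P T \<mu> \<longleftrightarrow>
     (\<forall>\<^sub>F n in sequentially. T n \<in> borel_measurable (completion P)) \<and>
     weak_conv_m (\<lambda>n. distr (completion P) borel (T n)) \<mu>"

end

theory Submission
  imports Defs
begin

text \<open>The statistic is \<open>tr ((\<kappa> S\<^sup>-\<^sup>1 T - I)\<^sup>2)\<close> with \<open>T\<close> the separable fit, so it is invariant under
  congruences with Kronecker products and one may assume that \<open>S\<close> is close to \<open>I\<close>. To second order it is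
  the squared norm of the component of \<open>S - I\<close> in \<open>(Sym\<^sub>0 \<otimes> Sym\<^sub>0) \<oplus> (Alt \<otimes> Alt)\<close>, the complement of the
  matrices \<open>B \<otimes> I + I \<otimes> A\<close> among the symmetric ones. Sphericity makes the fourth moments of \<open>Z\<close> a
  combination of pairings of row indices and pairings of column indices, whence the limiting covariance
  is scalar on each of the two summands. The fit exists by Brouwer's theorem, and its uniqueness up to
  scaling makes the statistic almost surely a measurable function of \<open>S\<close>.\<close>

section \<open>Spectral theorem and positive definite matrices\<close>

text \<open>The statistic is multiplied by \<open>n\<close> and its expansion has a remainder cubic
  in \<open>h = norm (S - mat 1)\<close>. It is therefore enough that \<open>h\<close> has order at
  most \<open>n powr (- 2 / 5)\<close> outside events of small probability. This exponent is below
  -1/3, so that \<open>n * h^3\<close> tends to 0, and above -1/2, so that Chebyshev's inequality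
  for the first and second sample moments suffices; only here and in the covariance of the limit do
  fourth moments of \<open>Z\<close> enter. The limit is the law of a quadratic form in several
  correlated statistics. Averaging over an independent Gaussian vector turns the Laplace transform
  of such a form into characteristic functions of scalar sums, so the central limit theorem is
  applied to real variables only. The two Laplace transforms are matched as products of the same
  Gaussian integrals and never evaluated. The solutions \<open>S1\<close> and \<open>S2\<close> are
  an arbitrary selection without any measurability. The proof therefore works with
  \<open>fitted_stat\<close>, a Borel function of the covariance, and returns to the selection on
  the completed space.\<close>

definition diag_mat :: "('n \<Rightarrow> real) \<Rightarrow> real^'n^'n" where
  "diag_mat d = (\<chi> i j. if i = j then d i else 0)"

definition psd :: "real^'n^'n \<Rightarrow> bool" where
  "psd A \<longleftrightarrow> transpose A = A \<and> (\<forall>x. 0 \<le> x \<bullet> (A *v x))"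

lemma inner_matrix_vector_symmetric:
  fixes A :: "real^'n^'n"
  assumes "transpose A = A"
  shows "x \<bullet> (A *v y) = (A *v x) \<bullet> y"
  using assms by (metis dot_lmul_matrix vector_transpose_matrix)

text \<open>A maximizer of the quadratic form on the unit sphere of \<open>W\<close> is an
  eigenvector: moving it along the residual \<open>A x - c x\<close>, which lies in \<open>W\<close>
  by invariance, would otherwise raise the Rayleigh quotient to first order.\<close>

lemma symmetric_eigenvector_exists:
  fixes A :: "real^'n^'n"
  assumes A: "transpose A = A" and W: "subspace W" and inv: "\<And>x. x \<in> W \<Longrightarrow> A *v x \<in> W"
    and ne: "\<exists>x\<in>W. x \<noteq> 0"
  shows "\<exists>x\<in>W. norm x = 1 \<and> (\<exists>c. A *v x = c *\<^sub>R x)"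
proof -
  let ?K = "W \<inter> sphere 0 1"
  have "compact ?K"
    using closed_subspace[OF W] closed_Int_compact compact_sphere by blast
  moreover have "?K \<noteq> {}"
  proof -
    obtain x where x: "x \<in> W" "x \<noteq> 0" using ne by blast
    then have "(1 / norm x) *\<^sub>R x \<in> ?K" using W by (auto simp: subspace_mul)
    then show ?thesis by blast
  qed
  moreover have "continuous_on ?K (\<lambda>x. x \<bullet> (A *v x))"
    by (intro continuous_intros matrix_vector_mult_linear_continuous_on)
  ultimately obtain x where x: "x \<in> ?K" and mx: "\<And>y. y \<in> ?K \<Longrightarrow> y \<bullet> (A *v y) \<le> x \<bullet> (A *v x)"
    using continuous_attains_sup by (metis (no_types, lifting))
  define c where "c = x \<bullet> (A *v x)"
  have nx: "norm x = 1" "x \<in> W" "x \<bullet> x = 1" using x by (auto simp: norm_eq_1)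
  have le: "y \<bullet> (A *v y) \<le> c * (y \<bullet> y)" if "y \<in> W" for y
  proof (cases "y = 0")
    case False
    define z where "z = (1 / norm y) *\<^sub>R y"
    have "z \<in> ?K" using that False W by (auto simp: z_def subspace_mul)
    then have "z \<bullet> (A *v z) \<le> c" using mx c_def by blast
    moreover have "z \<bullet> (A *v z) = (y \<bullet> (A *v y)) / (y \<bullet> y)"
      by (simp add: z_def matrix_vector_mult_scaleR power2_norm_eq_inner [symmetric] power2_eq_square)
    ultimately show ?thesis using False by (simp add: divide_le_eq)
  qed simp
  define w where "w = A *v x - c *\<^sub>R x"
  have wW: "w \<in> W" using nx inv W by (auto simp: w_def intro: subspace_diff subspace_mul)
  have wx: "w \<bullet> x = 0" using nx by (simp add: w_def inner_diff_left inner_diff_right c_def inner_commute)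
  \<comment> \<open>This is \<open>le\<close> at the perturbed point \<open>x + t w\<close>. The
    terms free of \<open>t\<close> cancel, and the cross terms reduce to
    \<open>w \<bullet> w\<close> because \<open>w\<close> is orthogonal to \<open>x\<close>.\<close>
  have ineq: "2 * t * (w \<bullet> w) \<le> t^2 * (c * (w \<bullet> w) - w \<bullet> (A *v w))" for t
  proof -
    have "x + t *\<^sub>R w \<in> W" using nx wW W by (auto intro: subspace_add subspace_mul)
    from le[OF this] have "(x + t *\<^sub>R w) \<bullet> (A *v (x + t *\<^sub>R w)) \<le> c * ((x + t *\<^sub>R w) \<bullet> (x + t *\<^sub>R w))" .
    moreover have "w \<bullet> (A *v x) = w \<bullet> w"
    proof -
      have "A *v x = w + c *\<^sub>R x" by (simp add: w_def)
      then show ?thesis using wx by (simp add: inner_add_right)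
    qed
    moreover have "x \<bullet> (A *v w) = w \<bullet> (A *v x)"
      using inner_matrix_vector_symmetric[OF A, of x w] by (simp add: inner_commute)
    ultimately show ?thesis using wx nx
      by (simp add: matrix_vector_right_distrib matrix_vector_mult_scaleR inner_add_left inner_add_right
          inner_commute[of x w] c_def[symmetric] algebra_simps power2_eq_square)
  qed
  have "w \<bullet> w = 0"
  proof (rule ccontr)
    assume "w \<bullet> w \<noteq> 0"
    then have pos: "w \<bullet> w > 0" by (simp add: inner_gt_zero_iff)
    define b where "b = \<bar>c * (w \<bullet> w) - w \<bullet> (A *v w)\<bar> + 1"
    \<comment> \<open>With this choice \<open>t^2 * b\<close> equals
      \<open>t * (w \<bullet> w)\<close>, half of the left side of \<open>ineq\<close>.\<close>
    define t where "t = (w \<bullet> w) / b"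
    have b: "b > 0" by (simp add: b_def add_nonneg_pos)
    have "t > 0" using pos b by (simp add: t_def)
    have "2 * t * (w \<bullet> w) \<le> t^2 * b"
      using ineq[of t] by (rule order_trans) (auto simp: b_def intro!: mult_left_mono)
    also have "t^2 * b = t * (w \<bullet> w)" using b by (simp add: t_def power2_eq_square)
    finally show False using \<open>t > 0\<close> pos by simp
  qed
  then have "A *v x = c *\<^sub>R x" by (simp add: w_def)
  then show ?thesis using nx by blast
qed

text \<open>The orthogonal complement of the eigenvectors found so far is invariant by symmetry, and
  it is nonzero because fewer than \<open>CARD('n)\<close> of them have been chosen. The induction
  runs over index sets so that the final family is indexed by \<open>'n\<close> itself.\<close>

lemma symmetric_orthonormal_eigenvectors:
  fixes A :: "real^'n^'n" and I :: "'n set"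
  assumes A: "transpose A = A"
  shows "\<exists>u d. (\<forall>i\<in>I. A *v u i = d i *\<^sub>R u i) \<and> (\<forall>i\<in>I. \<forall>j\<in>I. u i \<bullet> u j = (if i = j then 1 else 0))"
proof (induction I rule: finite_induct[OF finite])
  case 1 show ?case by auto
next
  case (2 a I)
  then obtain u :: "'n \<Rightarrow> real^'n" and d where
    ev: "\<And>i. i \<in> I \<Longrightarrow> A *v u i = d i *\<^sub>R u i" and
    on: "\<And>i j. i \<in> I \<Longrightarrow> j \<in> I \<Longrightarrow> u i \<bullet> u j = (if i = j then 1 else 0)" by metis
  define W where "W = {x. \<forall>i\<in>I. u i \<bullet> x = 0}"
  have "subspace W" by (auto simp: W_def subspace_def inner_add_right)
  moreover have "A *v x \<in> W" if "x \<in> W" for x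
    using that ev inner_matrix_vector_symmetric[OF A] by (auto simp: W_def)
  moreover have "\<exists>x\<in>W. x \<noteq> 0"
  proof -
    have "dim (u ` I) \<le> card I" by (metis 2(1) card_image_le dim_le_card' finite_imageI order_trans)
    also have "card I < CARD('n)" by (metis 2(2) UNIV_I finite_class.finite_UNIV psubset_card_mono psubsetI subset_UNIV)
    finally have "dim (u ` I) < DIM(real^'n)" by simp
    from orthogonal_to_subspace_exists[OF this] obtain x where x: "x \<noteq> 0" "\<And>y. y \<in> span (u ` I) \<Longrightarrow> orthogonal x y" by metis
    then have "u i \<bullet> x = 0" if "i \<in> I" for i
      using that by (metis imageI inner_commute orthogonal_def span_base)
    then show ?thesis using x by (auto simp: W_def)
  qed
  ultimately obtain x c where x: "x \<in> W" "norm x = 1" "A *v x = c *\<^sub>R x"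
    using symmetric_eigenvector_exists[OF A] by metis
  then show ?case using 2(2)
    by (intro exI[of _ "u(a := x)"] exI[of _ "d(a := c)"])
      (auto simp: ev on W_def norm_eq_1 inner_commute)
qed

theorem spectral_theorem:
  fixes A :: "real^'n^'n"
  assumes "transpose A = A"
  obtains C d where "orthogonal_matrix C" "A = C ** diag_mat d ** transpose C"
proof -
  obtain u :: "'n \<Rightarrow> real^'n" and d where
    ev: "\<And>i. A *v u i = d i *\<^sub>R u i" and
    on: "\<And>i j. u i \<bullet> u j = (if i = j then 1 else 0)"
    using symmetric_orthonormal_eigenvectors[OF assms, of UNIV] by auto
  define C :: "real^'n^'n" where "C = (\<chi> i j. u j $ i)"
  have C: "orthogonal_matrix C"
    using on unfolding orthogonal_matrix
    by (simp add: vec_eq_iff C_def matrix_matrix_mult_def transpose_def mat_def inner_vec_def)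
  have "A ** C = C ** diag_mat d"
  proof -
    have "(A ** C) $ i $ j = (A *v u j) $ i" for i j
      by (simp add: C_def matrix_matrix_mult_def matrix_vector_mult_def)
    moreover have "(C ** diag_mat d) $ i $ j = (d j *\<^sub>R u j) $ i" for i j
      by (simp add: C_def matrix_matrix_mult_def diag_mat_def if_distrib sum.delta cong: if_cong)
    ultimately show ?thesis by (simp add: vec_eq_iff ev)
  qed
  then have "A = C ** diag_mat d ** transpose C"
    using C by (metis matrix_mul_assoc matrix_mul_rid orthogonal_matrix_def)
  then show ?thesis using C that by blast
qed

section \<open>Frobenius norm, transposition and matrix inversion\<close>

lemma norm_matrix_sq: "(norm (A :: real^'n^'m))\<^sup>2 = (\<Sum>i\<in>UNIV. \<Sum>j\<in>UNIV. (A $ i $ j)\<^sup>2)"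
  by (simp add: power2_norm_eq_inner inner_vec_def power2_eq_square[symmetric])

lemma norm_transpose [simp]: "norm (transpose (A :: real^'n^'m)) = norm A"
proof -
  have "(norm (transpose A))\<^sup>2 = (norm A)\<^sup>2"
    unfolding norm_matrix_sq transpose_def by (simp, subst sum.swap, simp)
  then show ?thesis by simp
qed

lemma norm_matrix_mult_le: "norm ((A :: real^'n^'m) ** (B :: real^'k^'n)) \<le> norm A * norm B"
proof -
  have "(norm (A ** B))\<^sup>2 = (\<Sum>i\<in>UNIV. \<Sum>j\<in>UNIV. (row i A \<bullet> column j B)\<^sup>2)"
    by (simp add: norm_matrix_sq matrix_mult_dot matrix_matrix_mult_def inner_vec_def row_def column_def)
  also have "\<dots> \<le> (\<Sum>i\<in>UNIV. \<Sum>j\<in>UNIV. (norm (row i A))\<^sup>2 * (norm (column j B))\<^sup>2)"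
    by (intro sum_mono) (metis Cauchy_Schwarz_ineq power2_norm_eq_inner)
  also have "\<dots> = (\<Sum>i\<in>UNIV. (norm (row i A))\<^sup>2) * (\<Sum>j\<in>UNIV. (norm (column j B))\<^sup>2)"
    by (simp add: sum_product)
  also have "(\<Sum>i\<in>UNIV. (norm (row i A))\<^sup>2) = (norm A)\<^sup>2"
    by (simp add: norm_matrix_sq) (simp add: power2_norm_eq_inner inner_vec_def row_def power2_eq_square[symmetric])
  also have "(\<Sum>j\<in>UNIV. (norm (column j B))\<^sup>2) = (norm B)\<^sup>2"
    unfolding norm_matrix_sq
    by (subst sum.swap) (simp add: power2_norm_eq_inner inner_vec_def column_def power2_eq_square[symmetric])
  finally show ?thesis by (metis norm_ge_zero power2_le_imp_le power_mult_distrib mult_nonneg_nonneg)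
qed

lemma bounded_bilinear_matrix_mult:
  "bounded_bilinear ((**) :: real^'n^'m \<Rightarrow> real^'k^'n \<Rightarrow> real^'k^'m)"
proof
  show "\<exists>K. \<forall>(a::real^'n^'m) (b::real^'k^'n). norm (a ** b) \<le> norm a * norm b * K"
    by (rule exI[of _ 1]) (simp add: norm_matrix_mult_le)
qed (simp_all add: vec_eq_iff matrix_matrix_mult_def sum.distrib sum_distrib_left algebra_simps)

interpretation mm: bounded_bilinear "(**) :: real^'n^'m \<Rightarrow> real^'k^'n \<Rightarrow> real^'k^'m"
  by (rule bounded_bilinear_matrix_mult)

lemma bounded_linear_transpose: "bounded_linear (transpose :: real^'n^'m \<Rightarrow> real^'m^'n)"
proof
  show "\<exists>K. \<forall>A::real^'n^'m. norm (transpose A) \<le> norm A * K"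
    by (rule exI[of _ 1]) simp
qed (simp_all add: vec_eq_iff transpose_def)

lemmas transpose_diff = linear_diff[OF bounded_linear.linear[OF bounded_linear_transpose]]
lemmas transpose_add = linear_add[OF bounded_linear.linear[OF bounded_linear_transpose]]

text \<open>\<open>matrix_inv\<close> is defined by choice, so inverses are computed by exhibiting
  one; for square matrices a one-sided inverse is enough.\<close>

lemma matrix_inv_unique:
  assumes "(A :: real^'n^'n) ** B = mat 1"
  shows "matrix_inv A = B"
proof -
  have "\<exists>A'. A ** A' = mat 1 \<and> A' ** A = mat 1"
    using assms matrix_left_right_inverse by blast
  then have "A ** matrix_inv A = mat 1 \<and> matrix_inv A ** A = mat 1"
    unfolding matrix_inv_def by (rule someI_ex)
  then show ?thesis using assms by (metis matrix_mul_assoc matrix_mul_lid matrix_mul_rid)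
qed

lemma matrix_inv_mult:
  assumes "det (A :: real^'n^'n) \<noteq> 0"
  shows "matrix_inv A ** A = mat 1" "A ** matrix_inv A = mat 1"
proof -
  have "invertible A" using assms by (simp add: invertible_det_nz)
  then obtain B where B: "A ** B = mat 1" "B ** A = mat 1" by (auto simp: invertible_def)
  then show "matrix_inv A ** A = mat 1" "A ** matrix_inv A = mat 1"
    using matrix_inv_unique by metis+
qed

lemma transpose_matrix_inv:
  assumes "det (A :: real^'n^'n) \<noteq> 0"
  shows "transpose (matrix_inv A) = matrix_inv (transpose A)"
proof -
  have "transpose A ** transpose (matrix_inv A) = mat 1"
    by (simp add: matrix_transpose_mul[symmetric] matrix_inv_mult[OF assms])
  then show ?thesis by (rule matrix_inv_unique[symmetric])
qed

lemma diag_mat_mult: "diag_mat d ** diag_mat e = diag_mat (\<lambda>i. d i * e i)"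
  by (simp add: vec_eq_iff diag_mat_def matrix_matrix_mult_def mult_delta_left)

lemma transpose_diag_mat [simp]: "transpose (diag_mat d) = diag_mat d"
  by (auto simp: vec_eq_iff diag_mat_def transpose_def)

lemma det_diag_mat: "det (diag_mat d) = prod d UNIV"
  by (subst det_diagonal) (auto simp: diag_mat_def)

lemma trace_diag_mat: "trace (diag_mat d) = sum d UNIV"
  by (simp add: trace_def diag_mat_def)

lemma diag_mat_1: "diag_mat (\<lambda>_. 1) = mat 1"
  by (auto simp: vec_eq_iff diag_mat_def mat_def)

lemma diag_mat_diff: "diag_mat d - diag_mat e = diag_mat (\<lambda>i. d i - e i)"
  by (auto simp: vec_eq_iff diag_mat_def)

lemma inner_diag_mat: "x \<bullet> (diag_mat d *v x) = (\<Sum>i\<in>UNIV. d i * (x $ i)\<^sup>2)"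
  by (simp add: inner_vec_def diag_mat_def matrix_vector_mult_def mult_delta_left power2_eq_square mult.left_commute)

lemma inner_congruence:
  "(x :: real^'n) \<bullet> ((C ** A ** transpose C) *v x) = (transpose C *v x) \<bullet> (A *v (transpose C *v x))"
  by (metis dot_lmul_matrix matrix_vector_mul_assoc transpose_matrix_vector)

lemma det_orthogonal_conj:
  assumes "orthogonal_matrix (C :: real^'n^'n)"
  shows "det (C ** A ** transpose C) = det A"
proof -
  have "det C * det C = 1" using det_orthogonal_matrix[OF assms] by auto
  then show ?thesis by (simp add: det_mul)
qed

lemma trace_conj:
  "trace (C ** A ** transpose C) = trace (transpose C ** C ** (A :: real^'n^'n))"
  by (metis matrix_mul_assoc trace_mul_sym)

lemma trace_transpose [simp]: "trace (transpose A) = trace (A :: real^'n^'n)"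
  by (simp add: trace_def transpose_def)

lemma trace_scaleR [simp]: "trace (c *\<^sub>R A) = c * trace (A :: real^'n^'n)"
  by (simp add: trace_def sum_distrib_left)

lemma inner_eq_trace: "(A :: real^'n^'m) \<bullet> B = trace (transpose A ** B)"
  unfolding trace_def by (simp add: inner_vec_def matrix_matrix_mult_def transpose_def) (rule sum.swap)

lemma abs_trace_mult_le: "\<bar>trace ((A :: real^'n^'m) ** B)\<bar> \<le> norm A * norm B"
  using Cauchy_Schwarz_ineq2[of "transpose A" B] by (simp add: inner_eq_trace)

section \<open>Positive definite matrices, their square roots and determinants\<close>

lemma psdD: "psd A \<Longrightarrow> transpose A = A" "psd A \<Longrightarrow> 0 \<le> x \<bullet> (A *v x)"
  by (auto simp: psd_def)

lemma spd_imp_psd: "spd A \<Longrightarrow> psd A"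
  unfolding spd_def psd_def by (metis inner_zero_left less_eq_real_def)

lemma spd_symmetric: "spd A \<Longrightarrow> transpose A = A" by (simp add: spd_def)

text \<open>The eigenvalue \<open>d i\<close> is the value of the quadratic form at the unit
  eigenvector \<open>C *v axis i 1\<close>, so its sign can be read off from the form.\<close>

lemma psd_spectral:
  assumes "psd (A :: real^'n^'n)"
  obtains C d where "orthogonal_matrix C" "A = C ** diag_mat d ** transpose C" "\<And>i. 0 \<le> d i"
    "spd A \<Longrightarrow> (\<And>i. 0 < d i)"
proof -
  obtain C :: "real^'n^'n" and d where C: "orthogonal_matrix C" "A = C ** diag_mat d ** transpose C"
    using assms spectral_theorem psdD by metis
  have q: "(C *v axis i 1) \<bullet> (A *v (C *v axis i 1)) = d i" for i
  proof -
    have "transpose C *v (C *v axis i 1) = axis i (1::real)"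
      using C(1) by (simp only: matrix_vector_mul_assoc orthogonal_matrix_def matrix_vector_mul_lid)
    then show ?thesis
      unfolding C(2) inner_congruence by (simp add: inner_diag_mat axis_def power2_eq_square mult_delta_right)
  qed
  have ne: "C *v axis i 1 \<noteq> 0" for i
  proof
    assume "C *v axis i 1 = 0"
    then have "transpose C *v (C *v axis i 1) = 0" by (simp only: matrix_vector_mult_0_right)
    then have "axis i (1::real) = 0"
      using C(1) by (simp only: matrix_vector_mul_assoc orthogonal_matrix_def matrix_vector_mul_lid)
    then show False by (simp add: axis_eq_0_iff)
  qed
  have "0 \<le> d i" for i using q[of i] psdD(2)[OF assms] by metis
  moreover have "0 < d i" if "spd A" for i using q[of i] ne[of i] that unfolding spd_def by metis
  ultimately show ?thesis using that C by blast
qed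

lemma spd_det_pos:
  assumes "spd (A :: real^'n^'n)" shows "det A > 0"
  using psd_spectral[OF spd_imp_psd[OF assms]] assms
  by (metis det_diag_mat det_orthogonal_conj prod_pos)

lemma spd_det_nz: "spd (A :: real^'n^'n) \<Longrightarrow> det A \<noteq> 0" using spd_det_pos by force

lemma spd_congruence:
  assumes "spd (A :: real^'n^'n)" "det C \<noteq> 0"
  shows "spd (C ** A ** transpose C)"
proof -
  have "transpose C *v x \<noteq> 0" if "x \<noteq> 0" for x
  proof
    assume "transpose C *v x = 0"
    then have "matrix_inv (transpose C) *v (transpose C *v x) = 0" by (simp only: matrix_vector_mult_0_right)
    then show False using assms(2) that by (simp add: matrix_vector_mul_assoc matrix_inv_mult del: transpose_matrix_vector)
  qed
  then show ?thesis using assms(1)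
    unfolding spd_def inner_congruence by (simp add: matrix_transpose_mul matrix_mul_assoc del: transpose_matrix_vector)
qed

lemma spd_matrix_inv:
  assumes "spd (A :: real^'n^'n)" shows "spd (matrix_inv A)"
proof -
  have "transpose (matrix_inv A) = matrix_inv A"
    using transpose_matrix_inv[OF spd_det_nz[OF assms]] spd_symmetric[OF assms] by simp
  moreover have "matrix_inv A ** A ** matrix_inv A = matrix_inv A"
    by (simp add: matrix_inv_mult[OF spd_det_nz[OF assms]])
  moreover have "det (matrix_inv A) \<noteq> 0"
    by (metis assms det_I det_mul matrix_inv_mult(1) mult_zero_left spd_det_nz zero_neq_one)
  ultimately show ?thesis using spd_congruence[OF assms, of "matrix_inv A"] by simp
qed

lemma spd_mat_1: "spd (mat 1 :: real^'n^'n)"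
  by (simp add: spd_def inner_gt_zero_iff)

lemma spd_scaleR: "spd A \<Longrightarrow> 0 < c \<Longrightarrow> spd (c *\<^sub>R A)"
  by (simp add: spd_def transpose_scalar scaleR_matrix_vector_assoc[symmetric])

lemma psd_scaleR: "psd A \<Longrightarrow> 0 \<le> c \<Longrightarrow> psd (c *\<^sub>R A)"
  by (simp add: psd_def transpose_scalar scaleR_matrix_vector_assoc[symmetric])

lemma psd_mult_transpose: "psd (C ** transpose (C :: real^'m^'n))"
  unfolding psd_def
  by (simp add: matrix_transpose_mul matrix_vector_mul_assoc[symmetric] del: transpose_matrix_vector)
     (metis dot_lmul_matrix inner_ge_zero transpose_matrix_vector)

text \<open>The eigenvector matrix is scaled by the roots of the eigenvalues. Such a factor turns
  positivity of traces, inner products and Kronecker products into sums of squares.\<close>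

lemma psd_factor:
  assumes "psd (A :: real^'n^'n)"
  obtains C :: "real^'n^'n" where "A = C ** transpose C"
proof -
  obtain C d where C: "orthogonal_matrix C" "A = C ** diag_mat d ** transpose C" "\<And>i. 0 \<le> d i"
    using psd_spectral[OF assms] by metis
  have "A = (C ** diag_mat (\<lambda>i. sqrt (d i))) ** transpose (C ** diag_mat (\<lambda>i. sqrt (d i)))"
    using C(3) by (simp add: C(2) matrix_transpose_mul matrix_mul_assoc)
      (simp add: matrix_mul_assoc[symmetric] diag_mat_mult)
  then show ?thesis using that by blast
qed

lemma psd_trace_nonneg: "psd (A :: real^'n^'n) \<Longrightarrow> 0 \<le> trace A"
  using psd_factor by (metis inner_eq_trace inner_ge_zero trace_mul_sym)

text \<open>For \<open>A = C ** transpose C\<close> submultiplicativity bounds the norm by the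
  squared norm of \<open>C\<close>, which is the trace. Hence positive semidefinite matrices of
  fixed trace form a bounded set.\<close>

lemma psd_norm_le_trace:
  assumes "psd (A :: real^'n^'n)" shows "norm A \<le> trace A"
proof -
  obtain C :: "real^'n^'n" where C: "A = C ** transpose C" using psd_factor assms by metis
  have "norm A \<le> norm C * norm C" unfolding C using norm_matrix_mult_le[of C "transpose C"] by simp
  also have "\<dots> = trace A"
    by (simp add: C trace_mul_sym[of C] inner_eq_trace[symmetric] power2_norm_eq_inner[symmetric] power2_eq_square)
  finally show ?thesis .
qed

lemma spd_trace_pos: "spd (A :: real^'n^'n) \<Longrightarrow> 0 < trace A"
proof -
  assume A: "spd A"
  have "A \<noteq> 0" using spd_det_nz[OF A] by (metis det_0 mat_0)
  then show ?thesis using psd_norm_le_trace[OF spd_imp_psd[OF A]] by (smt (verit) zero_less_norm_iff)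
qed

lemma spd_sqrt_exists:
  assumes "spd (A :: real^'n^'n)"
  shows "\<exists>B. spd B \<and> B ** B = A"
proof -
  obtain C d where C: "orthogonal_matrix C" "A = C ** diag_mat d ** transpose C" "\<And>i. 0 < d i"
    using psd_spectral[OF spd_imp_psd[OF assms]] assms by metis
  define B where "B = C ** diag_mat (\<lambda>i. sqrt (d i)) ** transpose C"
  have CC: "transpose C ** C = mat 1" using C(1) by (simp add: orthogonal_matrix)
  have dC: "det C \<noteq> 0" using det_orthogonal_matrix[OF C(1)] by fastforce
  have "spd (diag_mat (\<lambda>i. sqrt (d i)))"
    unfolding spd_def
  proof (intro conjI allI impI)
    fix x :: "real^'n" assume "x \<noteq> 0"
    then obtain i where "x $ i \<noteq> 0" by (auto simp: vec_eq_iff)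
    then show "0 < x \<bullet> (diag_mat (\<lambda>i. sqrt (d i)) *v x)"
      unfolding inner_diag_mat using C(3)
      by (intro sum_pos2[of _ i]) (auto intro!: mult_pos_pos mult_nonneg_nonneg simp: less_imp_le)
  qed simp
  then have "spd B" unfolding B_def using dC by (rule spd_congruence)
  moreover have "B ** B = A"
  proof -
    have "B ** B = C ** diag_mat (\<lambda>i. sqrt (d i)) ** (transpose C ** C) ** diag_mat (\<lambda>i. sqrt (d i)) ** transpose C"
      by (simp add: B_def matrix_mul_assoc)
    also have "\<dots> = C ** (diag_mat (\<lambda>i. sqrt (d i)) ** diag_mat (\<lambda>i. sqrt (d i))) ** transpose C"
      by (simp add: CC matrix_mul_assoc)
    finally show ?thesis using C(3) by (simp add: C(2) diag_mat_mult less_imp_le)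
  qed
  ultimately show ?thesis by blast
qed

text \<open>With \<open>D = B - C\<close> one has \<open>B B - C C = B D + D C\<close>, although
  \<open>B\<close> and \<open>C\<close> need not commute. So the traces of \<open>D B D\<close> and
  \<open>D C D\<close> add up to zero, while both are positive unless \<open>D = 0\<close>.\<close>

lemma spd_sqrt_unique:
  assumes B: "spd (B :: real^'n^'n)" and C: "spd C" and eq: "B ** B = C ** C"
  shows "B = C"
proof (rule ccontr)
  assume "B \<noteq> C"
  define D where "D = B - C"
  have D: "D \<noteq> 0" "transpose D = D" using \<open>B \<noteq> C\<close> B C by (simp_all add: D_def spd_symmetric transpose_diff)
  \<comment> \<open>For the root \<open>R\<close> of \<open>X\<close> this trace is the squared norm
    of \<open>R ** D\<close>, which is nonzero because \<open>R\<close> is invertible.\<close>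
  have t: "trace (D ** X ** D) > 0" if X: "spd X" for X
  proof -
    obtain R where R: "spd R" "R ** R = X" using spd_sqrt_exists[OF X] by blast
    have "R ** D \<noteq> 0"
      by (metis D(1) R(1) matrix_inv_mult(1) matrix_mul_assoc matrix_mul_lid mm.zero_right spd_det_nz)
    then have "0 < (R ** D) \<bullet> (R ** D)" by (simp add: inner_gt_zero_iff)
    then show ?thesis using R D
      by (simp add: inner_eq_trace matrix_transpose_mul spd_symmetric) (metis matrix_mul_assoc)
  qed
  have "trace (D ** (B ** B - C ** C)) = trace (D ** B ** D) + trace (D ** D ** C)"
    unfolding D_def by (simp add: mm.diff_left mm.diff_right trace_sub matrix_mul_assoc)
  also have "trace (D ** D ** C) = trace (D ** C ** D)"
    by (metis matrix_mul_assoc trace_mul_sym)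
  finally show False using eq t[OF B] t[OF C] by (simp add: mm.zero_right trace_0[unfolded mat_0])
qed

lemma mat_sqrt:
  assumes "spd (A :: real^'n^'n)"
  shows "spd (mat_sqrt A)" "mat_sqrt A ** mat_sqrt A = A"
proof -
  have "\<exists>!B. spd B \<and> B ** B = A" using spd_sqrt_exists[OF assms] spd_sqrt_unique by metis
  from theI'[OF this] show "spd (mat_sqrt A)" "mat_sqrt A ** mat_sqrt A = A"
    unfolding mat_sqrt_def by auto
qed

lemma mat_inv_sqrt:
  assumes "spd (A :: real^'n^'n)"
  shows "spd (mat_inv_sqrt A)" "mat_inv_sqrt A ** mat_inv_sqrt A = matrix_inv A"
proof -
  show "spd (mat_inv_sqrt A)" unfolding mat_inv_sqrt_def using assms by (intro spd_matrix_inv mat_sqrt)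
  note i = matrix_inv_mult[OF spd_det_nz[OF mat_sqrt(1)[OF assms]]]
  have "A ** (mat_inv_sqrt A ** mat_inv_sqrt A) = mat_sqrt A ** (mat_sqrt A ** mat_inv_sqrt A) ** mat_inv_sqrt A"
    by (simp add: mat_sqrt(2)[OF assms] matrix_mul_assoc)
  then show "mat_inv_sqrt A ** mat_inv_sqrt A = matrix_inv A"
    by (metis i(2) mat_inv_sqrt_def matrix_inv_unique matrix_mul_rid)
qed

text \<open>The eigenvalues sum to the dimension, so the first-order terms \<open>d i - 1\<close> of
  \<open>ln (d i)\<close> cancel and only quadratic remainders are left. This keeps the determinant
  normalization out of the leading term of the statistic.\<close>

lemma ln_det_near_mat_1:
  assumes P: "spd (P :: real^'n^'n)" and tr: "trace P = real CARD('n)" and near: "norm (P - mat 1) \<le> 1 / 2"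
  shows "\<bar>ln (det P)\<bar> \<le> 2 * (norm (P - mat 1))\<^sup>2"
proof -
  obtain C d where C: "orthogonal_matrix C" "P = C ** diag_mat d ** transpose C" "\<And>i. 0 < d i"
    using psd_spectral[OF spd_imp_psd[OF P]] P by metis
  have CC: "transpose C ** C = mat 1" "C ** transpose C = mat 1" using C(1) by (simp_all add: orthogonal_matrix_def)
  have eq: "P - mat 1 = C ** diag_mat (\<lambda>i. d i - 1) ** transpose C"
    by (simp add: C(2) CC(2) diag_mat_diff[symmetric] diag_mat_1 mm.diff_left mm.diff_right)
  have "(norm (P - mat 1))\<^sup>2 = trace (transpose (P - mat 1) ** (P - mat 1))"
    by (simp add: power2_norm_eq_inner inner_eq_trace)
  also have "transpose (P - mat 1) ** (P - mat 1)
      = C ** diag_mat (\<lambda>i. d i - 1) ** (transpose C ** C) ** diag_mat (\<lambda>i. d i - 1) ** transpose C"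
    by (simp only: eq matrix_transpose_mul transpose_transpose transpose_diag_mat matrix_mul_assoc)
  also have "trace \<dots> = trace (C ** (diag_mat (\<lambda>i. d i - 1) ** diag_mat (\<lambda>i. d i - 1)) ** transpose C)"
    by (simp only: CC(1) matrix_mul_rid matrix_mul_assoc)
  also have "\<dots> = trace (diag_mat (\<lambda>i. d i - 1) ** diag_mat (\<lambda>i. d i - 1))"
    by (simp only: trace_conj CC(1) matrix_mul_lid)
  finally have n: "(norm (P - mat 1))\<^sup>2 = (\<Sum>i\<in>UNIV. (d i - 1)\<^sup>2)"
    by (simp add: diag_mat_mult trace_diag_mat power2_eq_square)
  have sd: "sum d UNIV = real CARD('n)" using tr
    by (simp add: C(2) trace_conj CC(1) trace_diag_mat)
  have small: "\<bar>d i - 1\<bar> \<le> 1 / 2" for i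
  proof -
    have "(d i - 1)\<^sup>2 \<le> (\<Sum>i\<in>UNIV. (d i - 1)\<^sup>2)" by (rule member_le_sum) auto
    also have "\<dots> \<le> (1 / 2)\<^sup>2" unfolding n[symmetric] using near by (intro power_mono) auto
    finally show ?thesis by (metis abs_le_square_iff abs_of_nonneg half_gt_zero_iff less_eq_real_def zero_less_one)
  qed
  have "ln (det P) = (\<Sum>i\<in>UNIV. ln (d i))"
    unfolding C(2) det_orthogonal_conj[OF C(1)] det_diag_mat using C(3) by (subst ln_prod) (auto simp: less_imp_neq[symmetric] order_less_imp_not_eq2)
  also have "\<dots> = (\<Sum>i\<in>UNIV. ln (1 + (d i - 1)) - (d i - 1))"
    using sd by (simp add: sum_subtractf)
  also have "\<bar>\<dots>\<bar> \<le> (\<Sum>i\<in>UNIV. \<bar>ln (1 + (d i - 1)) - (d i - 1)\<bar>)" by (rule sum_abs)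
  also have "\<dots> \<le> (\<Sum>i\<in>UNIV. 2 * (d i - 1)\<^sup>2)"
    by (intro sum_mono abs_ln_one_plus_x_minus_x_bound small)
  finally show ?thesis by (simp add: n sum_distrib_left)
qed

section \<open>Kronecker products and partial traces\<close>

lemma sum_UNIV_prod: "(\<Sum>a\<in>UNIV. f a) = (\<Sum>k\<in>UNIV. \<Sum>j\<in>UNIV. f (k, j))"
  for f :: "'a::finite \<times> 'b::finite \<Rightarrow> 'c::comm_monoid_add"
  by (subst sum.cartesian_product) simp

lemma kronecker_mult: "kronecker A B ** kronecker C D = kronecker (A ** C) (B ** D)"
  by (simp add: vec_eq_iff kronecker_def matrix_matrix_mult_def sum_UNIV_prod sum_product mult_ac)

lemma transpose_kronecker: "transpose (kronecker A B) = kronecker (transpose A) (transpose B)"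
  by (simp add: vec_eq_iff kronecker_def transpose_def)

lemma kronecker_mat_1 [simp]: "kronecker (mat 1) (mat 1) = mat 1"
  by (auto simp: vec_eq_iff kronecker_def mat_def)

lemma inner_kronecker: "kronecker A B \<bullet> kronecker C D = (A \<bullet> C) * (B \<bullet> D)"
proof -
  have "kronecker A B \<bullet> kronecker C D =
    (\<Sum>i\<in>UNIV. \<Sum>j\<in>UNIV. \<Sum>k\<in>UNIV. \<Sum>l\<in>UNIV. (A$i$k * C$i$k) * (B$j$l * D$j$l))"
    by (simp add: inner_vec_def kronecker_def sum_UNIV_prod mult_ac)
  also have "\<dots> = (\<Sum>i\<in>UNIV. \<Sum>j\<in>UNIV. (\<Sum>k\<in>UNIV. A$i$k * C$i$k) * (\<Sum>l\<in>UNIV. B$j$l * D$j$l))"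
    by (simp only: sum_product)
  also have "\<dots> = (A \<bullet> C) * (B \<bullet> D)"
    by (simp add: inner_vec_def sum_product)
  finally show ?thesis .
qed

lemma norm_kronecker: "norm (kronecker A B) = norm A * norm B"
  by (simp add: norm_eq_sqrt_inner inner_kronecker real_sqrt_mult)

lemma bounded_bilinear_kronecker:
  "bounded_bilinear (kronecker :: real^'n^'m \<Rightarrow> real^'l^'k \<Rightarrow> real^('n \<times> 'l)^('m \<times> 'k))"
proof
  show "\<exists>K. \<forall>(a::real^'n^'m) (b::real^'l^'k). norm (kronecker a b) \<le> norm a * norm b * K"
    by (rule exI[of _ 1]) (simp add: norm_kronecker)
qed (simp_all add: vec_eq_iff kronecker_def algebra_simps)

interpretation kr: bounded_bilinear "kronecker :: real^'n^'m \<Rightarrow> real^'l^'k \<Rightarrow> real^('n \<times> 'l)^('m \<times> 'k)"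
  by (rule bounded_bilinear_kronecker)

lemma matrix_inv_kronecker:
  assumes "det (A :: real^'n^'n) \<noteq> 0" "det (B :: real^'m^'m) \<noteq> 0"
  shows "matrix_inv (kronecker A B) = kronecker (matrix_inv A) (matrix_inv B)"
  by (rule matrix_inv_unique) (simp add: kronecker_mult matrix_inv_mult assms)

lemma det_kronecker_nz:
  assumes "det (A :: real^'n^'n) \<noteq> 0" "det (B :: real^'m^'m) \<noteq> 0"
  shows "det (kronecker A B) \<noteq> 0"
proof -
  have "kronecker A B ** kronecker (matrix_inv A) (matrix_inv B) = mat 1"
    by (simp add: kronecker_mult matrix_inv_mult assms)
  then show ?thesis by (metis det_I det_mul mult_zero_left zero_neq_one)
qed

lemma psd_kronecker:
  assumes "psd (A :: real^'n^'n)" "psd (B :: real^'m^'m)"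
  shows "psd (kronecker A B)"
proof -
  obtain C :: "real^'n^'n" where C: "A = C ** transpose C" using psd_factor[OF assms(1)] by blast
  obtain D :: "real^'m^'m" where D: "B = D ** transpose D" using psd_factor[OF assms(2)] by blast
  have "kronecker A B = kronecker C D ** transpose (kronecker C D)"
    by (simp only: C D transpose_kronecker kronecker_mult)
  then show ?thesis by (metis psd_mult_transpose)
qed

lemma spd_iff_psd_det: "spd (A :: real^'n^'n) \<longleftrightarrow> psd A \<and> det A \<noteq> 0"
proof
  assume "psd A \<and> det A \<noteq> 0"
  then have A: "psd A" "det A \<noteq> 0" by auto
  obtain C :: "real^'n^'n" where C: "A = C ** transpose C" using psd_factor[OF A(1)] by blast
  then have "det C \<noteq> 0" using A(2) by (auto simp: det_mul)
  from spd_congruence[OF spd_mat_1 this] show "spd A" by (simp add: C)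
qed (simp add: spd_imp_psd spd_det_nz)

lemma spd_kronecker:
  assumes "spd (A :: real^'n^'n)" "spd (B :: real^'m^'m)"
  shows "spd (kronecker A B)"
  using assms by (simp add: spd_iff_psd_det psd_kronecker det_kronecker_nz)

lemma kronecker_diag_mat: "kronecker (diag_mat a) (diag_mat b) = diag_mat (\<lambda>x. a (fst x) * b (snd x))"
  by (auto simp: vec_eq_iff kronecker_def diag_mat_def)

text \<open>The Kronecker product of the two eigenvector matrices diagonalizes the product, with the
  pairwise products of the eigenvalues on the diagonal.\<close>

lemma det_kronecker:
  assumes "spd (A :: real^'n^'n)" "spd (B :: real^'m^'m)"
  shows "det (kronecker A B) = det A ^ CARD('m) * det B ^ CARD('n)"
proof -
  obtain C a where C: "orthogonal_matrix C" "A = C ** diag_mat a ** transpose C"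
    using spectral_theorem[OF spd_symmetric[OF assms(1)]] by metis
  obtain D b where D: "orthogonal_matrix D" "B = D ** diag_mat b ** transpose D"
    using spectral_theorem[OF spd_symmetric[OF assms(2)]] by metis
  have o: "orthogonal_matrix (kronecker C D)"
    using C(1) D(1) by (simp add: orthogonal_matrix transpose_kronecker kronecker_mult)
  have "kronecker A B = kronecker C D ** kronecker (diag_mat a) (diag_mat b) ** transpose (kronecker C D)"
    by (simp add: C(2) D(2) transpose_kronecker kronecker_mult)
  then have "det (kronecker A B) = (\<Prod>x\<in>UNIV. a (fst x) * b (snd x))"
    by (simp only: det_orthogonal_conj[OF o] kronecker_diag_mat det_diag_mat)
  also have "\<dots> = (\<Prod>x\<in>UNIV \<times> UNIV. case x of (i, j) \<Rightarrow> a i * b j)"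
    by (simp add: case_prod_beta)
  also have "\<dots> = (\<Prod>i\<in>UNIV. \<Prod>j\<in>UNIV. a i * b j)"
    by (rule prod.cartesian_product[symmetric])
  also have "\<dots> = (\<Prod>i\<in>UNIV. a i) ^ CARD('m) * (\<Prod>j\<in>UNIV. b j) ^ CARD('n)"
    by (simp add: prod.distrib prod_power_distrib)
  finally show ?thesis
    by (simp add: C(2) D(2) det_orthogonal_conj[OF C(1)] det_orthogonal_conj[OF D(1)] det_diag_mat)
qed

section \<open>Partial traces and the estimating equations in terms of the covariance\<close>

definition ptrace_row :: "real^('q \<times> 'p)^('q \<times> 'p) \<Rightarrow> real^'q^'q \<Rightarrow> real^'p^'p" where
  "ptrace_row S K = (\<chi> j l. \<Sum>k\<in>UNIV. \<Sum>m\<in>UNIV. K $ k $ m * S $ (k, j) $ (m, l))"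

definition ptrace_col :: "real^('q \<times> 'p)^('q \<times> 'p) \<Rightarrow> real^'p^'p \<Rightarrow> real^'q^'q" where
  "ptrace_col S L = (\<chi> k m. \<Sum>j\<in>UNIV. \<Sum>l\<in>UNIV. L $ j $ l * S $ (k, j) $ (m, l))"

lemma bounded_bilinear_ptrace_row:
  "bounded_bilinear (ptrace_row :: real^('q::finite \<times> 'p::finite)^('q \<times> 'p) \<Rightarrow> _)"
  unfolding bilinear_conv_bounded_bilinear[symmetric] bilinear_def
  by (auto intro!: linearI simp: vec_eq_iff ptrace_row_def sum.distrib sum_distrib_left algebra_simps)

lemma bounded_bilinear_ptrace_col:
  "bounded_bilinear (ptrace_col :: real^('q::finite \<times> 'p::finite)^('q \<times> 'p) \<Rightarrow> _)"
  unfolding bilinear_conv_bounded_bilinear[symmetric] bilinear_def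
  by (auto intro!: linearI simp: vec_eq_iff ptrace_col_def sum.distrib sum_distrib_left algebra_simps)

interpretation ptr: bounded_bilinear "ptrace_row :: real^('q::finite \<times> 'p::finite)^('q \<times> 'p) \<Rightarrow> _"
  by (rule bounded_bilinear_ptrace_row)

interpretation ptc: bounded_bilinear "ptrace_col :: real^('q::finite \<times> 'p::finite)^('q \<times> 'p) \<Rightarrow> _"
  by (rule bounded_bilinear_ptrace_col)

text \<open>The partial trace with weight \<open>K\<close> is the adjoint of forming the Kronecker
  product with \<open>K\<close>. Equivariance, positivity and norm bounds of partial traces are all
  obtained by testing against matrices through this identity.\<close>

lemma inner_ptrace_row: "L \<bullet> ptrace_row S K = kronecker K L \<bullet> S"
proof -
  have "L \<bullet> ptrace_row S K = (\<Sum>j\<in>UNIV. \<Sum>l\<in>UNIV. \<Sum>k\<in>UNIV. \<Sum>m\<in>UNIV. L$j$l * (K$k$m * S $ (k, j) $ (m, l)))"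
    by (simp add: inner_vec_def ptrace_row_def sum_distrib_left)
  also have "\<dots> = (\<Sum>j\<in>UNIV. \<Sum>k\<in>UNIV. \<Sum>l\<in>UNIV. \<Sum>m\<in>UNIV. L$j$l * (K$k$m * S $ (k, j) $ (m, l)))"
    by (intro sum.cong sum.swap refl)
  also have "\<dots> = (\<Sum>k\<in>UNIV. \<Sum>j\<in>UNIV. \<Sum>l\<in>UNIV. \<Sum>m\<in>UNIV. L$j$l * (K$k$m * S $ (k, j) $ (m, l)))"
    by (rule sum.swap)
  also have "\<dots> = (\<Sum>k\<in>UNIV. \<Sum>j\<in>UNIV. \<Sum>m\<in>UNIV. \<Sum>l\<in>UNIV. L$j$l * (K$k$m * S $ (k, j) $ (m, l)))"
    by (intro sum.cong sum.swap refl)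
  finally show ?thesis
    by (simp add: inner_vec_def kronecker_def sum_UNIV_prod mult_ac)
qed

lemma inner_ptrace_col: "K \<bullet> ptrace_col S L = kronecker K L \<bullet> S"
proof -
  have "K \<bullet> ptrace_col S L = (\<Sum>k\<in>UNIV. \<Sum>m\<in>UNIV. \<Sum>j\<in>UNIV. \<Sum>l\<in>UNIV. K$k$m * (L$j$l * S $ (k, j) $ (m, l)))"
    by (simp add: inner_vec_def ptrace_col_def sum_distrib_left)
  also have "\<dots> = (\<Sum>k\<in>UNIV. \<Sum>j\<in>UNIV. \<Sum>m\<in>UNIV. \<Sum>l\<in>UNIV. K$k$m * (L$j$l * S $ (k, j) $ (m, l)))"
    by (intro sum.cong sum.swap refl)
  finally show ?thesis
    by (simp add: inner_vec_def kronecker_def sum_UNIV_prod mult_ac)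
qed

lemma matrix_eq_inner: "(\<And>L. L \<bullet> A = L \<bullet> B) \<Longrightarrow> A = (B :: real^'n^'m)"
  using vector_eq_ldot by blast

lemma ptrace_row_kronecker: "ptrace_row (kronecker B A) K = (K \<bullet> B) *\<^sub>R A"
  by (rule matrix_eq_inner) (simp add: inner_ptrace_row inner_kronecker)

lemma ptrace_col_kronecker: "ptrace_col (kronecker B A) L = (L \<bullet> A) *\<^sub>R B"
  by (rule matrix_eq_inner) (simp add: inner_ptrace_col inner_kronecker)

lemma inner_mat_1: "A \<bullet> mat 1 = trace (A :: real^'n^'n)" "mat 1 \<bullet> A = trace (A :: real^'n^'n)"
  by (simp_all add: inner_eq_trace)

lemma ptrace_row_mat_1: "ptrace_row (mat 1) K = trace K *\<^sub>R mat 1"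
  using ptrace_row_kronecker[of "mat 1" "mat 1" K] by (simp add: inner_mat_1)

lemma ptrace_col_mat_1: "ptrace_col (mat 1) L = trace L *\<^sub>R mat 1"
  using ptrace_col_kronecker[of "mat 1" "mat 1" L] by (simp add: inner_mat_1)

lemma inner_congruence_matrix:
  "(X :: real^'n^'n) \<bullet> (C ** Y ** transpose C) = (transpose C ** X ** C) \<bullet> Y" for C :: "real^'m^'n"
proof -
  have "X \<bullet> (C ** Y ** transpose C) = trace ((transpose X ** C ** Y) ** transpose C)"
    by (simp add: inner_eq_trace matrix_mul_assoc)
  also have "\<dots> = trace (transpose C ** (transpose X ** C ** Y))" by (rule trace_mul_sym)
  finally show ?thesis by (simp add: inner_eq_trace matrix_transpose_mul matrix_mul_assoc)
qed

text \<open>Moved to the other side of the inner product, the congruence acts on a Kronecker product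
  and acts factor by factor. This equivariance is what lets the fit follow affine changes of the
  data.\<close>

lemma ptrace_row_congruence:
  "ptrace_row (kronecker C2 C1 ** S ** transpose (kronecker C2 C1)) K
     = C1 ** ptrace_row S (transpose C2 ** K ** C2) ** transpose C1"
  by (rule matrix_eq_inner)
    (simp only: inner_ptrace_row inner_congruence_matrix, simp only: transpose_kronecker kronecker_mult)

lemma ptrace_col_congruence:
  "ptrace_col (kronecker C2 C1 ** S ** transpose (kronecker C2 C1)) L
     = C2 ** ptrace_col S (transpose C1 ** L ** C1) ** transpose C2"
  by (rule matrix_eq_inner)
    (simp only: inner_ptrace_col inner_congruence_matrix, simp only: transpose_kronecker kronecker_mult)

lemma transpose_ptrace_row: "transpose (ptrace_row S K) = ptrace_row (transpose S) (transpose K)"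
  by (simp add: vec_eq_iff ptrace_row_def transpose_def) (intro allI sum.swap)

lemma transpose_ptrace_col: "transpose (ptrace_col S L) = ptrace_col (transpose S) (transpose L)"
  by (simp add: vec_eq_iff ptrace_col_def transpose_def) (intro allI sum.swap)

lemma inner_outer: "outer x \<bullet> A = x \<bullet> (A *v x)"
  by (simp add: inner_vec_def outer_def matrix_vector_mult_def sum_distrib_left mult_ac)

lemma transpose_outer [simp]: "transpose (outer x) = outer x"
  by (simp add: vec_eq_iff transpose_def outer_def mult.commute)

lemma psd_outer: "psd (outer (x :: real^'n))"
proof -
  have "y \<bullet> (outer x *v y) = (x \<bullet> y)\<^sup>2" for y
    unfolding inner_outer[symmetric]
    by (simp add: inner_vec_def outer_def power2_eq_square sum_product mult_ac)
  then show ?thesis by (simp add: psd_def)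
qed

lemma trace_outer [simp]: "trace (outer x) = x \<bullet> x"
  by (simp add: trace_def outer_def inner_vec_def)

lemma psd_inner_nonneg:
  assumes "psd (A :: real^'n^'n)" "psd B"
  shows "0 \<le> A \<bullet> B"
proof -
  obtain C :: "real^'n^'n" where C: "A = C ** transpose C" using psd_factor[OF assms(1)] by blast
  have "A \<bullet> B = mat 1 \<bullet> (transpose C ** B ** transpose (transpose C))"
    unfolding inner_congruence_matrix by (simp add: C)
  also have "\<dots> \<ge> 0"
  proof -
    obtain D :: "real^'n^'n" where D: "B = D ** transpose D" using psd_factor[OF assms(2)] by blast
    have "transpose C ** B ** transpose (transpose C) = (transpose C ** D) ** transpose (transpose C ** D)"
      by (simp add: D matrix_transpose_mul matrix_mul_assoc)
    then show ?thesis by (metis inner_mat_1(2) psd_mult_transpose psd_trace_nonneg)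
  qed
  finally show ?thesis .
qed

lemma psd_diff_iff: "psd (A - B) \<longleftrightarrow> transpose (A - B) = A - B \<and> (\<forall>x. x \<bullet> (B *v x) \<le> x \<bullet> (A *v x))"
  unfolding psd_def by (simp add: inner_outer[symmetric] inner_diff_right)

text \<open>The constant is the minimum of the quadratic form on the compact unit sphere, extended
  to all vectors by homogeneity.\<close>

lemma spd_lower_bound:
  assumes "spd (S :: real^'n^'n)"
  obtains e where "e > 0" "psd (S - e *\<^sub>R mat 1)"
proof -
  let ?K = "sphere 0 1 :: (real^'n) set"
  have "compact ?K" by simp
  moreover have "?K \<noteq> {}" by (simp add: sphere_eq_empty)
  moreover have "continuous_on ?K (\<lambda>x. x \<bullet> (S *v x))"
    by (intro continuous_intros matrix_vector_mult_linear_continuous_on)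
  ultimately obtain x where x: "x \<in> ?K" and mn: "\<And>y. y \<in> ?K \<Longrightarrow> x \<bullet> (S *v x) \<le> y \<bullet> (S *v y)"
    using continuous_attains_inf by (metis (no_types, lifting))
  define e where "e = x \<bullet> (S *v x)"
  have "x \<noteq> 0" using x by auto
  then have "e > 0" using assms by (simp add: e_def spd_def)
  moreover have "e * (y \<bullet> y) \<le> y \<bullet> (S *v y)" for y
  proof (cases "y = 0")
    case False
    have "e \<le> ((1 / norm y) *\<^sub>R y) \<bullet> (S *v ((1 / norm y) *\<^sub>R y))"
      unfolding e_def by (rule mn) (use False in auto)
    also have "\<dots> = (y \<bullet> (S *v y)) / (y \<bullet> y)"
      by (simp add: matrix_vector_mult_scaleR power2_norm_eq_inner [symmetric] power2_eq_square)
    finally show ?thesis using False by (simp add: le_divide_eq)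
  qed simp
  then have "psd (S - e *\<^sub>R mat 1)"
    unfolding psd_diff_iff
    by (simp add: transpose_diff transpose_scalar spd_symmetric[OF assms] scaleR_matrix_vector_assoc[symmetric])
  ultimately show ?thesis using that by blast
qed

text \<open>Quantitative positivity that remains valid for singular \<open>K\<close> and
  \<open>L\<close>. It keeps the estimating maps positive definite at boundary points of the
  semidefinite cone and decides the equality case in the uniqueness proof.\<close>

lemma inner_kronecker_lower_bound:
  assumes "psd (S - e *\<^sub>R mat 1)" "psd K" "psd L"
  shows "e * (trace K * trace L) \<le> kronecker K L \<bullet> S"
proof -
  have "0 \<le> kronecker K L \<bullet> (S - e *\<^sub>R mat 1)"
    using assms by (intro psd_inner_nonneg psd_kronecker)
  moreover have "kronecker K L \<bullet> mat 1 = trace K * trace L"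
    using inner_kronecker[of K L "mat 1" "mat 1"] by (simp add: inner_mat_1)
  ultimately show ?thesis by (simp add: inner_diff_right)
qed

lemma spd_ptrace_row:
  assumes S: "spd S" and K: "psd K" "0 < trace K"
  shows "spd (ptrace_row S K)"
  unfolding spd_def
proof (intro conjI allI impI)
  show "transpose (ptrace_row S K) = ptrace_row S K"
    using S K by (simp add: transpose_ptrace_row spd_symmetric psdD)
  obtain e where e: "e > 0" "psd (S - e *\<^sub>R mat 1)" using spd_lower_bound[OF S] .
  fix x :: "real^'b" assume "x \<noteq> 0"
  then have "0 < e * (trace K * trace (outer x))" using e K by (simp add: inner_gt_zero_iff)
  also have "\<dots> \<le> x \<bullet> (ptrace_row S K *v x)"
    unfolding inner_outer[symmetric] inner_ptrace_row
    by (rule inner_kronecker_lower_bound[OF e(2) K(1) psd_outer])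
  finally show "0 < x \<bullet> (ptrace_row S K *v x)" .
qed

lemma spd_ptrace_col:
  assumes S: "spd S" and L: "psd L" "0 < trace L"
  shows "spd (ptrace_col S L)"
  unfolding spd_def
proof (intro conjI allI impI)
  show "transpose (ptrace_col S L) = ptrace_col S L"
    using S L by (simp add: transpose_ptrace_col spd_symmetric psdD)
  obtain e where e: "e > 0" "psd (S - e *\<^sub>R mat 1)" using spd_lower_bound[OF S] .
  fix x :: "real^'a" assume "x \<noteq> 0"
  then have "0 < e * (trace (outer x) * trace L)" using e L by (simp add: inner_gt_zero_iff)
  also have "\<dots> \<le> x \<bullet> (ptrace_col S L *v x)"
    unfolding inner_outer[symmetric] inner_ptrace_col
    by (rule inner_kronecker_lower_bound[OF e(2) psd_outer L(1)])
  finally show "0 < x \<bullet> (ptrace_col S L *v x)" .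
qed

definition separable_fit ::
  "real^('q \<times> 'p)^('q \<times> 'p) \<Rightarrow> real^'p^'p \<Rightarrow> real^'q^'q \<Rightarrow> bool" where
  "separable_fit S A B \<longleftrightarrow> spd A \<and> spd B \<and>
     real CARD('q) *\<^sub>R A = ptrace_row S (matrix_inv B) \<and>
     real CARD('p) *\<^sub>R B = ptrace_col S (matrix_inv A)"

lemma ptrace_row_outer: "ptrace_row (outer (vec_cols D)) K = D ** K ** transpose D"
proof -
  have "(\<Sum>k\<in>UNIV. \<Sum>m\<in>UNIV. K $ k $ m * (D $ j $ k * D $ l $ m)) =
        (\<Sum>m\<in>UNIV. (\<Sum>k\<in>UNIV. D $ j $ k * K $ k $ m) * D $ l $ m)" for j l
    by (subst sum.swap) (simp add: sum_distrib_right sum_distrib_left mult_ac)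
  then show ?thesis
    by (simp add: vec_eq_iff ptrace_row_def outer_def vec_cols_def matrix_matrix_mult_def transpose_def)
qed

lemma ptrace_col_outer: "ptrace_col (outer (vec_cols D)) L = transpose D ** L ** D"
proof -
  have "(\<Sum>j\<in>UNIV. \<Sum>l\<in>UNIV. L $ j $ l * (D $ j $ k * D $ l $ m)) =
        (\<Sum>l\<in>UNIV. (\<Sum>j\<in>UNIV. D $ j $ k * L $ j $ l) * D $ l $ m)" for k m
    by (subst sum.swap) (simp add: sum_distrib_right sum_distrib_left mult_ac)
  then show ?thesis
    by (simp add: vec_eq_iff ptrace_col_def outer_def vec_cols_def matrix_matrix_mult_def transpose_def)
qed

text \<open>Partial traces are linear and send the outer product of \<open>vec_cols D\<close> to
  \<open>D ** K ** transpose D\<close>, so the sample enters the equations only through its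
  covariance.\<close>

lemma separable_solution_iff:
  fixes X :: "nat \<Rightarrow> real^'q^'p"
  assumes "n > 0"
  shows "separable_solution X n A B \<longleftrightarrow> separable_fit (sample_cov X n) A B"
proof -
  have 1: "ptrace_row (sample_cov X n) K = (1 / real n) *\<^sub>R
     (\<Sum>i<n. (X i - sample_mean X n) ** K ** transpose (X i - sample_mean X n))" for K
    by (simp add: sample_cov_def ptr.scaleR_left ptr.sum_left ptrace_row_outer)
  have 2: "ptrace_col (sample_cov X n) L = (1 / real n) *\<^sub>R
     (\<Sum>i<n. transpose (X i - sample_mean X n) ** L ** (X i - sample_mean X n))" for L
    by (simp add: sample_cov_def ptc.scaleR_left ptc.sum_left ptrace_col_outer)
  have 3: "(C = (1 / (real n * c)) *\<^sub>R Y) = (c *\<^sub>R C = (1 / real n) *\<^sub>R Y)" if "c > 0"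
    for C Y :: "real^'m^'m" and c
  proof -
    have "(1 / (real n * c)) *\<^sub>R Y = (1 / c) *\<^sub>R ((1 / real n) *\<^sub>R Y)" by (simp add: mult.commute)
    then show ?thesis using that
      by (auto dest: arg_cong[where f = "\<lambda>v. (1 / c) *\<^sub>R v"])
  qed
  show ?thesis unfolding separable_solution_def separable_fit_def 1 2
    by (simp add: 3)
qed

section \<open>The separable estimating equations\<close>

definition separability_stat :: "real^'n^'n \<Rightarrow> real^'n^'n \<Rightarrow> real" where
  "separability_stat S T =
     trace ((((det S / det T) powr (1 / real CARD('n))) *\<^sub>R (matrix_inv S ** T) - mat 1) **
            (((det S / det T) powr (1 / real CARD('n))) *\<^sub>R (matrix_inv S ** T) - mat 1))"

text \<open>The expanded square involves only traces of \<open>X Y\<close> and of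
  \<open>X Y X Y\<close>, which are cyclic. This is the passage between the symmetric
  \<open>V\<close> and a similar matrix that contains no square root.\<close>

lemma trace_square_commute:
  fixes X Y :: "real^'n^'n"
  shows "trace ((c *\<^sub>R (X ** Y) - mat 1) ** (c *\<^sub>R (X ** Y) - mat 1)) =
    trace ((c *\<^sub>R (Y ** X) - mat 1) ** (c *\<^sub>R (Y ** X) - mat 1))"
proof -
  have *: "trace ((c *\<^sub>R (X ** Y) - mat 1) ** (c *\<^sub>R (X ** Y) - mat 1)) =
    c * c * trace (X ** Y ** (X ** Y)) - 2 * c * trace (X ** Y) + trace (mat 1 :: real^'n^'n)" for X Y :: "real^'n^'n"
    by (simp add: mm.diff_left mm.diff_right trace_sub mm.scaleR_left mm.scaleR_right) (simp add: algebra_simps)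
  have "trace (X ** Y ** (X ** Y)) = trace (Y ** X ** (Y ** X))"
    by (metis matrix_mul_assoc trace_mul_sym)
  moreover have "trace (X ** Y) = trace (Y ** X)" by (rule trace_mul_sym)
  ultimately show ?thesis unfolding * by simp
qed

lemma CARD_pos_real: "0 < real CARD('n::finite)"
  by (simp add: card_gt_0_iff)

lemma matrix_inv_scaleR:
  assumes "det (A :: real^'n^'n) \<noteq> 0" "c \<noteq> 0"
  shows "matrix_inv (c *\<^sub>R A) = (1 / c) *\<^sub>R matrix_inv A"
  by (rule matrix_inv_unique) (simp add: mm.scaleR_left mm.scaleR_right matrix_inv_mult assms)

text \<open>\<open>V\<close> is \<open>a b W T W\<close> with \<open>W\<close> the inverse root of
  \<open>c S\<close>. Cyclicity brings the two copies of \<open>W\<close> together and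
  \<open>W W\<close> is \<open>S^-1 / c\<close>, so no root survives. The three determinant factors
  merge into one power because \<open>det (kronecker B A)\<close> is
  \<open>det B^p det A^q\<close>.\<close>

lemma norm_separability_matrix:
  fixes S :: "real^('q::finite \<times> 'p::finite)^('q \<times> 'p)"
  assumes S: "spd S" and A: "spd A" and B: "spd B"
  shows "(norm (separability_matrix S A B - mat 1))\<^sup>2 = separability_stat S (kronecker B A)"
proof -
  let ?N = "real CARD('q \<times> 'p)"
  let ?T = "kronecker B A"
  define a where "a = 1 / det A powr (1 / real CARD('p))"
  define b where "b = 1 / det B powr (1 / real CARD('q))"
  define c where "c = 1 / det S powr (1 / ?N)"
  have pos: "0 < det A" "0 < det B" "0 < det S" using assms by (auto intro: spd_det_pos)
  have abc: "0 < a" "0 < b" "0 < c" using pos by (auto simp: a_def b_def c_def)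
  have cS: "spd (c *\<^sub>R S)" using S abc by (intro spd_scaleR)
  let ?W = "mat_inv_sqrt (c *\<^sub>R S)"
  note W = mat_inv_sqrt[OF cS]
  have kappa: "a * b / c = (det S / det ?T) powr (1 / ?N)"
  proof -
    have N: "?N = real CARD('q) * real CARD('p)" by simp
    have "det ?T powr (1 / ?N) = (det B ^ CARD('p)) powr (1 / ?N) * (det A ^ CARD('q)) powr (1 / ?N)"
      using pos by (simp add: det_kronecker[OF B A] powr_mult)
    also have "\<dots> = det B powr (1 / real CARD('q)) * det A powr (1 / real CARD('p))"
      using pos by (simp add: powr_realpow[symmetric] powr_powr N del: powr_realpow)
    finally show ?thesis
      using pos by (simp add: a_def b_def c_def powr_divide)
  qed
  have V: "separability_matrix S A B = (a * b) *\<^sub>R (?W ** ?T ** ?W)"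
    unfolding separability_matrix_def det_normalize_def a_def[symmetric] b_def[symmetric] c_def[symmetric]
    by (simp only: kr.scaleR_left kr.scaleR_right mm.scaleR_left mm.scaleR_right scaleR_scaleR mult.commute)
  have symT: "transpose ?T = ?T" using A B by (simp add: transpose_kronecker spd_symmetric)
  have symV: "transpose (separability_matrix S A B - mat 1) = separability_matrix S A B - mat 1"
    by (simp add: V transpose_diff transpose_scalar matrix_transpose_mul symT spd_symmetric[OF W(1)] matrix_mul_assoc)
  have "(norm (separability_matrix S A B - mat 1))\<^sup>2
      = trace ((separability_matrix S A B - mat 1) ** (separability_matrix S A B - mat 1))"
    by (simp only: power2_norm_eq_inner inner_eq_trace symV)
  also have "\<dots> = trace (((a * b) *\<^sub>R (?W ** (?W ** ?T)) - mat 1) ** ((a * b) *\<^sub>R (?W ** (?W ** ?T)) - mat 1))"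
    unfolding V by (rule trace_square_commute)
  also have "?W ** (?W ** ?T) = (1 / c) *\<^sub>R (matrix_inv S ** ?T)"
    using abc by (simp add: matrix_mul_assoc W(2) matrix_inv_scaleR spd_det_nz[OF S] mm.scaleR_left)
  also have "(a * b) *\<^sub>R ((1 / c) *\<^sub>R (matrix_inv S ** ?T)) = ((det S / det ?T) powr (1 / ?N)) *\<^sub>R (matrix_inv S ** ?T)"
    by (simp only: kappa[symmetric] scaleR_scaleR) simp
  finally show ?thesis unfolding separability_stat_def .
qed

text \<open>The congruence replaces \<open>S^-1 T\<close> by a similar matrix and multiplies both
  determinants by the same factor.\<close>

lemma separability_stat_congruence:
  fixes S T C :: "real^'n^'n"
  assumes S: "det S \<noteq> 0" and C: "det C \<noteq> 0"
  shows "separability_stat (C ** S ** transpose C) (C ** T ** transpose C) = separability_stat S T"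
proof -
  have i: "matrix_inv (C ** S ** transpose C) = transpose (matrix_inv C) ** matrix_inv S ** matrix_inv C"
  proof (rule matrix_inv_unique)
    have "C ** S ** transpose C ** (transpose (matrix_inv C) ** matrix_inv S ** matrix_inv C)
      = C ** S ** (transpose C ** transpose (matrix_inv C)) ** matrix_inv S ** matrix_inv C"
      by (simp only: matrix_mul_assoc)
    also have "transpose C ** transpose (matrix_inv C) = mat 1"
      by (simp add: matrix_transpose_mul[symmetric] matrix_inv_mult C)
    also have "C ** S ** mat 1 ** matrix_inv S ** matrix_inv C = C ** (S ** matrix_inv S) ** matrix_inv C"
      by (simp add: matrix_mul_assoc)
    finally show "C ** S ** transpose C ** (transpose (matrix_inv C) ** matrix_inv S ** matrix_inv C) = mat 1"
      by (simp add: matrix_inv_mult S C)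
  qed
  have d: "det (C ** S ** transpose C) / det (C ** T ** transpose C) = det S / det T"
    using C by (simp add: det_mul)
  let ?X = "transpose (matrix_inv C)" and ?Y = "matrix_inv S ** T ** transpose C"
  have e1: "matrix_inv (C ** S ** transpose C) ** (C ** T ** transpose C) = ?X ** ?Y"
  proof -
    have "matrix_inv (C ** S ** transpose C) ** (C ** T ** transpose C)
      = ?X ** matrix_inv S ** (matrix_inv C ** C) ** T ** transpose C"
      by (simp only: i matrix_mul_assoc)
    then show ?thesis by (simp add: matrix_inv_mult C matrix_mul_assoc)
  qed
  have e2: "?Y ** ?X = matrix_inv S ** T"
  proof -
    have "?Y ** ?X = matrix_inv S ** T ** (transpose C ** ?X)" by (simp only: matrix_mul_assoc)
    also have "transpose C ** ?X = mat 1"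
      by (simp add: matrix_transpose_mul[symmetric] matrix_inv_mult C)
    finally show ?thesis by simp
  qed
  show ?thesis
    unfolding separability_stat_def d e1 trace_square_commute[of _ ?X ?Y] e2 ..
qed

lemma separable_fit_congruence:
  fixes S :: "real^('q::finite \<times> 'p::finite)^('q \<times> 'p)"
  assumes fit: "separable_fit S A B" and C1: "det C1 \<noteq> 0" and C2: "det C2 \<noteq> 0"
  shows "separable_fit (kronecker C2 C1 ** S ** transpose (kronecker C2 C1))
     (C1 ** A ** transpose C1) (C2 ** B ** transpose C2)"
proof -
  have *: "transpose C ** matrix_inv (C ** A ** transpose C) ** C = matrix_inv A"
    if "spd A" "det C \<noteq> 0" for A C :: "real^'n^'n"
  proof (rule matrix_inv_unique[symmetric])
    let ?J = "matrix_inv (C ** A ** transpose C)"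
    have "C ** (A ** (transpose C ** ?J ** C)) = (C ** A ** transpose C) ** ?J ** C"
      by (simp only: matrix_mul_assoc)
    also have "\<dots> = C" using that by (simp add: matrix_inv_mult det_mul spd_det_nz)
    finally have "matrix_inv C ** (C ** (A ** (transpose C ** ?J ** C))) = matrix_inv C ** C" by simp
    then show "A ** (transpose C ** ?J ** C) = mat 1"
      using that by (simp add: matrix_mul_assoc matrix_inv_mult)
  qed
  have eqs: "ptrace_row S (matrix_inv B) = real CARD('q) *\<^sub>R A" "ptrace_col S (matrix_inv A) = real CARD('p) *\<^sub>R B"
    and "spd A" "spd B" using fit by (auto simp: separable_fit_def)
  then show ?thesis
    using C1 C2 unfolding separable_fit_def ptrace_row_congruence ptrace_col_congruence
    by (simp add: * spd_congruence mm.scaleR_left mm.scaleR_right)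
qed

text \<open>With \<open>y = Q^-1 x\<close> and \<open>z = P^-1 x\<close>, expanding
  \<open>0 \<le> (z - y) \<bullet> P (z - y)\<close> and using
  \<open>y \<bullet> P y \<le> y \<bullet> Q y = y \<bullet> x\<close> leaves
  \<open>y \<bullet> x \<le> z \<bullet> x\<close>.\<close>

lemma matrix_inv_antimono:
  fixes P Q :: "real^'n^'n"
  assumes P: "spd P" and Q: "spd Q" and le: "psd (Q - P)"
  shows "psd (matrix_inv P - matrix_inv Q)"
  unfolding psd_diff_iff
proof (intro conjI allI)
  show "transpose (matrix_inv P - matrix_inv Q) = matrix_inv P - matrix_inv Q"
    using P Q by (simp add: transpose_diff spd_matrix_inv spd_symmetric)
  fix x :: "real^'n"
  define y where "y = matrix_inv Q *v x"
  define z where "z = matrix_inv P *v x"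
  have Qy: "Q *v y = x" and Pz: "P *v z = x"
    by (simp_all add: y_def z_def matrix_vector_mul_assoc matrix_inv_mult spd_det_nz P Q)
  have "0 \<le> (z - y) \<bullet> (P *v (z - y))" using P by (simp add: psdD(2) spd_imp_psd)
  also have "\<dots> = z \<bullet> x - 2 * (y \<bullet> x) + y \<bullet> (P *v y)"
    using inner_matrix_vector_symmetric[OF spd_symmetric[OF P], of z y]
    by (simp add: matrix_vector_mult_diff_distrib inner_diff_left inner_diff_right Pz inner_commute)
  also have "y \<bullet> (P *v y) \<le> y \<bullet> (Q *v y)" using le by (simp add: psd_diff_iff)
  finally show "x \<bullet> (matrix_inv Q *v x) \<le> x \<bullet> (matrix_inv P *v x)"
    by (simp add: Qy y_def[symmetric] z_def[symmetric] inner_commute)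
qed

lemma psd_ptrace_row:
  assumes S: "psd S" and K: "psd K"
  shows "psd (ptrace_row S K)"
  unfolding psd_def inner_outer[symmetric] inner_ptrace_row
  using S K by (simp add: transpose_ptrace_row psdD psd_inner_nonneg psd_kronecker psd_outer)

lemma psd_trace_0: "psd A \<Longrightarrow> trace A \<le> 0 \<Longrightarrow> A = 0"
  using psd_norm_le_trace[of A] by (metis norm_le_zero_iff order_trans)

text \<open>The scalar is the minimum of the quotient of the two quadratic forms over the unit
  sphere; at a minimizer the form of the difference vanishes.\<close>

lemma spd_largest_scalar:
  fixes B B' :: "real^'n^'n"
  assumes B: "spd B" and B': "spd B'"
  obtains \<mu> x where "\<mu> > 0" "x \<noteq> 0" "psd (B' - \<mu> *\<^sub>R B)" "x \<bullet> ((B' - \<mu> *\<^sub>R B) *v x) = 0"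
proof -
  let ?K = "sphere 0 1 :: (real^'n) set"
  let ?f = "\<lambda>x. (x \<bullet> (B' *v x)) / (x \<bullet> (B *v x))"
  have pos: "0 < x \<bullet> (B *v x)" "0 < x \<bullet> (B' *v x)" if "x \<noteq> 0" for x using B B' that by (auto simp: spd_def)
  have nz: "x \<noteq> 0" if "x \<in> ?K" for x using that by auto
  have "compact ?K" by simp
  moreover have "?K \<noteq> {}" by (simp add: sphere_eq_empty)
  moreover have "continuous_on ?K ?f"
    using pos nz by (intro continuous_intros matrix_vector_mult_linear_continuous_on) (metis less_irrefl)
  ultimately obtain x where x: "x \<in> ?K" and mn: "\<And>y. y \<in> ?K \<Longrightarrow> ?f x \<le> ?f y"
    using continuous_attains_inf by (metis (no_types, lifting))
  have x0: "x \<noteq> 0" by (rule nz[OF x])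
  have sym: "transpose (B' - ?f x *\<^sub>R B) = B' - ?f x *\<^sub>R B"
    by (simp add: transpose_diff transpose_scalar spd_symmetric[OF B] spd_symmetric[OF B'])
  have "?f x * (y \<bullet> (B *v y)) \<le> y \<bullet> (B' *v y)" for y
  proof (cases "y = 0")
    case False
    have "?f x \<le> ?f ((1 / norm y) *\<^sub>R y)" by (rule mn) (use False in auto)
    also have "\<dots> = ?f y" using False by (simp add: matrix_vector_mult_scaleR)
    finally show ?thesis using pos(1)[OF False] by (simp add: le_divide_eq)
  qed simp
  then have "psd (B' - ?f x *\<^sub>R B)"
    unfolding psd_diff_iff using sym by (simp add: scaleR_matrix_vector_assoc[symmetric])
  moreover have "x \<bullet> ((B' - ?f x *\<^sub>R B) *v x) = 0"
    using pos(1)[OF x0] by (simp add: matrix_vector_mult_diff_rdistrib inner_diff_right scaleR_matrix_vector_assoc[symmetric])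
  moreover have "?f x > 0" using pos[OF x0] by simp
  ultimately show ?thesis using that x0 by blast
qed

text \<open>If \<open>\<mu>\<close> is the largest number with \<open>\<mu> B \<le> B'\<close>, passing through both equations reproduces this
  inequality, and equality in one direction forces equality throughout.\<close>

lemma separable_fit_unique:
  fixes S :: "real^('q::finite \<times> 'p::finite)^('q \<times> 'p)"
  assumes S: "spd S" and fit: "separable_fit S A B" and fit': "separable_fit S A' B'"
  shows "kronecker B' A' = kronecker B A"
proof -
  let ?p = "real CARD('p)" and ?q = "real CARD('q)"
  have spd: "spd A" "spd B" "spd A'" "spd B'" using fit fit' by (auto simp: separable_fit_def)
  have eqs: "ptrace_row S (matrix_inv B) = ?q *\<^sub>R A" "ptrace_col S (matrix_inv A) = ?p *\<^sub>R B"
    "ptrace_row S (matrix_inv B') = ?q *\<^sub>R A'" "ptrace_col S (matrix_inv A') = ?p *\<^sub>R B'"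
    using fit fit' by (auto simp: separable_fit_def)
  obtain \<mu> x where \<mu>: "\<mu> > 0" "x \<noteq> 0" "psd (B' - \<mu> *\<^sub>R B)" "x \<bullet> ((B' - \<mu> *\<^sub>R B) *v x) = 0"
    using spd_largest_scalar spd by blast
  obtain e where e: "e > 0" "psd (S - e *\<^sub>R mat 1)" using spd_lower_bound[OF S] .
  \<comment> \<open>Inversion reverses \<open>\<mu> B \<le> B'\<close>, the row equation is monotone
    and transfers the result to \<open>A\<close> and \<open>A'\<close>, and a second inversion makes
    \<open>?R\<close> positive semidefinite.\<close>
  have "psd (matrix_inv (\<mu> *\<^sub>R B) - matrix_inv B')"
    using spd \<mu> by (intro matrix_inv_antimono spd_scaleR)
  then have "psd ((1 / \<mu>) *\<^sub>R matrix_inv B - matrix_inv B')"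
    using \<mu> spd by (simp add: matrix_inv_scaleR spd_det_nz)
  then have "psd (ptrace_row S ((1 / \<mu>) *\<^sub>R matrix_inv B - matrix_inv B'))"
    using S by (simp add: psd_ptrace_row spd_imp_psd)
  also have "ptrace_row S ((1 / \<mu>) *\<^sub>R matrix_inv B - matrix_inv B') = ?q *\<^sub>R ((1 / \<mu>) *\<^sub>R A - A')"
    by (simp add: ptr.diff_right ptr.scaleR_right eqs scaleR_diff_right)
  finally have "psd ((1 / ?q) *\<^sub>R (?q *\<^sub>R ((1 / \<mu>) *\<^sub>R A - A')))"
    by (rule psd_scaleR) simp
  then have "psd ((1 / \<mu>) *\<^sub>R A - A')" by simp
  then have "psd (matrix_inv A' - matrix_inv ((1 / \<mu>) *\<^sub>R A))"
    using spd \<mu> by (intro matrix_inv_antimono spd_scaleR) auto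
  then have R: "psd (matrix_inv A' - \<mu> *\<^sub>R matrix_inv A)" (is "psd ?R")
    using \<mu> spd by (simp add: matrix_inv_scaleR spd_det_nz)
  have "ptrace_col S ?R = ?p *\<^sub>R (B' - \<mu> *\<^sub>R B)"
    by (simp add: ptc.diff_right ptc.scaleR_right eqs scaleR_diff_right mult.commute)
  \<comment> \<open>At the vector \<open>x\<close> the column equation gives 0, whereas the lower
    bound \<open>e\<close> on \<open>S\<close> makes the same quantity at least a positive multiple
    of the trace of \<open>?R\<close>. A semidefinite matrix without trace vanishes.\<close>
  then have "0 = outer x \<bullet> ptrace_col S ?R"
    by (simp only: inner_scaleR_right inner_outer \<mu>(4))
  also have "\<dots> \<ge> e * (trace (outer x) * trace ?R)"
    unfolding inner_ptrace_col by (rule inner_kronecker_lower_bound[OF e(2) psd_outer R])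
  finally have "e * ((x \<bullet> x) * trace ?R) \<le> 0" by simp
  moreover have "0 < x \<bullet> x" using \<mu>(2) by (simp add: inner_gt_zero_iff)
  ultimately have "trace ?R \<le> 0"
    using e(1) by (metis mult_pos_pos not_less)
  then have "?R = 0" using psd_trace_0 R by blast
  then have iA: "matrix_inv A' = \<mu> *\<^sub>R matrix_inv A" by simp
  then have "matrix_inv (matrix_inv A') = (1 / \<mu>) *\<^sub>R matrix_inv (matrix_inv A)"
    using \<mu> spd by (simp add: matrix_inv_scaleR spd_det_nz spd_matrix_inv)
  moreover have "matrix_inv (matrix_inv X) = X" if "spd X" for X :: "real^'p^'p"
    using that by (intro matrix_inv_unique) (simp add: matrix_inv_mult spd_det_nz)
  ultimately have A': "A' = (1 / \<mu>) *\<^sub>R A" using spd by simp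
  have "?p *\<^sub>R B' = ?p *\<^sub>R (\<mu> *\<^sub>R B)"
    using eqs(4) by (simp add: iA ptc.scaleR_right eqs(2) mult.commute)
  then have "B' = \<mu> *\<^sub>R B" unfolding scaleR_cancel_left by simp
  then show ?thesis using A' \<mu>(1) by (simp add: kr.scaleR_left kr.scaleR_right)
qed

section \<open>Continuity of inversion and the compact set of normalized precision matrices\<close>

lemma continuous_on_vec_lambda2:
  "(\<And>i j. continuous_on S (\<lambda>x. f x i j)) \<Longrightarrow> continuous_on S (\<lambda>x. \<chi> i j. f x i j)"
  by (intro continuous_on_vec_lambda)

lemma continuous_on_det:
  assumes "continuous_on S (f :: 'a::topological_space \<Rightarrow> real^'n^'n)"
  shows "continuous_on S (\<lambda>x. det (f x))"
  unfolding det_def by (intro continuous_intros assms)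

text \<open>Cramer's rule applied to each column of the inverse. It displays the entries as
  quotients of polynomials, from which continuity is evident.\<close>

lemma matrix_inv_cramer:
  assumes "det (A :: real^'n^'n) \<noteq> 0"
  shows "matrix_inv A = (\<chi> k l. det (\<chi> i j. if j = k then (if i = l then 1 else 0) else A $ i $ j) / det A)"
proof (rule matrix_inv_unique)
  have "(A ** matrix_inv A) = mat 1" using assms by (rule matrix_inv_mult)
  then have "A *v column l (matrix_inv A) = axis l 1" for l
    by (simp add: vec_eq_iff matrix_matrix_mult_def matrix_vector_mult_def column_def mat_def axis_def)
  then have "column l (matrix_inv A) = (\<chi> k. det (\<chi> i j. if j = k then axis l 1 $ i else A $ i $ j) / det A)" for l
    using cramer[OF assms] by blast
  then have "(\<chi> k l. det (\<chi> i j. if j = k then (if i = l then 1 else 0) else A $ i $ j) / det A) = matrix_inv A"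
    by (simp add: vec_eq_iff column_def axis_def cong: if_cong)
  then show "A ** (\<chi> k l. det (\<chi> i j. if j = k then (if i = l then 1 else 0) else A $ i $ j) / det A) = mat 1"
    using matrix_inv_mult(2)[OF assms] by simp
qed

lemma continuous_on_matrix_inv:
  assumes f: "continuous_on S (f :: 'a::topological_space \<Rightarrow> real^'n^'n)" and nz: "\<And>x. x \<in> S \<Longrightarrow> det (f x) \<noteq> 0"
  shows "continuous_on S (\<lambda>x. matrix_inv (f x))"
proof -
  have "continuous_on S (\<lambda>x. \<chi> k l. det (\<chi> i j. if j = k then (if i = l then 1 else 0) else f x $ i $ j) / det (f x))"
  proof (intro continuous_on_vec_lambda2 continuous_on_divide continuous_on_det f)
    fix k l i j
    show "continuous_on S (\<lambda>x. if j = k then if i = l then 1 else 0 else f x $ i $ j)"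
      by (cases "j = k") (auto intro!: continuous_intros f)
  qed (use nz in auto)
  then show ?thesis
    by (rule continuous_on_eq) (simp add: matrix_inv_cramer nz)
qed

lemma closed_psd: "closed {A :: real^'n^'n. psd A}"
proof -
  have "{A :: real^'n^'n. psd A} = {A. transpose A = A} \<inter> (\<Inter>x. {A. 0 \<le> outer x \<bullet> A})"
    by (auto simp: psd_def inner_outer)
  also have "closed \<dots>"
    by (intro closed_Int closed_INT closed_Collect_eq closed_Collect_le ballI continuous_intros
        linear_continuous_on bounded_linear_transpose)
  finally show ?thesis .
qed

lemma continuous_on_trace:
  assumes "continuous_on S (f :: 'a::topological_space \<Rightarrow> real^'n^'n)"
  shows "continuous_on S (\<lambda>x. trace (f x))"
  unfolding trace_def by (intro continuous_intros assms)

text \<open>A compact convex slice of the semidefinite cone. With \<open>c = q\<close> it carries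
  the precision \<open>K = B^-1\<close> of a fit, normalized against the scaling freedom. It is the
  domain of the fixed point map and the parameter set in the measurability proof.\<close>

definition psd_trace :: "real \<Rightarrow> (real^'n^'n) set" where
  "psd_trace c = {K. psd K \<and> trace K = c}"

lemma compact_psd_trace: "compact (psd_trace c)"
  unfolding compact_eq_bounded_closed
proof
  show "bounded (psd_trace c)"
    unfolding bounded_iff psd_trace_def
    by (rule exI[of _ c]) (use psd_norm_le_trace in auto)
  show "closed (psd_trace c)"
    unfolding psd_trace_def Collect_conj_eq
    by (intro closed_Int closed_psd closed_Collect_eq continuous_intros continuous_on_trace)
qed

lemma psd_add: "psd A \<Longrightarrow> psd B \<Longrightarrow> psd (A + B)"
  by (simp add: psd_def transpose_add matrix_vector_mult_add_rdistrib inner_add_right)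

lemma convex_psd_trace: "convex (psd_trace c)"
  unfolding convex_def psd_trace_def
  by (auto intro!: psd_add psd_scaleR simp: trace_add distrib_right[symmetric])

text \<open>This and \<open>col_fit\<close> are the two half-steps of the alternating iteration,
  parametrized by the precision \<open>K\<close> in place of \<open>B\<close>. No inverse of
  \<open>K\<close> is taken, so they make sense at singular \<open>K\<close> on the boundary of the
  domain.\<close>

definition row_fit :: "real^('q::finite \<times> 'p::finite)^('q \<times> 'p) \<Rightarrow> real^'q^'q \<Rightarrow> real^'p^'p" where
  "row_fit S K = (1 / real CARD('q)) *\<^sub>R ptrace_row S K"

definition col_fit :: "real^('q::finite \<times> 'p::finite)^('q \<times> 'p) \<Rightarrow> real^'q^'q \<Rightarrow> real^'q^'q" where
  "col_fit S K = (1 / real CARD('p)) *\<^sub>R ptrace_col S (matrix_inv (row_fit S K))"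

lemma spd_row_fit: "spd S \<Longrightarrow> psd K \<Longrightarrow> 0 < trace K \<Longrightarrow> spd (row_fit S K)"
  unfolding row_fit_def by (intro spd_scaleR spd_ptrace_row) auto

lemma spd_col_fit: "spd S \<Longrightarrow> psd K \<Longrightarrow> 0 < trace K \<Longrightarrow> spd (col_fit S K)"
  using spd_matrix_inv[OF spd_row_fit[of S K]] unfolding col_fit_def
  by (intro spd_scaleR spd_ptrace_col spd_imp_psd spd_trace_pos) auto

text \<open>Turns the pair of equations into a single equation for \<open>K\<close>, which also cuts
  out a closed set when \<open>K\<close> and \<open>S\<close> vary.\<close>

lemma separable_fit_of_precision:
  assumes S: "spd S" and K: "psd K" "0 < trace K" and eq: "col_fit S K ** K = mat 1"
  shows "separable_fit S (row_fit S K) (col_fit S K)"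
proof -
  have "matrix_inv (col_fit S K) = K" by (rule matrix_inv_unique[OF eq])
  then show ?thesis
    using spd_row_fit[OF S K] spd_col_fit[OF S K] by (simp add: separable_fit_def row_fit_def col_fit_def)
qed

text \<open>The scaling freedom is spent on giving the precision of the column factor trace
  \<open>q\<close>; the factors \<open>c\<close> and \<open>1 / c\<close> cancel in the Kronecker
  product.\<close>

lemma separable_fit_normalize:
  fixes S :: "real^('q::finite \<times> 'p::finite)^('q \<times> 'p)"
  assumes fit: "separable_fit S A B"
  obtains K where "K \<in> psd_trace (real CARD('q))" "col_fit S K ** K = mat 1"
    "kronecker (col_fit S K) (row_fit S K) = kronecker B A"
proof -
  have spd: "spd A" "spd B" and eqs: "ptrace_row S (matrix_inv B) = real CARD('q) *\<^sub>R A"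
     "ptrace_col S (matrix_inv A) = real CARD('p) *\<^sub>R B" using fit by (auto simp: separable_fit_def)
  have t: "0 < trace (matrix_inv B)" using spd by (simp add: spd_matrix_inv spd_trace_pos)
  define c where "c = real CARD('q) / trace (matrix_inv B)"
  have c: "c > 0" using t by (simp add: c_def)
  define K where "K = c *\<^sub>R matrix_inv B"
  have "K \<in> psd_trace (real CARD('q))"
    using t c psd_scaleR[OF spd_imp_psd[OF spd_matrix_inv[OF spd(2)]], of c] by (simp add: psd_trace_def K_def c_def)
  moreover have r: "row_fit S K = c *\<^sub>R A" by (simp add: row_fit_def K_def ptr.scaleR_right eqs)
  moreover have co: "col_fit S K = (1 / c) *\<^sub>R B"
    using c by (simp add: col_fit_def r matrix_inv_scaleR spd_det_nz spd ptc.scaleR_right eqs)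
  moreover have "col_fit S K ** K = mat 1"
    using c unfolding co by (simp add: K_def mm.scaleR_left mm.scaleR_right matrix_inv_mult spd_det_nz spd)
  moreover have "kronecker (col_fit S K) (row_fit S K) = kronecker B A"
    using c unfolding co r by (simp add: kr.scaleR_left kr.scaleR_right)
  ultimately show ?thesis using that by blast
qed

text \<open>Brouwer's theorem is applied to one round of the iteration, renormalized to trace
  \<open>q\<close>. A fixed point solves the equations only up to a factor \<open>c\<close>, and
  comparing the two half-steps shows \<open>c = 1\<close>.\<close>

lemma separable_fit_exists:
  fixes S :: "real^('q::finite \<times> 'p::finite)^('q \<times> 'p)"
  assumes S: "spd S"
  shows "\<exists>A B. separable_fit S A B"
proof -
  let ?p = "real CARD('p)" and ?q = "real CARD('q)"
  let ?D = "psd_trace ?q :: (real^'q^'q) set"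
  define f where "f K = (?q / trace (matrix_inv (col_fit S K))) *\<^sub>R matrix_inv (col_fit S K)" for K
  have D: "psd K" "0 < trace K" if "K \<in> ?D" for K using that by (auto simp: psd_trace_def)
  note rs = spd_row_fit[OF S D] and cs = spd_col_fit[OF S D]
  have inv: "spd (matrix_inv (col_fit S K))" if "K \<in> ?D" for K using cs that by (simp add: spd_matrix_inv)
  have "continuous_on ?D (\<lambda>K. row_fit S K)"
    unfolding row_fit_def by (intro continuous_intros ptr.continuous_on)
  then have "continuous_on ?D (\<lambda>K. matrix_inv (row_fit S K))"
    by (rule continuous_on_matrix_inv) (simp add: rs spd_det_nz)
  then have "continuous_on ?D (\<lambda>K. col_fit S K)"
    unfolding col_fit_def by (intro continuous_intros ptc.continuous_on)
  then have "continuous_on ?D (\<lambda>K. matrix_inv (col_fit S K))"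
    by (rule continuous_on_matrix_inv) (simp add: cs spd_det_nz)
  moreover have nz: "trace (matrix_inv (col_fit S K)) \<noteq> 0" if "K \<in> ?D" for K
    using spd_trace_pos[OF inv[OF that]] by simp
  ultimately have "continuous_on ?D f"
    unfolding f_def by (intro continuous_intros continuous_on_trace) (simp_all add: nz)
  moreover have "f \<in> ?D \<rightarrow> ?D"
  proof
    fix K assume "K \<in> ?D"
    note i = inv[OF this]
    show "f K \<in> ?D"
      using spd_trace_pos[OF i] by (auto simp: f_def psd_trace_def intro!: psd_scaleR spd_imp_psd[OF i])
  qed
  moreover have "?D \<noteq> {}"
  proof -
    have "mat 1 \<in> ?D" by (simp add: psd_trace_def trace_I spd_imp_psd[OF spd_mat_1])
    then show ?thesis by blast
  qed
  ultimately obtain K where K: "K \<in> ?D" and fK: "f K = K"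
    using brouwer[OF compact_psd_trace convex_psd_trace] by metis
  define B where "B = col_fit S K"
  define c where "c = ?q / trace (matrix_inv B)"
  have c: "c > 0" using spd_trace_pos[OF inv[OF K]] by (simp add: c_def B_def)
  have iB: "transpose (matrix_inv B) = matrix_inv B" "matrix_inv B ** B = mat 1" "B ** matrix_inv B = mat 1"
    using inv[OF K] cs[OF K K] by (simp_all add: B_def spd_symmetric matrix_inv_mult spd_det_nz)
  have Keq: "K = c *\<^sub>R matrix_inv B" using fK by (simp add: f_def c_def B_def)
  let ?L = "matrix_inv (row_fit S K)"
  \<comment> \<open>Both partial traces pair the same matrix \<open>kronecker K ?L\<close> with
    \<open>S\<close>. The first half-step evaluates this number as \<open>?p * ?q\<close>, the
    second as \<open>?p * ?q * c\<close>.\<close>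
  have "?p * ?q = ?q * trace (?L ** row_fit S K)"
    using rs[OF K K] by (simp add: matrix_inv_mult spd_det_nz trace_I)
  also have "\<dots> = ?L \<bullet> ptrace_row S K"
    using spd_matrix_inv[OF rs[OF K K]] by (simp add: inner_eq_trace spd_symmetric row_fit_def mm.scaleR_right)
  also have "\<dots> = K \<bullet> ptrace_col S ?L" by (simp add: inner_ptrace_row inner_ptrace_col)
  also have "ptrace_col S ?L = ?p *\<^sub>R B" by (simp add: B_def col_fit_def)
  also have "K \<bullet> (?p *\<^sub>R B) = ?p * (c * trace (matrix_inv B ** B))"
    by (subst Keq) (simp add: inner_eq_trace transpose_scalar iB(1) mm.scaleR_left mm.scaleR_right)
  also have "\<dots> = ?p * ?q * c" by (simp add: iB(2) trace_I)
  finally have "c = 1" by simp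
  then have "B ** K = mat 1"
    by (subst Keq) (simp add: iB(3))
  then have "col_fit S K ** K = mat 1" by (simp only: B_def)
  then show ?thesis using separable_fit_of_precision[OF S D[OF K]] by blast
qed

text \<open>The fit is chosen arbitrarily, since uniqueness up to scaling makes the value
  independent of the choice. The default 0 elsewhere makes it a total nonnegative function.\<close>

definition fitted_stat :: "real^('q::finite \<times> 'p::finite)^('q \<times> 'p) \<Rightarrow> real" where
  "fitted_stat S = (if spd S then
     separability_stat S (kronecker (SOME B. \<exists>A. separable_fit S A B) (SOME A. separable_fit S A (SOME B. \<exists>A. separable_fit S A B)))
   else 0)"

lemma fitted_stat_eq:
  assumes S: "spd S" and fit: "separable_fit S A B"
  shows "fitted_stat S = separability_stat S (kronecker B A)"
proof -
  let ?B = "SOME B. \<exists>A. separable_fit S A B"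
  have "\<exists>A. separable_fit S A ?B" using fit by (intro someI_ex[of "\<lambda>B. \<exists>A. separable_fit S A B"]) blast
  then have "separable_fit S (SOME A. separable_fit S A ?B) ?B" by (rule someI_ex)
  from separable_fit_unique[OF S this fit] show ?thesis by (simp add: fitted_stat_def S)
qed

lemma continuous_on_separability_stat:
  assumes f: "continuous_on D (f :: 'a::topological_space \<Rightarrow> real^'n^'n)" and g: "continuous_on D g"
    and spd: "\<And>x. x \<in> D \<Longrightarrow> spd (f x)" "\<And>x. x \<in> D \<Longrightarrow> spd (g x)"
  shows "continuous_on D (\<lambda>x. separability_stat (f x) (g x))"
proof -
  have k: "continuous_on D (\<lambda>x. (det (f x) / det (g x)) powr (1 / real CARD('n)))"
    by (intro continuous_on_powr continuous_on_divide continuous_on_det f g continuous_on_const)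
      (simp_all add: spd_det_nz spd)
  have i: "continuous_on D (\<lambda>x. matrix_inv (f x))"
    by (rule continuous_on_matrix_inv) (simp_all add: f spd spd_det_nz)
  show ?thesis
    unfolding separability_stat_def
    by (intro continuous_on_trace mm.continuous_on continuous_on_diff continuous_on_scaleR continuous_on_const k i g)
qed

text \<open>No fit is selected measurably. The positive definite cone is exhausted by the closed
  sets \<open>?C m\<close>; on each of them the sublevel set is the projection of a closed set along
  the compact set of normalized precisions, hence closed.\<close>

lemma fitted_stat_measurable [measurable]:
  "(fitted_stat :: real^('q::finite \<times> 'p::finite)^('q \<times> 'p) \<Rightarrow> real) \<in> borel_measurable borel"
proof (rule borel_measurableI_le)
  fix y :: real
  let ?C = "\<lambda>m. {S :: real^('q::finite \<times> 'p::finite)^('q \<times> 'p). psd (S - (1 / real (Suc m)) *\<^sub>R mat 1)}"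
  let ?D = "psd_trace (real CARD('q)) :: (real^'q^'q) set"
  let ?T = "\<lambda>m. {x \<in> ?D \<times> ?C m. col_fit (snd x) (fst x) ** fst x = mat 1 \<and>
      separability_stat (snd x) (kronecker (col_fit (snd x) (fst x)) (row_fit (snd x) (fst x))) \<le> y}"
  have spd_iff: "spd S \<longleftrightarrow> (\<exists>m. S \<in> ?C m)" for S
  proof
    assume "spd S"
    then obtain e where e: "e > 0" "psd (S - e *\<^sub>R mat 1)" using spd_lower_bound by blast
    obtain m where m: "1 / real (Suc m) < e" using e(1) by (metis nat_approx_posE)
    have "S - (1 / real (Suc m)) *\<^sub>R mat 1 = (S - e *\<^sub>R mat 1) + (e - 1 / real (Suc m)) *\<^sub>R mat 1"
      by (simp add: scaleR_diff_left)
    also have "psd \<dots>" using m by (intro psd_add[OF e(2)] psd_scaleR spd_imp_psd[OF spd_mat_1]) simp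
    finally show "\<exists>m. S \<in> ?C m" by blast
  next
    assume "\<exists>m. S \<in> ?C m"
    then obtain m where m: "psd (S - (1 / real (Suc m)) *\<^sub>R mat 1)" by blast
    show "spd S" unfolding spd_def
    proof (intro conjI allI impI)
      have "transpose (S - (1 / real (Suc m)) *\<^sub>R mat 1) = transpose S - (1 / real (Suc m)) *\<^sub>R mat 1"
        by (simp add: transpose_diff transpose_scalar)
      then show "transpose S = S" using psdD(1)[OF m] by simp
      fix x :: "real^('q \<times> 'p)" assume "x \<noteq> 0"
      then have "0 < (1 / real (Suc m)) * (x \<bullet> x)" by (simp add: inner_gt_zero_iff)
      also have "\<dots> \<le> x \<bullet> (S *v x)"
        using m by (simp add: psd_diff_iff scaleR_matrix_vector_assoc[symmetric])
      finally show "0 < x \<bullet> (S *v x)" .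
    qed
  qed
  have closed_C: "closed (?C m)" for m
  proof -
    have "closed ((\<lambda>S. S - (1 / real (Suc m)) *\<^sub>R mat 1) -` {A :: real^('q \<times> 'p)^('q \<times> 'p). psd A})"
      by (intro closed_vimage closed_psd continuous_intros)
    then show ?thesis by (simp add: vimage_def)
  qed
  have closed_T: "closed (?T m)" for m
  proof -
    let ?U = "?D \<times> ?C m"
    have U: "closed ?U" by (intro closed_Times closed_C compact_imp_closed compact_psd_trace)
    have spdU: "spd (snd x)" "psd (fst x)" "0 < trace (fst x)" if "x \<in> ?U" for x
      using that spd_iff[of "snd x"] by (auto simp: psd_trace_def)
    note rs = spd_row_fit[OF spdU] and cs = spd_col_fit[OF spdU]
    have r: "continuous_on ?U (\<lambda>x. row_fit (snd x) (fst x))"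
      unfolding row_fit_def by (intro continuous_intros ptr.continuous_on)
    then have "continuous_on ?U (\<lambda>x. matrix_inv (row_fit (snd x) (fst x)))"
      by (rule continuous_on_matrix_inv) (simp add: rs spd_det_nz)
    then have c: "continuous_on ?U (\<lambda>x. col_fit (snd x) (fst x))"
      unfolding col_fit_def by (intro continuous_intros ptc.continuous_on)
    have s: "continuous_on ?U (\<lambda>x. separability_stat (snd x) (kronecker (col_fit (snd x) (fst x)) (row_fit (snd x) (fst x))))"
      using spdU rs cs by (intro continuous_on_separability_stat kr.continuous_on r c spd_kronecker continuous_intros) auto
    have m: "continuous_on ?U (\<lambda>x. col_fit (snd x) (fst x) ** fst x)"
      by (intro mm.continuous_on c continuous_intros)
    have "?T m = (?U \<inter> (\<lambda>x. col_fit (snd x) (fst x) ** fst x) -` {mat 1}) \<inter>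
      (?U \<inter> (\<lambda>x. separability_stat (snd x) (kronecker (col_fit (snd x) (fst x)) (row_fit (snd x) (fst x)))) -` {..y})"
      by auto
    also have "closed \<dots>"
      by (intro closed_Int continuous_closed_preimage m s U) auto
    finally show ?thesis .
  qed
  have borelT: "{S. \<exists>K. K \<in> ?D \<and> (K, S) \<in> ?T m} \<in> sets borel" for m
    using closed_compact_projection[OF compact_psd_trace closed_T] by (rule borel_closed)
  have spd_borel: "{S :: real^('q::finite \<times> 'p::finite)^('q \<times> 'p). spd S} \<in> sets borel"
  proof -
    have "{S :: real^('q::finite \<times> 'p::finite)^('q \<times> 'p). spd S} = (\<Union>m. ?C m)" using spd_iff by auto
    also have "\<dots> \<in> sets borel" using closed_C by (intro sets.countable_UN) auto
    finally show ?thesis .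
  qed
  have "(\<exists>m K. K \<in> ?D \<and> (K, S) \<in> ?T m) \<longleftrightarrow> spd S \<and> fitted_stat S \<le> y" for S
  proof
    assume "\<exists>m K. K \<in> ?D \<and> (K, S) \<in> ?T m"
    then obtain m K where K: "K \<in> ?D" "S \<in> ?C m" "col_fit S K ** K = mat 1"
      "separability_stat S (kronecker (col_fit S K) (row_fit S K)) \<le> y" by auto
    have S: "spd S" using K spd_iff by blast
    have "separable_fit S (row_fit S K) (col_fit S K)"
      using K S by (intro separable_fit_of_precision) (auto simp: psd_trace_def)
    then show "spd S \<and> fitted_stat S \<le> y" using fitted_stat_eq[OF S] K(4) S by simp
  next
    assume S: "spd S \<and> fitted_stat S \<le> y"
    then obtain A B where fit: "separable_fit S A B" using separable_fit_exists by blast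
    obtain m where m: "S \<in> ?C m" using S spd_iff by blast
    obtain K where "K \<in> ?D" "col_fit S K ** K = mat 1" "kronecker (col_fit S K) (row_fit S K) = kronecker B A"
      using separable_fit_normalize[OF fit] .
    then have "K \<in> ?D \<and> (K, S) \<in> ?T m" using S m fitted_stat_eq[of S, OF _ fit] by auto
    then show "\<exists>m K. K \<in> ?D \<and> (K, S) \<in> ?T m" by blast
  qed
  then have "(\<Union>m. {S. \<exists>K. K \<in> ?D \<and> (K, S) \<in> ?T m}) = {S. spd S \<and> fitted_stat S \<le> y}"
    by blast
  moreover have "fitted_stat S = 0" if "\<not> spd S" for S :: "real^('q \<times> 'p)^('q \<times> 'p)"
    using that by (simp add: fitted_stat_def)
  \<comment> \<open>Off the cone the default value is 0, so this complement belongs to the sublevel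
    set exactly when \<open>0 \<le> y\<close>.\<close>
  ultimately have "{S \<in> space borel. fitted_stat S \<le> y} = (\<Union>m. {S. \<exists>K. K \<in> ?D \<and> (K, S) \<in> ?T m}) \<union> (if 0 \<le> y then - {S. spd S} else {})"
    by auto
  also have "\<dots> \<in> sets borel"
    using borelT spd_borel by (intro sets.Un sets.countable_UN) auto
  finally show "{S \<in> space borel. fitted_stat S \<le> y} \<in> sets (borel :: (real^('q::finite \<times> 'p::finite)^('q \<times> 'p)) measure)" .
qed

section \<open>Orthonormal bases of matrix spaces\<close>

definition orthonormal :: "'a::real_inner set \<Rightarrow> bool" where
  "orthonormal B \<longleftrightarrow> finite B \<and> (\<forall>x\<in>B. \<forall>y\<in>B. x \<bullet> y = (if x = y then 1 else 0))"

lemma orthonormal_independent: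
  fixes B :: "'a::euclidean_space set"
  assumes "orthonormal B" shows "independent B" "pairwise orthogonal B"
proof -
  show "pairwise orthogonal B" using assms by (auto simp: pairwise_def orthogonal_def orthonormal_def)
  moreover have "0 \<notin> B" using assms by (force simp: orthonormal_def)
  ultimately show "independent B" by (rule pairwise_orthogonal_independent)
qed

text \<open>An orthonormal set is independent, so having as many elements as the dimension it spans,
  and every vector equals its orthonormal expansion.\<close>

lemma parseval:
  fixes B :: "'a::euclidean_space set"
  assumes B: "orthonormal B" and card: "card B = DIM('a)"
  shows "(norm x)\<^sup>2 = (\<Sum>b\<in>B. (b \<bullet> x)\<^sup>2)"
proof -
  have "UNIV \<subseteq> span B"
    using card orthonormal_independent[OF B] by (intro card_ge_dim_independent) (auto simp: dim_UNIV)
  then have "(\<Sum>b\<in>B. (x \<bullet> b) *\<^sub>R b) = x"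
    using B orthonormal_independent[OF B]
    by (intro orthonormal_basis_expand) (auto simp: orthonormal_def norm_eq_1)
  then have "x \<bullet> x = x \<bullet> (\<Sum>b\<in>B. (x \<bullet> b) *\<^sub>R b)" by simp
  also have "\<dots> = (\<Sum>b\<in>B. (b \<bullet> x)\<^sup>2)"
    by (simp add: inner_sum_right power2_eq_square inner_commute)
  finally show ?thesis by (simp add: power2_norm_eq_inner)
qed

lemma orthonormal_basis_of_subspace:
  fixes S :: "'a::euclidean_space set"
  assumes "subspace S"
  obtains B where "B \<subseteq> S" "orthonormal B" "card B = dim S"
proof -
  obtain B where B: "B \<subseteq> S" "pairwise orthogonal B" "\<And>x. x \<in> B \<Longrightarrow> norm x = 1"
    "independent B" "card B = dim S" using orthonormal_basis_subspace[OF assms] by metis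
  then have "orthonormal B"
    by (auto simp: orthonormal_def independent_imp_finite norm_eq_1 pairwise_def orthogonal_def)
  then show ?thesis using B that by blast
qed

section \<open>Alternating and traceless symmetric matrices: dimensions and adapted bases\<close>

definition alternating :: "(real^'n^'n) set" where "alternating = {X. transpose X = - X}"
definition traceless_symmetric :: "(real^'n^'n) set" where
  "traceless_symmetric = {X. transpose X = X \<and> trace X = 0}"

lemma inner_transpose: "transpose X \<bullet> transpose Y = X \<bullet> (Y :: real^'n^'m)"
  by (simp add: inner_vec_def transpose_def) (rule sum.swap)

lemma transpose_zero: "transpose (0 :: real^'n^'m) = 0"
  by (simp add: vec_eq_iff transpose_def)

lemma subspace_alternating: "subspace alternating"
  by (simp add: subspace_def alternating_def transpose_add transpose_scalar transpose_zero)

lemma subspace_traceless_symmetric: "subspace traceless_symmetric"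
  by (simp add: subspace_def traceless_symmetric_def transpose_add transpose_scalar trace_add
      transpose_zero trace_0[unfolded mat_0])

lemma alternating_inner_symmetric:
  assumes "X \<in> alternating" "transpose Y = Y"
  shows "X \<bullet> Y = 0"
  using inner_transpose[of X Y] assms by (simp add: alternating_def)

lemma trace_alternating: "X \<in> alternating \<Longrightarrow> trace X = 0"
  using alternating_inner_symmetric[of X "mat 1"] by (simp add: inner_mat_1)

text \<open>Testing \<open>Y\<close> against its own alternating part \<open>Y - transpose Y\<close>
  forces this part to vanish. The dimension of the symmetric matrices then follows from that of the
  complement.\<close>

lemma orthogonal_to_alternating: "(\<forall>X\<in>alternating. orthogonal X Y) \<longleftrightarrow> transpose Y = (Y :: real^'n^'n)"
proof
  assume *: "\<forall>X\<in>alternating. orthogonal X Y"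
  have D: "Y - transpose Y \<in> alternating" by (simp add: alternating_def transpose_diff)
  have "(Y - transpose Y) \<bullet> Y = 0" using * D by (simp add: orthogonal_def)
  moreover have "(Y - transpose Y) \<bullet> transpose Y = - ((Y - transpose Y) \<bullet> Y)"
    using inner_transpose[of "Y - transpose Y" Y] by (simp add: transpose_diff inner_diff_left inner_diff_right inner_commute)
  ultimately have "(Y - transpose Y) \<bullet> (Y - transpose Y) = 0" by (simp add: inner_diff_right)
  then show "transpose Y = Y" by simp
qed (auto simp: orthogonal_def alternating_inner_symmetric)

text \<open>The basis consists of differences of matrix units over the pairs with
  \<open>f a < f b\<close>, where the injection \<open>f\<close> into the naturals provides an order
  on \<open>'n\<close>. These pairs and their swaps exhaust the off-diagonal positions, whence the
  factor 2.\<close>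

lemma dim_alternating: "2 * dim (alternating :: (real^'n^'n) set) = CARD('n) * (CARD('n) - 1)"
proof -
  obtain f :: "'n \<Rightarrow> nat" where f: "inj f" by (metis finite_imp_inj_to_nat_seg finite)
  define U where "U = {(i, j). f i < f j}"
  define E :: "'n \<times> 'n \<Rightarrow> real^'n^'n" where
    "E = (\<lambda>(a, b). \<chi> i j. (if i = a \<and> j = b then 1 else 0) - (if i = b \<and> j = a then 1 else 0))"
  have neq: "a \<noteq> b" if "(a, b) \<in> U" for a b using that by (auto simp: U_def)
  have inner_E: "E (a, b) \<bullet> X = X $ a $ b - X $ b $ a" for a b and X :: "real^'n^'n"
  proof -
    have "E (a, b) \<bullet> X = (\<Sum>i\<in>UNIV. \<Sum>j\<in>UNIV. (if i = a then if j = b then X $ i $ j else 0 else 0)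
        - (if i = b then if j = a then X $ i $ j else 0 else 0))"
      by (auto simp: E_def inner_vec_def intro!: sum.cong)
    also have "\<dots> = (\<Sum>i\<in>UNIV. (if i = a then X $ i $ b else 0) - (if i = b then X $ i $ a else 0))"
      by (intro sum.cong refl) (simp add: sum_subtractf)
    also have "\<dots> = X $ a $ b - X $ b $ a" by (simp add: sum_subtractf)
    finally show ?thesis .
  qed
  have inner_E': "E x \<bullet> X = X $ fst x $ snd x - X $ snd x $ fst x" for x and X :: "real^'n^'n"
    by (cases x) (simp add: inner_E)
  have E_nth: "E (a, b) $ i $ j = (if i = a \<and> j = b then 1 else 0) - (if i = b \<and> j = a then 1 else 0)" for a b i j
    by (simp add: E_def)
  have E2: "E x \<bullet> E y = (if x = y then 2 else 0)" if "x \<in> U" "y \<in> U" for x y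
    using that neq by (cases x; cases y) (auto simp: inner_E E_nth U_def)
  have injE: "inj_on E U"
    by (rule inj_onI) (metis E2 zero_neq_numeral)
  have "independent (E ` U)"
  proof (rule pairwise_orthogonal_independent)
    show "pairwise orthogonal (E ` U)"
      by (auto simp: pairwise_def orthogonal_def E2)
    show "0 \<notin> E ` U" using E2 by (metis imageE inner_zero_left zero_neq_numeral)
  qed
  moreover have "E ` U \<subseteq> alternating"
  proof -
    have "transpose (E (a, b)) = - E (a, b)" for a b
      by (simp add: vec_eq_iff transpose_def E_nth conj_commute)
    then show ?thesis by (auto simp: alternating_def)
  qed
  moreover have "alternating \<subseteq> span (E ` U)"
  proof
    fix X :: "real^'n^'n" assume "X \<in> alternating"
    then have X: "X $ i $ j = - X $ j $ i" for i j
    proof -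
      have "transpose X $ j $ i = (- X) $ j $ i" using \<open>X \<in> alternating\<close> by (simp add: alternating_def)
      then show ?thesis by (simp add: transpose_def)
    qed
    have X0: "X $ i $ i = 0" for i using X[of i i] by simp
    have "X = (\<Sum>x\<in>U. X $ fst x $ snd x *\<^sub>R E x)"
    proof (rule matrix_eq_inner, rule ccontr)
      fix L assume ne: "L \<bullet> X \<noteq> L \<bullet> (\<Sum>x\<in>U. X $ fst x $ snd x *\<^sub>R E x)"
      have "L \<bullet> (\<Sum>x\<in>U. X $ fst x $ snd x *\<^sub>R E x) = (\<Sum>x\<in>U. X $ fst x $ snd x * (L $ fst x $ snd x - L $ snd x $ fst x))"
        by (simp add: inner_sum_right inner_commute[of L] inner_E')
      \<comment> \<open>By antisymmetry the sum over \<open>U\<close> splits into the contributions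
        of the positions in \<open>U\<close> and of their swaps.\<close>
      also have "\<dots> = (\<Sum>x\<in>U. X $ fst x $ snd x * L $ fst x $ snd x) + (\<Sum>x\<in>U. X $ snd x $ fst x * L $ snd x $ fst x)"
        unfolding sum.distrib[symmetric]
        by (intro sum.cong refl) (simp add: X[of "snd _" "fst _"] algebra_simps)
      also have "(\<Sum>x\<in>U. X $ snd x $ fst x * L $ snd x $ fst x) = (\<Sum>x\<in>prod.swap ` U. X $ fst x $ snd x * L $ fst x $ snd x)"
        by (subst sum.reindex) auto
      also have "(\<Sum>x\<in>U. X $ fst x $ snd x * L $ fst x $ snd x) + \<dots> = (\<Sum>x\<in>U \<union> prod.swap ` U. X $ fst x $ snd x * L $ fst x $ snd x)"
        by (rule sum.union_disjoint[symmetric]) (auto simp: U_def)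
      also have "\<dots> = (\<Sum>x\<in>UNIV. X $ fst x $ snd x * L $ fst x $ snd x)"
      proof (rule sum.mono_neutral_left)
        show "\<forall>x\<in>UNIV - (U \<union> prod.swap ` U). X $ fst x $ snd x * L $ fst x $ snd x = 0"
        proof
          fix x assume "x \<in> UNIV - (U \<union> prod.swap ` U)"
          then have "f (fst x) = f (snd x)" by (cases x) (force simp: U_def image_iff not_less)
          then have "fst x = snd x" using f by (simp add: inj_eq)
          then show "X $ fst x $ snd x * L $ fst x $ snd x = 0" by (simp add: X0)
        qed
      qed auto
      also have "\<dots> = L \<bullet> X" by (simp add: sum_UNIV_prod inner_vec_def mult.commute)
      finally show False using ne by simp
    qed
    also have "\<dots> \<in> span (E ` U)" by (intro span_sum span_scale span_base imageI)
    finally show "X \<in> span (E ` U)" .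
  qed
  ultimately have "dim (alternating :: (real^'n^'n) set) = card (E ` U)"
    by (intro dim_unique[of "E ` U"]) auto
  also have "\<dots> = card U" by (rule card_image[OF injE])
  finally have d: "dim (alternating :: (real^'n^'n) set) = card U" .
  have "2 * card U = card U + card (prod.swap ` U)" by (subst card_image) auto
  also have "\<dots> = card (U \<union> prod.swap ` U)"
    by (rule card_Un_disjoint[symmetric]) (auto simp: U_def)
  also have "U \<union> prod.swap ` U = UNIV - (\<lambda>i. (i, i)) ` UNIV"
  proof -
    have "x \<in> U \<union> prod.swap ` U \<longleftrightarrow> fst x \<noteq> snd x" for x
    proof -
      obtain a b where x: "x = (a, b)" by (cases x)
      have "a = b \<or> f a < f b \<or> f b < f a" using f by (metis injD linorder_neqE_nat)
      then show ?thesis by (auto simp: x U_def image_iff)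
    qed
    moreover have "x \<in> UNIV - (\<lambda>i. (i, i)) ` UNIV \<longleftrightarrow> fst x \<noteq> snd x" for x :: "'n \<times> 'n"
      by (cases x) auto
    ultimately show ?thesis by (intro set_eqI) simp
  qed
  also have "card \<dots> = CARD('n) * CARD('n) - CARD('n)"
    by (subst card_Diff_subset) (auto simp: card_image inj_on_def card_prod)
  also have "\<dots> = CARD('n) * (CARD('n) - 1)" by (simp add: diff_mult_distrib2)
  finally show ?thesis unfolding d .
qed

text \<open>Two orthogonal complements: the symmetric matrices are that of the alternating ones, and
  the traceless ones among them are that of the identity.\<close>

lemma dim_traceless_symmetric:
  "2 * dim (traceless_symmetric :: (real^'n^'n) set) = (CARD('n) + 2) * (CARD('n) - 1)"
proof -
  let ?n = "CARD('n)"
  have "dim {Y \<in> (UNIV :: (real^'n^'n) set). \<forall>X\<in>alternating. orthogonal X Y} + dim (alternating :: (real^'n^'n) set) = dim (UNIV :: (real^'n^'n) set)"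
    by (rule dim_subspace_orthogonal_to_vectors) (auto simp: subspace_alternating)
  then have 1: "dim {Y :: real^'n^'n. transpose Y = Y} + dim (alternating :: (real^'n^'n) set) = ?n * ?n"
    by (simp add: orthogonal_to_alternating dim_UNIV)
  let ?I = "mat 1 :: real^'n^'n"
  have "dim {Y \<in> {Y :: real^'n^'n. transpose Y = Y}. \<forall>X\<in>span {?I}. orthogonal X Y} + dim (span {?I}) = dim {Y :: real^'n^'n. transpose Y = Y}"
  proof (rule dim_subspace_orthogonal_to_vectors)
    show S: "subspace {Y :: real^'n^'n. transpose Y = Y}"
      by (simp add: subspace_def transpose_add transpose_scalar transpose_zero)
    show "span {?I} \<subseteq> {Y :: real^'n^'n. transpose Y = Y}" by (rule span_minimal[OF _ S]) simp
  qed simp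
  moreover have "{Y \<in> {Y :: real^'n^'n. transpose Y = Y}. \<forall>X\<in>span {?I}. orthogonal X Y} = traceless_symmetric"
    by (auto simp: traceless_symmetric_def orthogonal_def span_singleton inner_mat_1)
  moreover have "dim (span {?I}) = 1"
  proof -
    have "?I \<noteq> 0" using spd_det_nz[OF spd_mat_1, where 'n='n] by (metis det_0 mat_0)
    then show ?thesis by (simp add: dim_singleton)
  qed
  ultimately have "dim (traceless_symmetric :: (real^'n^'n) set) + 1 + dim (alternating :: (real^'n^'n) set) = ?n * ?n"
    using 1 by simp
  then have "2 * dim (traceless_symmetric :: (real^'n^'n) set) + 2 + ?n * (?n - 1) = 2 * (?n * ?n)"
    unfolding dim_alternating[symmetric] by simp
  moreover obtain m where "?n = Suc m" using CARD_pos_real[where 'n='n] by (metis gr0_implies_Suc of_nat_0_less_iff)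
  ultimately show ?thesis by (simp add: algebra_simps)
qed

text \<open>Together with the normalized identity \<open>unit\<close> the two sets form an
  orthonormal basis of all matrices; inclusion, orthonormality and cardinality are enough for this.
  The cardinalities are doubled to avoid division.\<close>

locale matrix_basis =
  fixes Sy Al :: "(real^'n^'n) set"
  assumes Sy: "Sy \<subseteq> traceless_symmetric" "orthonormal Sy" "2 * card Sy = (CARD('n) + 2) * (CARD('n) - 1)"
    and Al: "Al \<subseteq> alternating" "orthonormal Al" "2 * card Al = CARD('n) * (CARD('n) - 1)"
begin

definition unit :: "real^'n^'n" where "unit = (1 / sqrt (real CARD('n))) *\<^sub>R mat 1"

lemma inner_unit: "unit \<bullet> unit = 1"
  using CARD_pos_real[where 'n='n] by (simp add: unit_def inner_mat_1 trace_I)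

lemma
  shows inner_Sy_Al: "x \<in> Sy \<Longrightarrow> y \<in> Al \<Longrightarrow> x \<bullet> y = 0"
    and inner_Al_Sy: "x \<in> Sy \<Longrightarrow> y \<in> Al \<Longrightarrow> y \<bullet> x = 0"
    and inner_unit_Sy: "x \<in> Sy \<Longrightarrow> unit \<bullet> x = 0" "x \<in> Sy \<Longrightarrow> x \<bullet> unit = 0"
    and inner_unit_Al: "x \<in> Al \<Longrightarrow> unit \<bullet> x = 0" "x \<in> Al \<Longrightarrow> x \<bullet> unit = 0"
  using Sy(1) Al(1) alternating_inner_symmetric[of y x] trace_alternating
  by (auto simp: traceless_symmetric_def unit_def inner_mat_1 inner_commute)

lemma disjoint: "Sy \<inter> Al = {}" "unit \<notin> Sy" "unit \<notin> Al"
proof -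
  show "unit \<notin> Sy" "unit \<notin> Al" using inner_unit inner_unit_Sy inner_unit_Al by force+
  show "Sy \<inter> Al = {}" using inner_Sy_Al Sy(2) by (force simp: orthonormal_def)
qed

lemma orthonormal_basis: "orthonormal (insert unit (Sy \<union> Al))"
  using Sy(2) Al(2) disjoint unfolding orthonormal_def
  by (auto simp: inner_unit inner_Sy_Al inner_Al_Sy inner_unit_Sy inner_unit_Al)

lemma card_basis: "card (insert unit (Sy \<union> Al)) = CARD('n) * CARD('n)"
proof -
  have "2 * card (insert unit (Sy \<union> Al)) = 2 * card Sy + 2 * card Al + 2"
    using disjoint Sy(2) Al(2) by (simp add: card_Un_disjoint orthonormal_def)
  moreover obtain m where "CARD('n) = Suc m" using CARD_pos_real[where 'n='n] by (metis gr0_implies_Suc of_nat_0_less_iff)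
  ultimately show ?thesis unfolding Sy(3) Al(3) by (simp add: algebra_simps)
qed

lemma trace_0: "x \<in> Sy \<union> Al \<Longrightarrow> trace x = 0"
  using Sy(1) Al(1) trace_alternating by (auto simp: traceless_symmetric_def)

end

lemma matrix_basis_exists: "\<exists>Sy Al :: (real^'n^'n) set. matrix_basis Sy Al"
proof -
  obtain Sy :: "(real^'n^'n) set" where "Sy \<subseteq> traceless_symmetric" "orthonormal Sy" "card Sy = dim (traceless_symmetric :: (real^'n^'n) set)"
    using orthonormal_basis_of_subspace[OF subspace_traceless_symmetric] by metis
  moreover obtain Al :: "(real^'n^'n) set" where "Al \<subseteq> alternating" "orthonormal Al" "card Al = dim (alternating :: (real^'n^'n) set)"
    using orthonormal_basis_of_subspace[OF subspace_alternating] by metis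
  ultimately show ?thesis
    by (intro exI[of _ Sy] exI[of _ Al]) (simp add: matrix_basis_def dim_alternating dim_traceless_symmetric)
qed

lemma orthonormal_kronecker:
  fixes B :: "(real^'n^'n) set" and C :: "(real^'m^'m) set"
  assumes B: "orthonormal B" and C: "orthonormal C"
  shows "orthonormal ((\<lambda>(s, t). kronecker s t) ` (B \<times> C))" "inj_on (\<lambda>(s, t). kronecker s t) (B \<times> C)"
proof -
  have *: "kronecker s t \<bullet> kronecker s' t' = (if (s, t) = (s', t') then 1 else 0)"
    if "s \<in> B" "s' \<in> B" "t \<in> C" "t' \<in> C" for s s' t t'
    using that B C by (simp add: inner_kronecker orthonormal_def)
  show i: "inj_on (\<lambda>(s, t). kronecker s t) (B \<times> C)"
    by (rule inj_onI) (auto, (metis * fst_conv snd_conv zero_neq_one)+)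
  show "orthonormal ((\<lambda>(s, t). kronecker s t) ` (B \<times> C))"
    unfolding orthonormal_def
  proof (intro conjI ballI)
    show "finite ((\<lambda>(s, t). kronecker s t) ` (B \<times> C))" using B C by (auto simp: orthonormal_def)
    fix x y assume "x \<in> (\<lambda>(s, t). kronecker s t) ` (B \<times> C)" "y \<in> (\<lambda>(s, t). kronecker s t) ` (B \<times> C)"
    then obtain s t s' t' where st: "s \<in> B" "t \<in> C" "s' \<in> B" "t' \<in> C" "x = kronecker s t" "y = kronecker s' t'" by auto
    then have "x = y \<longleftrightarrow> (s, t) = (s', t')" using inj_onD[OF i, of "(s, t)" "(s', t')"] by auto
    then show "x \<bullet> y = (if x = y then 1 else 0)" using st by (simp add: *)
  qed
qed

lemma parseval_kronecker:
  fixes B :: "(real^'n^'n) set" and C :: "(real^'m^'m) set"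
  assumes "orthonormal B" "orthonormal C" "card B = CARD('n) * CARD('n)" "card C = CARD('m) * CARD('m)"
  shows "(norm X)\<^sup>2 = (\<Sum>(s, t)\<in>B \<times> C. (kronecker s t \<bullet> X)\<^sup>2)"
proof -
  have "(norm X)\<^sup>2 = (\<Sum>e\<in>(\<lambda>(s, t). kronecker s t) ` (B \<times> C). (e \<bullet> X)\<^sup>2)"
    using assms by (intro parseval orthonormal_kronecker)
      (simp_all add: card_image[OF orthonormal_kronecker(2)] card_cartesian_product)
  also have "\<dots> = (\<Sum>x\<in>B \<times> C. ((case x of (s, t) \<Rightarrow> kronecker s t) \<bullet> X)\<^sup>2)"
    by (subst sum.reindex) (use assms in \<open>auto simp: orthonormal_kronecker\<close>)
  finally show ?thesis by (simp add: case_prod_beta)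
qed

section \<open>Quadratic expansion of the statistic\<close>

lemma CARD_ge_1_real: "1 \<le> real CARD('n::finite)"
  using card_gt_0_iff[of "UNIV :: 'n set"] by (simp add: real_of_nat_ge_one_iff Suc_leI)

lemma orthonormal_norm: "orthonormal B \<Longrightarrow> x \<in> B \<Longrightarrow> norm x = 1"
  by (simp add: orthonormal_def norm_eq_1)

lemma abs_exp_minus_1_le:
  assumes "\<bar>x\<bar> \<le> 1 / 2" shows "\<bar>exp x - 1\<bar> \<le> 2 * \<bar>x :: real\<bar>"
proof -
  have "1 + x \<le> exp x" by (rule exp_ge_add_one_self)
  moreover have "exp x \<le> 1 + 2 * \<bar>x\<bar>" using exp_bound_lemma[of x] assms by simp
  ultimately show ?thesis by linarith
qed

lemma norm_mat_1_le: "norm (mat 1 :: real^'n^'n) \<le> real CARD('n)"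
  using psd_norm_le_trace[OF spd_imp_psd[OF spd_mat_1], where 'n='n] by (simp add: trace_I)

lemma abs_trace_le: "\<bar>trace (A :: real^'n^'n)\<bar> \<le> real CARD('n) * norm A"
proof -
  have "\<bar>trace A\<bar> \<le> norm (mat 1 :: real^'n^'n) * norm A"
    using abs_trace_mult_le[of "mat 1" A] by simp
  also have "\<dots> \<le> real CARD('n) * norm A" by (intro mult_right_mono norm_mat_1_le) simp
  finally show ?thesis .
qed

text \<open>For \<open>J = A^-1\<close> one has \<open>J - 1 = - (A - 1) - (J - 1) (A - 1)\<close>;
  the last term is at most half the left side and is absorbed.\<close>

lemma norm_matrix_inv_minus_1_le:
  assumes A: "det (A :: real^'n^'n) \<noteq> 0" and near: "norm (A - mat 1) \<le> 1 / 2"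
  shows "norm (matrix_inv A - mat 1) \<le> 2 * norm (A - mat 1)"
proof -
  let ?J = "matrix_inv A"
  have "?J - mat 1 = - (A - mat 1) - (?J - mat 1) ** (A - mat 1)"
    by (simp add: mm.diff_left mm.diff_right matrix_inv_mult A)
  then have "norm (?J - mat 1) \<le> norm (A - mat 1) + norm ((?J - mat 1) ** (A - mat 1))"
    by (metis norm_minus_cancel norm_triangle_ineq4)
  also have "norm ((?J - mat 1) ** (A - mat 1)) \<le> norm (?J - mat 1) * norm (A - mat 1)"
    by (rule norm_matrix_mult_le)
  also have "\<dots> \<le> norm (?J - mat 1) * (1 / 2)" using near by (intro mult_left_mono) auto
  finally show ?thesis by simp
qed

text \<open>Adjointness with the partial trace itself as test matrix, then Cauchy-Schwarz and
  cancellation of one norm.\<close>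

lemma norm_ptrace_row_le: "norm (ptrace_row S K) \<le> norm S * norm K"
proof -
  have "norm (ptrace_row S K) * norm (ptrace_row S K) = kronecker K (ptrace_row S K) \<bullet> S"
    by (simp add: inner_ptrace_row[symmetric] power2_norm_eq_inner[symmetric] power2_eq_square)
  also have "\<dots> \<le> norm K * norm (ptrace_row S K) * norm S"
    using norm_cauchy_schwarz[of "kronecker K (ptrace_row S K)" S] by (simp add: norm_kronecker)
  finally have "norm (ptrace_row S K) * norm (ptrace_row S K) \<le> norm S * norm K * norm (ptrace_row S K)"
    by (simp add: mult_ac)
  then show ?thesis
    by (cases "norm (ptrace_row S K) = 0") (auto simp: mult_le_cancel_right)
qed

lemma norm_ptrace_col_le: "norm (ptrace_col S L) \<le> norm S * norm L"
proof -
  have "norm (ptrace_col S L) * norm (ptrace_col S L) = kronecker (ptrace_col S L) L \<bullet> S"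
    by (simp add: inner_ptrace_col[symmetric] power2_norm_eq_inner[symmetric] power2_eq_square)
  also have "\<dots> \<le> norm (ptrace_col S L) * norm L * norm S"
    using norm_cauchy_schwarz[of "kronecker (ptrace_col S L) L" S] by (simp add: norm_kronecker)
  finally have "norm (ptrace_col S L) * norm (ptrace_col S L) \<le> norm S * norm L * norm (ptrace_col S L)"
    by (simp add: mult_ac)
  then show ?thesis
    by (cases "norm (ptrace_col S L) = 0") (auto simp: mult_le_cancel_right)
qed

lemma norm_le_of_near_1:
  assumes "norm ((A :: real^'n^'n) - mat 1) \<le> 1" shows "norm A \<le> real CARD('n) + 1"
  using norm_triangle_ineq[of "A - mat 1" "mat 1"] assms norm_mat_1_le[where 'n='n] by simp

text \<open>With \<open>tr B^-1 = q\<close> the row equation for \<open>S = I\<close> gives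
  \<open>A = I\<close> whatever \<open>B\<close> is, so \<open>A - I\<close> is the partial trace of
  \<open>S - I\<close> with a bounded weight, and the column equation then controls
  \<open>B - I\<close>. The constant \<open>2 + 2 q\<close> collects the weight bound
  \<open>p + 1 \<le> 2 p\<close> and the trace defect \<open>2 p q\<close>, after division by
  \<open>p\<close>.\<close>

lemma separable_fit_near:
  fixes S :: "real^('q::finite \<times> 'p::finite)^('q \<times> 'p)"
  assumes S: "spd S" and fit: "separable_fit S A B" and tr: "trace (matrix_inv B) = real CARD('q)"
    and near: "norm (S - mat 1) \<le> 1 / 2"
  shows "norm (A - mat 1) \<le> norm (S - mat 1)"
    and "norm (B - mat 1) \<le> (2 + 2 * real CARD('q)) * norm (S - mat 1)"
proof -
  let ?p = "real CARD('p)" and ?q = "real CARD('q)" and ?H = "S - mat 1"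
  have spd: "spd A" "spd B" and eqs: "?q *\<^sub>R A = ptrace_row S (matrix_inv B)"
    "?p *\<^sub>R B = ptrace_col S (matrix_inv A)"
    using fit by (auto simp: separable_fit_def)
  have p1: "1 \<le> ?p" by (rule CARD_ge_1_real)
  have "?q *\<^sub>R (A - mat 1) = ptrace_row ?H (matrix_inv B)"
    by (simp add: scaleR_diff_right eqs ptr.diff_left ptrace_row_mat_1 tr)
  then have "?q * norm (A - mat 1) = norm (ptrace_row ?H (matrix_inv B))"
    by (metis abs_of_nonneg norm_scaleR of_nat_0_le_iff)
  also have "\<dots> \<le> norm ?H * norm (matrix_inv B)" by (rule norm_ptrace_row_le)
  also have "\<dots> \<le> norm ?H * ?q"
    using psd_norm_le_trace[OF spd_imp_psd[OF spd_matrix_inv[OF spd(2)]]] tr by (intro mult_left_mono) auto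
  finally have "?q * norm (A - mat 1) \<le> ?q * norm ?H" by (simp add: mult.commute)
  then show A: "norm (A - mat 1) \<le> norm ?H" by simp
  have iA: "norm (matrix_inv A - mat 1) \<le> 2 * norm ?H"
    using norm_matrix_inv_minus_1_le[OF spd_det_nz[OF spd(1)]] A near by linarith
  have "?p *\<^sub>R (B - mat 1) = ptrace_col ?H (matrix_inv A) + trace (matrix_inv A - mat 1) *\<^sub>R mat 1"
    by (simp add: scaleR_diff_right eqs ptc.diff_left ptrace_col_mat_1 trace_sub trace_I scaleR_diff_left)
  then have "?p * norm (B - mat 1) = norm (ptrace_col ?H (matrix_inv A) + trace (matrix_inv A - mat 1) *\<^sub>R mat 1)"
    by (metis abs_of_nonneg norm_scaleR of_nat_0_le_iff)
  also have "\<dots> \<le> norm (ptrace_col ?H (matrix_inv A)) + \<bar>trace (matrix_inv A - mat 1)\<bar> * norm (mat 1 :: real^'q^'q)"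
    using norm_triangle_ineq by (metis norm_scaleR)
  also have "norm (ptrace_col ?H (matrix_inv A)) \<le> norm ?H * (?p + 1)"
    using norm_le_of_near_1[of "matrix_inv A"] iA near
    by (intro order_trans[OF norm_ptrace_col_le] mult_left_mono) auto
  also have "\<bar>trace (matrix_inv A - mat 1)\<bar> * norm (mat 1 :: real^'q^'q) \<le> (?p * (2 * norm ?H)) * ?q"
    using iA by (intro mult_mono norm_mat_1_le order_trans[OF abs_trace_le] mult_left_mono) auto
  finally have "?p * norm (B - mat 1) \<le> norm ?H * (?p + 1) + ?p * (2 * norm ?H) * ?q" by simp
  also have "\<dots> \<le> norm ?H * (2 * ?p) + ?p * (2 * norm ?H) * ?q"
    using p1 by (intro add_right_mono mult_left_mono) auto
  also have "\<dots> = ?p * ((2 + 2 * ?q) * norm ?H)" by (simp add: algebra_simps)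
  finally show "norm (B - mat 1) \<le> (2 + 2 * ?q) * norm ?H"
    using p1 by (simp add: mult_le_cancel_left)
qed

text \<open>Apply \<open>ln_det_near_mat_1\<close> to \<open>P = W S W\<close> with \<open>W\<close>
  the inverse root of \<open>T\<close>; the trace hypothesis on \<open>P\<close> is the one assumed
  here. \<open>P - I\<close> is similar to \<open>- (T - S) T^-1\<close>, so its squared norm is a
  trace bounded by the squared norm of the latter.\<close>

lemma det_ratio_bound:
  fixes S T :: "real^'n^'n"
  assumes S: "spd S" and T: "spd T" and tr: "trace (matrix_inv T ** S) = real CARD('n)"
    and near: "norm ((T - S) ** matrix_inv T) \<le> 1 / 2"
  shows "\<bar>ln (det S / det T)\<bar> \<le> 2 * (norm ((T - S) ** matrix_inv T))\<^sup>2"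
proof -
  let ?W = "mat_inv_sqrt T"
  note W = mat_inv_sqrt[OF T]
  have symW: "transpose ?W = ?W" using W(1) by (rule spd_symmetric)
  let ?P = "?W ** S ** ?W"
  have P: "spd ?P" using spd_congruence[OF S spd_det_nz[OF W(1)]] symW by simp
  have trP: "trace ?P = real CARD('n)"
    using trace_mul_sym[of "?W ** S" ?W] by (simp add: matrix_mul_assoc W(2) tr)
  have symP: "transpose (?P - mat 1) = ?P - mat 1" using P by (simp add: transpose_diff spd_symmetric)
  have "(norm (?P - mat 1))\<^sup>2 = trace ((1 *\<^sub>R (?W ** (S ** ?W)) - mat 1) ** (1 *\<^sub>R (?W ** (S ** ?W)) - mat 1))"
    by (simp only: power2_norm_eq_inner inner_eq_trace symP scaleR_one matrix_mul_assoc)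
  also have "\<dots> = trace ((1 *\<^sub>R (S ** ?W ** ?W) - mat 1) ** (1 *\<^sub>R (S ** ?W ** ?W) - mat 1))"
    by (rule trace_square_commute)
  also have "1 *\<^sub>R (S ** ?W ** ?W) - mat 1 = - ((T - S) ** matrix_inv T)"
    by (simp add: matrix_mul_assoc[symmetric] W(2) mm.diff_left matrix_inv_mult spd_det_nz[OF T])
  also have "trace (- ((T - S) ** matrix_inv T) ** - ((T - S) ** matrix_inv T))
     \<le> (norm ((T - S) ** matrix_inv T))\<^sup>2"
    using abs_trace_mult_le[of "- ((T - S) ** matrix_inv T)" "- ((T - S) ** matrix_inv T)"]
    by (simp add: power2_eq_square)
  finally have le: "(norm (?P - mat 1))\<^sup>2 \<le> (norm ((T - S) ** matrix_inv T))\<^sup>2" .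
  then have "norm (?P - mat 1) \<le> 1 / 2" using near by (simp add: power2_le_iff_abs_le)
  from ln_det_near_mat_1[OF P trP this] le have "\<bar>ln (det ?P)\<bar> \<le> 2 * (norm ((T - S) ** matrix_inv T))\<^sup>2" by linarith
  moreover have "det ?P = det S / det T"
  proof -
    have "det ?P = det S * det (matrix_inv T)" by (simp add: W(2)[symmetric] det_mul)
    moreover have "det (matrix_inv T) * det T = 1"
      by (metis T det_I det_mul matrix_inv_mult(1) spd_det_nz)
    ultimately show ?thesis using spd_det_nz[OF T] by (simp add: field_simps)
  qed
  ultimately show ?thesis by simp
qed

text \<open>Put \<open>D = T - S\<close>. The determinant factor \<open>k\<close> is
  \<open>1 + O(h^2)\<close> by the trace hypothesis and \<open>S^-1\<close> is
  \<open>I + O(h)\<close>, so the matrix whose square is traced is \<open>D + E\<close> with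
  \<open>E = O(h^2)\<close>. The trace of its square is the squared norm of \<open>D\<close> up to
  \<open>O(h^3)\<close>.\<close>

lemma separability_stat_near:
  fixes S T :: "real^'n^'n"
  assumes S: "spd S" and T: "spd T" and tr: "trace (matrix_inv T ** S) = real CARD('n)"
    and h: "norm (S - mat 1) \<le> h" "norm (T - mat 1) \<le> c * h" "0 \<le> h" "1 \<le> c"
    and small: "8 * (c + 1)\<^sup>2 * (real CARD('n) + 1)\<^sup>2 * h \<le> 1"
  shows "\<bar>separability_stat S T - (norm (T - S))\<^sup>2\<bar> \<le> 1000 * (c + 1)^6 * (real CARD('n) + 1)^6 * h^3"
proof -
  let ?N = "real CARD('n)"
  define D where "D = T - S"
  \<comment> \<open>\<open>M\<close> dominates every constant that occurs, so all bounds become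
    monomials in \<open>M\<close> and \<open>h\<close>, and the smallness hypothesis reads
    \<open>8 M^2 h \<le> 1\<close>.\<close>
  define M where "M = (c + 1) * (?N + 1)"
  have N1: "1 \<le> ?N" by (rule CARD_ge_1_real)
  have c2: "2 \<le> c + 1" using h by simp
  have M2: "c + 1 \<le> M" "?N + 1 \<le> M" "1 \<le> M"
    using c2 N1 mult_mono[of 1 "c+1" "?N+1" "?N+1"] mult_mono[of "c+1" "c+1" 1 "?N+1"] mult_mono[of 1 "c+1" 1 "?N+1"] by (auto simp: M_def)
  have Mh: "8 * M\<^sup>2 * h \<le> 1" using small by (simp add: M_def power_mult_distrib mult_ac)
  have MM: "M \<le> M\<^sup>2" "1 \<le> M\<^sup>2" using M2(3) by (auto simp: power2_eq_square mult_le_cancel_left1 intro: order_trans[of 1 M])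
  have hM: "M * h \<le> M\<^sup>2 * h" "h \<le> M\<^sup>2 * h" using MM h(3) by (auto intro: mult_right_mono simp: mult_le_cancel_right1)
  have ch: "c * h \<le> M * h" using M2(1) h(3) by (intro mult_right_mono) auto
  have D: "norm D \<le> (c + 1) * h"
    using norm_triangle_ineq4[of "T - mat 1" "S - mat 1"] h by (simp add: D_def algebra_simps)
  have DM: "norm D \<le> M * h" using D M2(1) h(3) by (meson mult_right_mono order_trans)
  have T1: "norm (T - mat 1) \<le> 1 / 2" using h(2) ch hM Mh by linarith
  have S1: "norm (S - mat 1) \<le> 1 / 2" using h(1) hM Mh by linarith
  have iT: "norm (matrix_inv T) \<le> ?N + 1"
    using norm_matrix_inv_minus_1_le[OF spd_det_nz[OF T] T1] T1 by (intro norm_le_of_near_1) linarith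
  have iS: "norm (matrix_inv S - mat 1) \<le> 2 * h"
    using norm_matrix_inv_minus_1_le[OF spd_det_nz[OF S] S1] h(1) by linarith
  have DT: "norm (D ** matrix_inv T) \<le> M * h"
  proof -
    have "norm (D ** matrix_inv T) \<le> ((c + 1) * h) * (?N + 1)"
      using D iT h(3) c2 by (intro order_trans[OF norm_matrix_mult_le] mult_mono) auto
    then show ?thesis by (simp add: M_def mult_ac)
  qed
  have lnb: "\<bar>ln (det S / det T)\<bar> \<le> 2 * (M * h)\<^sup>2"
  proof -
    have "norm (D ** matrix_inv T) \<le> 1 / 2" using DT hM Mh by linarith
    from det_ratio_bound[OF S T tr this[unfolded D_def]]
    have "\<bar>ln (det S / det T)\<bar> \<le> 2 * (norm (D ** matrix_inv T))\<^sup>2" by (simp add: D_def)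
    also have "\<dots> \<le> 2 * (M * h)\<^sup>2" using DT by (intro mult_left_mono power_mono) auto
    finally show ?thesis .
  qed
  define k where "k = (det S / det T) powr (1 / ?N)"
  have Mh2: "(M * h)\<^sup>2 \<le> h"
  proof -
    have "(M * h)\<^sup>2 = (M\<^sup>2 * h) * h" by (simp add: power2_eq_square)
    also have "\<dots> \<le> 1 * h" using Mh h(3) by (intro mult_right_mono) auto
    finally show ?thesis by simp
  qed
  have h8: "h \<le> 1 / 8" using hM Mh by linarith
  have k1: "\<bar>k - 1\<bar> \<le> 4 * (M * h)\<^sup>2"
  proof -
    have pos: "0 < det S / det T" using spd_det_pos[OF S] spd_det_pos[OF T] by simp
    then have k: "k = exp (ln (det S / det T) / ?N)"
      by (simp add: k_def powr_def spd_det_nz[OF S] spd_det_nz[OF T])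
    have "\<bar>ln (det S / det T) / ?N\<bar> \<le> \<bar>ln (det S / det T)\<bar>"
      using N1 by (simp add: divide_le_eq mult_le_cancel_left1)
    then have le: "\<bar>ln (det S / det T) / ?N\<bar> \<le> 2 * (M * h)\<^sup>2" using lnb by linarith
    then have "\<bar>ln (det S / det T) / ?N\<bar> \<le> 1 / 2" using Mh2 h8 by linarith
    from abs_exp_minus_1_le[OF this] show ?thesis unfolding k using le by linarith
  qed
  have k2: "\<bar>k\<bar> \<le> 2" using k1 Mh2 h8 by linarith
  \<comment> \<open>The exact remainder of \<open>k S^-1 T - I\<close> after \<open>D\<close>,
    obtained from \<open>S^-1 T = I + S^-1 D\<close>.\<close>
  define E where "E = (k - 1) *\<^sub>R mat 1 + (k *\<^sub>R (matrix_inv S - mat 1) + (k - 1) *\<^sub>R mat 1) ** D"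
  have R: "k *\<^sub>R (matrix_inv S ** T) - mat 1 = D + E"
  proof -
    have "matrix_inv S ** T = mat 1 + matrix_inv S ** D"
      by (simp add: D_def mm.diff_right matrix_inv_mult spd_det_nz[OF S])
    then show ?thesis
      by (simp add: E_def mm.add_left mm.diff_left mm.scaleR_left scaleR_add_right scaleR_diff_right scaleR_diff_left)
  qed
  have MH0: "0 \<le> M * h" using M2 h(3) by simp
  have kN: "\<bar>k - 1\<bar> * norm (mat 1 :: real^'n^'n) \<le> 4 * M^3 * h\<^sup>2"
  proof -
    have "\<bar>k - 1\<bar> * norm (mat 1 :: real^'n^'n) \<le> (4 * (M * h)\<^sup>2) * M"
      using k1 norm_mat_1_le[where 'n='n] M2(2) by (intro mult_mono) auto
    then show ?thesis by (simp add: power2_eq_square power3_eq_cube mult_ac)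
  qed
  have G: "norm (k *\<^sub>R (matrix_inv S - mat 1) + (k - 1) *\<^sub>R mat 1 :: real^'n^'n) \<le> 5 * M * h"
  proof -
    have "norm (k *\<^sub>R (matrix_inv S - mat 1) + (k - 1) *\<^sub>R mat 1 :: real^'n^'n)
      \<le> \<bar>k\<bar> * norm (matrix_inv S - mat 1) + \<bar>k - 1\<bar> * norm (mat 1 :: real^'n^'n)"
      by (metis norm_scaleR norm_triangle_ineq)
    also have "\<bar>k\<bar> * norm (matrix_inv S - mat 1) \<le> 2 * (2 * h)"
      using k2 iS by (intro mult_mono) auto
    also have "4 * M^3 * h\<^sup>2 = (8 * M\<^sup>2 * h) * (M * h) / 2" by (simp add: power2_eq_square power3_eq_cube)
    then have "\<bar>k - 1\<bar> * norm (mat 1 :: real^'n^'n) \<le> 1 * (M * h)"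
      using kN mult_right_mono[OF Mh MH0] MH0 by linarith
    finally show ?thesis using M2(3) h(3) mult_right_mono[of 1 M h] by simp
  qed
  have E: "norm E \<le> 9 * M^3 * h\<^sup>2"
  proof -
    have "norm E \<le> \<bar>k - 1\<bar> * norm (mat 1 :: real^'n^'n) +
       norm (k *\<^sub>R (matrix_inv S - mat 1) + (k - 1) *\<^sub>R mat 1 :: real^'n^'n) * norm D"
      unfolding E_def by (intro order_trans[OF norm_triangle_ineq] add_mono norm_matrix_mult_le) simp
    also have "norm (k *\<^sub>R (matrix_inv S - mat 1) + (k - 1) *\<^sub>R mat 1 :: real^'n^'n) * norm D \<le> (5 * M * h) * (M * h)"
      using G DM MH0 by (intro mult_mono) auto
    also have "(5 * M * h) * (M * h) \<le> 5 * M^3 * h\<^sup>2"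
      using M2(3) mult_right_mono[of 1 M "5 * M\<^sup>2 * h\<^sup>2"] by (simp add: power2_eq_square power3_eq_cube mult_ac)
    finally show ?thesis using kN by linarith
  qed
  have symD: "transpose D = D" using S T by (simp add: D_def transpose_diff spd_symmetric)
  have "separability_stat S T = trace ((D + E) ** (D + E))"
    unfolding separability_stat_def k_def[symmetric] R ..
  also have "\<dots> = (norm D)\<^sup>2 + 2 * trace (D ** E) + trace (E ** E)"
    using trace_mul_sym[of E D]
    by (simp add: mm.add_left mm.add_right trace_add power2_norm_eq_inner inner_eq_trace symD)
  finally have "\<bar>separability_stat S T - (norm D)\<^sup>2\<bar> \<le> 2 * (norm D * norm E) + norm E * norm E"
    using abs_trace_mult_le[of D E] abs_trace_mult_le[of E E] by linarith
  also have "\<dots> \<le> 2 * ((M * h) * (9 * M^3 * h\<^sup>2)) + (9 * M^3 * h\<^sup>2) * (9 * M^3 * h\<^sup>2)"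
    using DM E MH0 M2(3) h(3) by (intro add_mono mult_left_mono mult_mono) auto
  also have "\<dots> \<le> 18 * M^6 * h^3 + 81 * M^6 * h^3"
  proof (rule add_mono)
    have "M^4 \<le> M^6" using M2(3) by (intro power_increasing) auto
    then have "18 * M^4 * h^3 \<le> 18 * M^6 * h^3" using h(3) by (intro mult_right_mono) auto
    then show "2 * ((M * h) * (9 * M^3 * h\<^sup>2)) \<le> 18 * M^6 * h^3"
      by (simp add: power2_eq_square power3_eq_cube power4_eq_xxxx mult_ac)
    have "h^4 \<le> h^3" using h(3) h8 by (intro power_decreasing) auto
    then have "81 * M^6 * h^4 \<le> 81 * M^6 * h^3" using M2(3) by (intro mult_left_mono) auto
    then show "(9 * M^3 * h\<^sup>2) * (9 * M^3 * h\<^sup>2) \<le> 81 * M^6 * h^3"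
      by (simp add: power_mult_distrib[symmetric] power_add[symmetric] mult_ac)
        (simp add: power2_eq_square power3_eq_cube power4_eq_xxxx eval_nat_numeral mult_ac)
  qed
  also have "\<dots> \<le> 1000 * (M^6 * h^3)" using M2(3) h(3) by simp
  finally show ?thesis by (simp add: D_def M_def power_mult_distrib mult_ac)
qed

text \<open>The column equation is tested against \<open>B^-1\<close>. Being exact, it supplies the
  trace hypothesis of \<open>separability_stat_near\<close>.\<close>

lemma separable_fit_trace:
  fixes S :: "real^('q::finite \<times> 'p::finite)^('q \<times> 'p)"
  assumes fit: "separable_fit S A B"
  shows "trace (matrix_inv (kronecker B A) ** S) = real CARD('q \<times> 'p)"
proof -
  have spd: "spd A" "spd B" and eqs: "ptrace_col S (matrix_inv A) = real CARD('p) *\<^sub>R B"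
    using fit by (auto simp: separable_fit_def)
  have "trace (matrix_inv (kronecker B A) ** S) = kronecker (matrix_inv B) (matrix_inv A) \<bullet> S"
    using spd_matrix_inv[OF spd_kronecker[OF spd(2,1)]]
    by (simp add: inner_eq_trace spd_symmetric flip: matrix_inv_kronecker[OF spd_det_nz[OF spd(2)] spd_det_nz[OF spd(1)]])
  also have "\<dots> = matrix_inv B \<bullet> ptrace_col S (matrix_inv A)" by (rule inner_ptrace_col[symmetric])
  also have "\<dots> = real CARD('p) * trace (matrix_inv B ** B)"
    using spd_matrix_inv[OF spd(2)] by (simp add: eqs inner_eq_trace spd_symmetric mm.scaleR_right)
  finally show ?thesis using spd by (simp add: matrix_inv_mult spd_det_nz trace_I)
qed

text \<open>The residual \<open>T - S\<close> has components of second order along \<open>s \<otimes> I\<close> and \<open>I \<otimes> t\<close> because both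
  estimating equations hold exactly, and the fit \<open>T\<close> itself has components of second order along
  \<open>s \<otimes> t\<close> for traceless \<open>s\<close> and \<open>t\<close>.\<close>

lemma residual_expansion:
  fixes S :: "real^('q::finite \<times> 'p::finite)^('q \<times> 'p)"
    and Sq Aq :: "(real^'q^'q) set" and Sp Ap :: "(real^'p^'p) set"
  assumes bq: "matrix_basis Sq Aq" and bp: "matrix_basis Sp Ap"
    and S: "spd S" and fit: "separable_fit S A B"
    and h: "h = norm (S - mat 1)" "h \<le> 1" and hA: "norm (A - mat 1) \<le> h" "norm (matrix_inv A - mat 1) \<le> 2 * h"
    and hB: "norm (B - mat 1) \<le> b * h" "norm (matrix_inv B - mat 1) \<le> 2 * b * h" "1 \<le> b"
    and hD: "norm (kronecker B A - S) \<le> c * h" "1 \<le> c"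
  shows "\<bar>(norm (kronecker B A - S))\<^sup>2 - (\<Sum>(s, t)\<in>Sq \<times> Sp \<union> Aq \<times> Ap. (kronecker s t \<bullet> (S - mat 1))\<^sup>2)\<bar>
    \<le> (real CARD('q) * real CARD('p))\<^sup>2 * (3 * b\<^sup>2 + 4 * b\<^sup>2 * c\<^sup>2) * h^3"
proof -
  interpret Q: matrix_basis Sq Aq by (rule bq)
  interpret P: matrix_basis Sp Ap by (rule bp)
  have spd: "spd A" "spd B" and eqs: "ptrace_row S (matrix_inv B) = real CARD('q) *\<^sub>R A"
    "ptrace_col S (matrix_inv A) = real CARD('p) *\<^sub>R B" using fit by (auto simp: separable_fit_def)
  define D where "D = kronecker B A - S"
  define J where "J = Sq \<times> Sp \<union> Aq \<times> Ap"
  define U where "U = insert Q.unit (Sq \<union> Aq) \<times> insert P.unit (Sp \<union> Ap)"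
  have h0: "0 \<le> h" by (simp add: h)
  have symS: "transpose S = S" using S by (rule spd_symmetric)
  have symD: "transpose D = D" using spd by (simp add: D_def transpose_diff transpose_kronecker spd_symmetric symS)
  have n1: "norm s = 1" if "s \<in> insert Q.unit (Sq \<union> Aq)" for s
    using Q.orthonormal_basis that by (rule orthonormal_norm)
  have n2: "norm t = 1" if "t \<in> insert P.unit (Sp \<union> Ap)" for t
    using P.orthonormal_basis that by (rule orthonormal_norm)
  have finU: "finite U" using Q.orthonormal_basis P.orthonormal_basis by (simp add: U_def orthonormal_def)
  have JU: "J \<subseteq> U" by (auto simp: J_def U_def)
  have cardU: "real (card U) = (real CARD('q) * real CARD('p))\<^sup>2"
    unfolding U_def card_cartesian_product Q.card_basis P.card_basis by (simp add: power2_eq_square)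
  have pars: "(norm D)\<^sup>2 = (\<Sum>x\<in>U. (kronecker (fst x) (snd x) \<bullet> D)\<^sup>2)"
    unfolding U_def
    by (subst parseval_kronecker[OF Q.orthonormal_basis P.orthonormal_basis Q.card_basis P.card_basis])
      (simp add: case_prod_beta)
  \<comment> \<open>Both partial traces of \<open>D\<close> vanish at the precisions of the fit. At
    weight \<open>mat 1\<close> they are therefore bounded by the norm of \<open>D\<close> times the
    deviation of a precision from \<open>mat 1\<close>, which is of second order.\<close>
  have col0: "ptrace_col D (matrix_inv A) = 0"
    using spd(1) spd_matrix_inv[OF spd(1)]
    by (simp add: D_def ptc.diff_left ptrace_col_kronecker eqs inner_eq_trace spd_symmetric matrix_inv_mult spd_det_nz trace_I)
  have row0: "ptrace_row D (matrix_inv B) = 0"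
    using spd(2) spd_matrix_inv[OF spd(2)]
    by (simp add: D_def ptr.diff_left ptrace_row_kronecker eqs inner_eq_trace spd_symmetric matrix_inv_mult spd_det_nz trace_I)
  have col: "\<bar>kronecker s P.unit \<bullet> D\<bar> \<le> 2 * b * c * h\<^sup>2" if "norm s = 1" for s
  proof -
    have "kronecker s P.unit \<bullet> D = (1 / sqrt (real CARD('p))) * (s \<bullet> ptrace_col D (mat 1))"
      by (simp add: P.unit_def inner_ptrace_col kr.scaleR_right)
    also have "ptrace_col D (mat 1) = - ptrace_col D (matrix_inv A - mat 1)"
      by (simp add: ptc.diff_right col0)
    finally have "\<bar>kronecker s P.unit \<bullet> D\<bar> = (1 / sqrt (real CARD('p))) * \<bar>s \<bullet> ptrace_col D (matrix_inv A - mat 1)\<bar>"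
      by (simp add: abs_mult)
    also have "\<dots> \<le> 1 * \<bar>s \<bullet> ptrace_col D (matrix_inv A - mat 1)\<bar>"
      using CARD_ge_1_real[where 'n='p] by (intro mult_right_mono) (auto simp: divide_le_eq)
    also have "\<dots> \<le> norm s * norm (ptrace_col D (matrix_inv A - mat 1))" using Cauchy_Schwarz_ineq2 by simp
    also have "\<dots> \<le> norm D * norm (matrix_inv A - mat 1)" by (simp add: that norm_ptrace_col_le)
    also have "\<dots> \<le> (c * h) * (2 * h)" using hD hA h0 by (intro mult_mono) (auto simp: D_def)
    also have "\<dots> \<le> b * ((c * h) * (2 * h))" using hB(3) hD(2) h0 mult_right_mono[OF hB(3), of "(c * h) * (2 * h)"] by simp
    finally show ?thesis by (simp add: power2_eq_square mult_ac)
  qed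
  have row: "\<bar>kronecker Q.unit t \<bullet> D\<bar> \<le> 2 * b * c * h\<^sup>2" if "norm t = 1" for t
  proof -
    have "kronecker Q.unit t \<bullet> D = (1 / sqrt (real CARD('q))) * (t \<bullet> ptrace_row D (mat 1))"
      by (simp add: Q.unit_def inner_ptrace_row kr.scaleR_left)
    also have "ptrace_row D (mat 1) = - ptrace_row D (matrix_inv B - mat 1)"
      by (simp add: ptr.diff_right row0)
    finally have "\<bar>kronecker Q.unit t \<bullet> D\<bar> = (1 / sqrt (real CARD('q))) * \<bar>t \<bullet> ptrace_row D (matrix_inv B - mat 1)\<bar>"
      by (simp add: abs_mult)
    also have "\<dots> \<le> 1 * \<bar>t \<bullet> ptrace_row D (matrix_inv B - mat 1)\<bar>"
      using CARD_ge_1_real[where 'n='q] by (intro mult_right_mono) (auto simp: divide_le_eq)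
    also have "\<dots> \<le> norm t * norm (ptrace_row D (matrix_inv B - mat 1))" using Cauchy_Schwarz_ineq2 by simp
    also have "\<dots> \<le> norm D * norm (matrix_inv B - mat 1)" by (simp add: that norm_ptrace_row_le)
    also have "\<dots> \<le> (c * h) * (2 * b * h)" using hD hB h0 by (intro mult_mono) (auto simp: D_def)
    finally show ?thesis by (simp add: power2_eq_square mult_ac)
  qed
  \<comment> \<open>A Kronecker product of a symmetric and an alternating factor is alternating,
    whereas \<open>D\<close> is symmetric.\<close>
  have mixed: "kronecker s t \<bullet> D = 0"
    if "transpose (kronecker s t) = - kronecker s t" for s :: "real^'q^'q" and t :: "real^'p^'p"
    using alternating_inner_symmetric[OF _ symD] that by (simp add: alternating_def)
  have rest: "\<bar>kronecker (fst x) (snd x) \<bullet> D\<bar> \<le> 2 * b * c * h\<^sup>2" if x: "x \<in> U - J" for x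
  proof -
    obtain s t where st: "x = (s, t)" by (cases x)
    have nn: "0 \<le> 2 * b * c * h\<^sup>2" using hB(3) hD(2) by simp
    consider "s = Q.unit" "norm t = 1" | "t = P.unit" "norm s = 1" | "s \<in> Sq" "t \<in> Ap" | "s \<in> Aq" "t \<in> Sp"
      using x n1[of s] n2[of t] by (auto simp: U_def J_def st)
    then show ?thesis
    proof cases
      case 3
      then have "transpose s = s" "transpose t = - t"
        using Q.Sy(1) P.Al(1) by (auto simp: traceless_symmetric_def alternating_def)
      then have "kronecker s t \<bullet> D = 0" by (intro mixed) (simp add: transpose_kronecker kr.minus_right)
      then show ?thesis using nn by (simp add: st)
    next
      case 4
      then have "transpose s = - s" "transpose t = t"
        using Q.Al(1) P.Sy(1) by (auto simp: traceless_symmetric_def alternating_def)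
      then have "kronecker s t \<bullet> D = 0" by (intro mixed) (simp add: transpose_kronecker kr.minus_left)
      then show ?thesis using nn by (simp add: st)
    qed (auto simp: st row col)
  qed
  have h4: "h\<^sup>2 * h\<^sup>2 \<le> h^3"
    using h0 h(2) mult_right_mono[of h 1 "h^3"] by (simp add: power2_eq_square power3_eq_cube mult_ac)
  have rest2: "(kronecker (fst x) (snd x) \<bullet> D)\<^sup>2 \<le> 4 * b\<^sup>2 * c\<^sup>2 * h^3" if x: "x \<in> U - J" for x
  proof -
    have "(kronecker (fst x) (snd x) \<bullet> D)\<^sup>2 \<le> (2 * b * c * h\<^sup>2)\<^sup>2"
      using rest[OF x] by (metis abs_le_square_iff abs_of_nonneg order_trans abs_ge_zero)
    also have "\<dots> = 4 * b\<^sup>2 * c\<^sup>2 * (h\<^sup>2 * h\<^sup>2)" by (simp add: power2_eq_square)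
    also have "\<dots> \<le> 4 * b\<^sup>2 * c\<^sup>2 * h^3" using h4 by (intro mult_left_mono) auto
    finally show ?thesis .
  qed
  have main: "\<bar>(kronecker (fst x) (snd x) \<bullet> D)\<^sup>2 - (kronecker (fst x) (snd x) \<bullet> (S - mat 1))\<^sup>2\<bar> \<le> 3 * b\<^sup>2 * h^3"
    if x: "x \<in> J" for x
  proof -
    obtain s t where st: "x = (s, t)" by (cases x)
    have tr0: "trace s = 0" "trace t = 0" using x Q.trace_0 P.trace_0 by (auto simp: st J_def)
    have ns: "norm s = 1" "norm t = 1" using x JU n1[of s] n2[of t] by (auto simp: st U_def)
    \<comment> \<open>The traceless \<open>s\<close> and \<open>t\<close> are orthogonal to the
      identity, so the component \<open>u\<close> of the fit is a product of two first-order
      quantities, while the component \<open>v\<close> of \<open>S\<close> is of first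
      order.\<close>
    define u where "u = kronecker s t \<bullet> kronecker B A"
    define v where "v = kronecker s t \<bullet> (S - mat 1)"
    have "kronecker s t \<bullet> mat 1 = 0"
      using inner_kronecker[of s t "mat 1" "mat 1"] by (simp add: inner_mat_1 tr0)
    then have uv: "kronecker s t \<bullet> D = u - v" by (simp add: D_def u_def v_def inner_diff_right)
    have su: "\<bar>s \<bullet> (B - mat 1)\<bar> \<le> b * h" "\<bar>t \<bullet> (A - mat 1)\<bar> \<le> h"
      using Cauchy_Schwarz_ineq2[of s "B - mat 1"] Cauchy_Schwarz_ineq2[of t "A - mat 1"] hB(1) hA(1) by (simp_all add: ns)
    have "u = (s \<bullet> (B - mat 1)) * (t \<bullet> (A - mat 1))"
      by (simp add: u_def inner_kronecker inner_diff_right inner_mat_1 tr0)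
    then have "\<bar>u\<bar> = \<bar>s \<bullet> (B - mat 1)\<bar> * \<bar>t \<bullet> (A - mat 1)\<bar>" by (simp add: abs_mult)
    also have "\<dots> \<le> (b * h) * h" using su h0 hB(3) by (intro mult_mono) auto
    finally have "\<bar>u\<bar> \<le> (b * h) * h" .
    then have u: "\<bar>u\<bar> \<le> b * h\<^sup>2" by (simp add: power2_eq_square)
    have v: "\<bar>v\<bar> \<le> h"
      using Cauchy_Schwarz_ineq2[of "kronecker s t" "S - mat 1"] by (simp add: v_def norm_kronecker ns h)
    have "\<bar>(u - v)\<^sup>2 - v\<^sup>2\<bar> = \<bar>u * u - 2 * (u * v)\<bar>" by (simp add: power2_eq_square algebra_simps)
    also have "\<dots> \<le> \<bar>u\<bar> * \<bar>u\<bar> + 2 * (\<bar>u\<bar> * \<bar>v\<bar>)"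
      by (rule order_trans[OF abs_triangle_ineq4]) (simp add: abs_mult)
    also have "\<dots> \<le> (b * h\<^sup>2) * (b * h\<^sup>2) + 2 * ((b * h\<^sup>2) * h)"
      using u v h0 by (intro add_mono mult_left_mono mult_mono) auto
    also have "\<dots> = b\<^sup>2 * (h\<^sup>2 * h\<^sup>2) + 2 * b * h^3" by (simp add: power2_eq_square power3_eq_cube)
    also have "\<dots> \<le> b\<^sup>2 * h^3 + 2 * b\<^sup>2 * h^3"
      using hB(3) h4 h0 mult_right_mono[OF hB(3), of b]
      by (intro add_mono mult_left_mono mult_right_mono) (auto simp: power2_eq_square)
    finally show ?thesis by (simp add: st uv v_def[symmetric])
  qed
  have "\<bar>(norm D)\<^sup>2 - (\<Sum>x\<in>J. (kronecker (fst x) (snd x) \<bullet> (S - mat 1))\<^sup>2)\<bar>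
    = \<bar>(\<Sum>x\<in>J. (kronecker (fst x) (snd x) \<bullet> D)\<^sup>2 - (kronecker (fst x) (snd x) \<bullet> (S - mat 1))\<^sup>2)
        + (\<Sum>x\<in>U - J. (kronecker (fst x) (snd x) \<bullet> D)\<^sup>2)\<bar>"
    unfolding pars sum.subset_diff[OF JU finU] by (simp add: sum_subtractf)
  also have "\<dots> \<le> (\<Sum>x\<in>J. 3 * b\<^sup>2 * h^3) + (\<Sum>x\<in>U - J. 4 * b\<^sup>2 * c\<^sup>2 * h^3)"
    by (rule order_trans[OF abs_triangle_ineq], rule add_mono;
        rule order_trans[OF sum_abs], rule sum_mono) (use main rest2 in auto)
  also have "\<dots> \<le> (\<Sum>x\<in>U. 3 * b\<^sup>2 * h^3) + (\<Sum>x\<in>U. 4 * b\<^sup>2 * c\<^sup>2 * h^3)"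
    using finU JU h0 by (intro add_mono sum_mono2) auto
  also have "\<dots> = real (card U) * (3 * b\<^sup>2 + 4 * b\<^sup>2 * c\<^sup>2) * h^3" by (simp add: algebra_simps)
  finally show ?thesis
    unfolding cardU D_def J_def by (simp add: case_prod_beta)
qed

theorem separability_stat_expansion:
  fixes Sq Aq :: "(real^'q^'q) set" and Sp Ap :: "(real^'p^'p) set"
  assumes bq: "matrix_basis Sq Aq" and bp: "matrix_basis Sp Ap"
  obtains C \<delta> :: real where "0 \<le> C" "0 < \<delta>"
    "\<And>(S :: real^('q \<times> 'p)^('q \<times> 'p)) A B. spd S \<Longrightarrow> separable_fit S A B \<Longrightarrow> norm (S - mat 1) \<le> \<delta> \<Longrightarrow>
      \<bar>separability_stat S (kronecker B A) - (\<Sum>(s, t)\<in>Sq \<times> Sp \<union> Aq \<times> Ap. (kronecker s t \<bullet> (S - mat 1))\<^sup>2)\<bar>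
        \<le> C * norm (S - mat 1) ^ 3"
proof -
  let ?p = "real CARD('p)" and ?q = "real CARD('q)" and ?N = "real CARD('q \<times> 'p)"
  \<comment> \<open>Relative to \<open>norm (S - mat 1)\<close>, \<open>b\<close> bounds the
    deviation of \<open>B\<close> from the identity and \<open>c\<close> that of the Kronecker
    product; \<open>\<delta>\<close> is the smallness threshold of
    \<open>separability_stat_near\<close>.\<close>
  define b where "b = 2 + 2 * ?q"
  define c where "c = b * (?p + 1) + ?q"
  define \<delta> where "\<delta> = 1 / (8 * (c + 1)\<^sup>2 * (?N + 1)\<^sup>2)"
  define C where "C = 1000 * (c + 1)^6 * (?N + 1)^6 + (?q * ?p)\<^sup>2 * (3 * b\<^sup>2 + 4 * b\<^sup>2 * (c + 1)\<^sup>2)"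
  have p1: "1 \<le> ?p" "1 \<le> ?q" by (rule CARD_ge_1_real)+
  have b: "1 \<le> b" using p1 by (simp add: b_def)
  have bc: "b \<le> c" unfolding c_def using p1 b mult_left_mono[of 1 "?p + 1" b] by linarith
  have c: "1 \<le> c" using b bc by simp
  have "0 < (c + 1)\<^sup>2 * (?N + 1)\<^sup>2"
    using c by (intro mult_pos_pos zero_less_power add_nonneg_pos) auto
  then have "0 < \<delta>" by (simp add: \<delta>_def)
  moreover have "0 \<le> C" using c by (simp add: C_def)
  moreover have "\<bar>separability_stat S (kronecker B A) - (\<Sum>(s, t)\<in>Sq \<times> Sp \<union> Aq \<times> Ap. (kronecker s t \<bullet> (S - mat 1))\<^sup>2)\<bar>
        \<le> C * norm (S - mat 1) ^ 3"
    if S: "spd S" and fit: "separable_fit S A B" and near: "norm (S - mat 1) \<le> \<delta>"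
    for S :: "real^('q \<times> 'p)^('q \<times> 'p)" and A B
  proof -
    \<comment> \<open>The given fit is replaced by its trace-normalized multiple, to which
      \<open>separable_fit_near\<close> applies; the Kronecker product is unchanged.\<close>
    obtain K where K: "K \<in> psd_trace ?q" "col_fit S K ** K = mat 1"
      "kronecker (col_fit S K) (row_fit S K) = kronecker B A" using separable_fit_normalize[OF fit] .
    define A' where "A' = row_fit S K"
    define B' where "B' = col_fit S K"
    define h where "h = norm (S - mat 1)"
    have h0: "0 \<le> h" by (simp add: h_def)
    have fit': "separable_fit S A' B'"
      unfolding A'_def B'_def using K p1 by (intro separable_fit_of_precision S) (auto simp: psd_trace_def)
    have spd: "spd A'" "spd B'" using fit' by (auto simp: separable_fit_def)
    have "matrix_inv B' = K" unfolding B'_def by (rule matrix_inv_unique[OF K(2)])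
    then have trB: "trace (matrix_inv B') = ?q" using K(1) by (simp add: psd_trace_def)
    have small: "8 * (c + 1)\<^sup>2 * (?N + 1)\<^sup>2 * h \<le> 1"
      using near \<open>0 < \<delta>\<close> c unfolding \<delta>_def h_def by (simp add: le_divide_eq mult_ac add_pos_pos split: if_splits)
    have ch: "c * h \<le> 1 / 8"
    proof -
      have "c * 1 \<le> (c + 1)\<^sup>2 * (?N + 1)\<^sup>2"
        using c by (intro mult_mono) (auto simp: power2_eq_square algebra_simps)
      then have "8 * (c * h) \<le> 8 * (c + 1)\<^sup>2 * (?N + 1)\<^sup>2 * h" using h0 by (simp add: mult_right_mono mult.assoc[symmetric])
      then show ?thesis using small by linarith
    qed
    have hc: "h \<le> c * h" "b * h \<le> c * h" using c bc h0 by (auto simp: mult_le_cancel_right1 intro: mult_right_mono)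
    have h8: "h \<le> 1 / 8" "b * h \<le> 1 / 8" using hc ch by linarith+
    have near': "norm (S - mat 1) \<le> 1 / 2" using h8 by (simp add: h_def)
    note near_fit = separable_fit_near[OF S fit' trB near', folded h_def b_def]
    have iA: "norm (matrix_inv A' - mat 1) \<le> 2 * h"
      using norm_matrix_inv_minus_1_le[OF spd_det_nz[OF spd(1)]] near_fit h8 by linarith
    have iB: "norm (matrix_inv B' - mat 1) \<le> 2 * b * h"
      using norm_matrix_inv_minus_1_le[OF spd_det_nz[OF spd(2)]] near_fit h8 by linarith
    have T: "norm (kronecker B' A' - mat 1) \<le> c * h"
    proof -
      have "kronecker B' A' - mat 1 = kronecker (B' - mat 1) A' + kronecker (mat 1) (A' - mat 1)"
        by (simp add: kr.diff_left kr.diff_right)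
      then have "norm (kronecker B' A' - mat 1) \<le> norm (B' - mat 1) * norm A' + norm (mat 1 :: real^'q^'q) * norm (A' - mat 1)"
        by (metis norm_kronecker norm_triangle_ineq)
      also have "\<dots> \<le> (b * h) * (?p + 1) + ?q * h"
        using near_fit h8 h0 b by (intro add_mono mult_mono norm_mat_1_le norm_le_of_near_1) auto
      finally show ?thesis by (simp add: c_def algebra_simps)
    qed
    have D: "norm (kronecker B' A' - S) \<le> (c + 1) * h"
      using norm_triangle_ineq4[of "kronecker B' A' - mat 1" "S - mat 1"] T by (simp add: h_def algebra_simps)
    have "\<bar>separability_stat S (kronecker B' A') - (norm (kronecker B' A' - S))\<^sup>2\<bar> \<le> 1000 * (c + 1)^6 * (?N + 1)^6 * h^3"
      by (rule separability_stat_near[OF S spd_kronecker[OF spd(2,1)] separable_fit_trace[OF fit'] _ T h0 c small])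
        (simp add: h_def)
    moreover have "\<bar>(norm (kronecker B' A' - S))\<^sup>2 - (\<Sum>(s, t)\<in>Sq \<times> Sp \<union> Aq \<times> Ap. (kronecker s t \<bullet> (S - mat 1))\<^sup>2)\<bar>
      \<le> (?q * ?p)\<^sup>2 * (3 * b\<^sup>2 + 4 * b\<^sup>2 * (c + 1)\<^sup>2) * h^3"
      by (rule residual_expansion[OF bq bp S fit' h_def _ near_fit(1) iA near_fit(2) iB b D]) (use h8 c in auto)
    moreover have "kronecker B A = kronecker B' A'" by (simp add: A'_def B'_def K)
    ultimately show ?thesis by (simp add: C_def h_def[symmetric] distrib_right)
  qed
  ultimately show ?thesis using that by blast
qed

section \<open>Fourth moments of matrix spherical distributions\<close>

text \<open>Invariance of a 4-tensor under sign changes, permutations and the reflections whose restriction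
  to a coordinate plane has first row \<open>(3/5, -4/5)\<close>; these already determine it up to three constants.\<close>

definition isotropic4 :: "('n::finite \<Rightarrow> 'n \<Rightarrow> 'n \<Rightarrow> 'n \<Rightarrow> real) \<Rightarrow> bool" where
  "isotropic4 t \<longleftrightarrow>
     (\<forall>e a b c d. t a b c d = (\<Prod>x\<leftarrow>[a, b, c, d]. if x = e then -1 else 1) * t a b c d) \<and>
     (\<forall>\<sigma> a b c d. bij \<sigma> \<longrightarrow> t (\<sigma> a) (\<sigma> b) (\<sigma> c) (\<sigma> d) = t a b c d) \<and>
     (\<forall>u v. u \<noteq> v \<longrightarrow> 625 * t u u u u =
        (\<Sum>a\<in>{u, v}. \<Sum>b\<in>{u, v}. \<Sum>c\<in>{u, v}. \<Sum>d\<in>{u, v}.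
          (\<Prod>x\<leftarrow>[a, b, c, d]. if x = u then 3 else -4) * t a b c d))"

lemma bij_two_points:
  assumes "i \<noteq> j" "a \<noteq> b"
  obtains \<sigma> :: "'n \<Rightarrow> 'n" where "bij \<sigma>" "\<sigma> i = a" "\<sigma> j = b"
proof -
  define \<tau> where "\<tau> = Transposition.transpose i a"
  define \<sigma> where "\<sigma> = Transposition.transpose (\<tau> j) b \<circ> \<tau>"
  have "\<tau> j \<noteq> a" using assms by (auto simp: \<tau>_def Transposition.transpose_def)
  then have "\<sigma> i = a" using assms by (auto simp: \<sigma>_def \<tau>_def Transposition.transpose_def)
  moreover have "\<sigma> j = b" by (simp add: \<sigma>_def)
  moreover have "bij \<sigma>" by (simp add: \<sigma>_def \<tau>_def bij_comp)
  ultimately show ?thesis using that by blast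
qed

text \<open>Permutations act transitively on pairs of distinct indices, so each pairing has one
  value; sign changes kill the entries matching no pairing; the reflection expresses the entry with
  four equal indices through the pairing values.\<close>

lemma isotropic4_form:
  assumes t: "isotropic4 t" and ij: "i \<noteq> j"
  shows "t a b c d = (if a = b \<and> c = d then t i i j j else 0) +
    (if a = c \<and> b = d then t i j i j else 0) + (if a = d \<and> b = c then t i j j i else 0)"
proof -
  have flip: "t a b c d = (\<Prod>x\<leftarrow>[a, b, c, d]. if x = e then -1 else 1) * t a b c d" for e a b c d
    using t unfolding isotropic4_def by blast
  have perm: "bij \<sigma> \<Longrightarrow> t (\<sigma> a) (\<sigma> b) (\<sigma> c) (\<sigma> d) = t a b c d" for \<sigma> a b c d
    using t unfolding isotropic4_def by blast
  have rot: "u \<noteq> v \<Longrightarrow> 625 * t u u u u =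
        (\<Sum>a\<in>{u, v}. \<Sum>b\<in>{u, v}. \<Sum>c\<in>{u, v}. \<Sum>d\<in>{u, v}.
          (\<Prod>x\<leftarrow>[a, b, c, d]. if x = u then 3 else -4) * t a b c d)" for u v
    using t unfolding isotropic4_def by blast
  have pairs: "t u u v v = t i i j j" "t u v u v = t i j i j" "t u v v u = t i j j i" if uv: "u \<noteq> v" for u v
  proof -
    obtain \<sigma> where s: "bij \<sigma>" "\<sigma> i = u" "\<sigma> j = v" using bij_two_points[OF ij uv] by metis
    show "t u u v v = t i i j j" "t u v u v = t i j i j" "t u v v u = t i j j i"
      using perm[OF s(1), of i i j j] perm[OF s(1), of i j i j] perm[OF s(1), of i j j i] by (simp_all add: s)
  qed
  have odd3: "t u u u v = 0" "t u u v u = 0" "t u v u u = 0" "t v u u u = 0" if "u \<noteq> v" for u v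
    using that flip[of u u u v v] flip[of u u v u v] flip[of u v u u v] flip[of v u u u v] by auto
  \<comment> \<open>With \<open>x\<close> the entry with equal indices and \<open>y\<close> the sum
    of the three pairing values, the reflection identity reads
    \<open>625 x = (81 + 256) x + 288 y\<close>, and \<open>625 - 337 = 288\<close>.\<close>
  have all: "t u u u u = t i i j j + t i j i j + t i j j i" for u
  proof -
    obtain v where uv: "u \<noteq> v" using ij by metis
    obtain \<sigma> where s: "bij \<sigma>" "\<sigma> u = v" using bij_two_points[OF uv, of v u] uv by metis
    have "t v v v v = t u u u u" using perm[OF s(1), of u u u u] by (simp add: s)
    then show ?thesis
      using rot[OF uv] uv by (simp add: odd3[OF uv] odd3[OF uv[symmetric]] pairs[OF uv] pairs[OF uv[symmetric]])
  qed
  show ?thesis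
  proof (cases "(a = b \<and> c = d) \<or> (a = c \<and> b = d) \<or> (a = d \<and> b = c)")
    case True
    then consider "a = b" "c = d" "a = c" | "a = b" "c = d" "a \<noteq> c" | "a = c" "b = d" "a \<noteq> b" | "a = d" "b = c" "a \<noteq> b"
      by blast
    then show ?thesis
    proof cases
      case 1 then show ?thesis using all[of a] by simp
    next
      case 2 then show ?thesis using pairs(1)[OF 2(3)] by auto
    next
      case 3 then show ?thesis using pairs(2)[OF 3(3)] by auto
    next
      case 4 then show ?thesis using pairs(3)[OF 4(3)] by auto
    qed
  next
    case False
    let ?P = "\<lambda>e. (\<Prod>x\<leftarrow>[a, b, c, d]. if x = e then -1 else 1) = (-1 :: real)"
    \<comment> \<open>If no pairing matches, one of the four indices differs from the other three,
      and flipping the sign at an index that occurs once negates the entry.\<close>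
    have "\<exists>e. ?P e"
    proof -
      consider "a \<notin> {b, c, d}" | "b \<notin> {a, c, d}" | "c \<notin> {a, b, d}" | "d \<notin> {a, b, c}"
        using False by blast
      then show ?thesis
      proof cases
        case 1 then have "?P a" by auto then show ?thesis ..
      next
        case 2 then have "?P b" by auto then show ?thesis ..
      next
        case 3 then have "?P c" by auto then show ?thesis ..
      next
        case 4 then have "?P d" by auto then show ?thesis ..
      qed
    qed
    then obtain e where "?P e" by blast
    then have "t a b c d = - 1 * t a b c d" using flip[of a b c d e] by (simp only:)
    then have "t a b c d = 0" by simp
    moreover have "(a = b \<and> c = d) = False" "(a = c \<and> b = d) = False" "(a = d \<and> b = c) = False"
      using False by blast+
    ultimately show ?thesis by (simp only: if_False add_0)
  qed
qed

text \<open>Each pairing contracts the two matrices to a scalar; the one joining \<open>a\<close>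
  with \<open>b\<close> and \<open>c\<close> with \<open>d\<close> produces the factor
  \<open>trace s\<close> and disappears.\<close>

lemma isotropic4_contract:
  fixes s s' :: "real^'n^'n"
  assumes "isotropic4 t" "i \<noteq> j" "trace s = 0"
  shows "(\<Sum>a\<in>UNIV. \<Sum>b\<in>UNIV. \<Sum>c\<in>UNIV. \<Sum>d\<in>UNIV. s $ a $ b * s' $ c $ d * t a b c d)
    = (s \<bullet> s') * t i j i j + (s \<bullet> transpose s') * t i j j i"
proof -
  let ?S = "\<lambda>f. \<Sum>a\<in>UNIV. \<Sum>b\<in>UNIV. \<Sum>c\<in>UNIV. \<Sum>d\<in>UNIV. f a b c d :: real"
  have "?S (\<lambda>a b c d. s $ a $ b * s' $ c $ d * t a b c d) =
     ?S (\<lambda>a b c d. if d = c then if b = a then s $ a $ b * s' $ c $ d * t i i j j else 0 else 0)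
   + ?S (\<lambda>a b c d. if d = b then if c = a then s $ a $ b * s' $ c $ d * t i j i j else 0 else 0)
   + ?S (\<lambda>a b c d. if d = a then if c = b then s $ a $ b * s' $ c $ d * t i j j i else 0 else 0)"
    unfolding sum.distrib[symmetric]
    by (intro sum.cong refl, subst isotropic4_form[OF assms(1,2)]) (simp add: algebra_simps)
  also have "?S (\<lambda>a b c d. if d = c then if b = a then s $ a $ b * s' $ c $ d * t i i j j else 0 else 0) = 0"
  proof -
    have "?S (\<lambda>a b c d. if d = c then if b = a then s $ a $ b * s' $ c $ d * t i i j j else 0 else 0)
      = (\<Sum>a\<in>UNIV. \<Sum>b\<in>UNIV. if b = a then (\<Sum>c\<in>UNIV. s $ a $ b * s' $ c $ c * t i i j j) else 0)"
      by (intro sum.cong refl) auto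
    also have "\<dots> = trace s * (\<Sum>c\<in>UNIV. s' $ c $ c * t i i j j)"
      by (simp add: trace_def sum_product mult_ac)
    finally show ?thesis using assms(3) by simp
  qed
  also have "?S (\<lambda>a b c d. if d = b then if c = a then s $ a $ b * s' $ c $ d * t i j i j else 0 else 0)
      = (s \<bullet> s') * t i j i j"
    by (simp add: inner_vec_def sum_distrib_right)
  also have "?S (\<lambda>a b c d. if d = a then if c = b then s $ a $ b * s' $ c $ d * t i j j i else 0 else 0)
      = (s \<bullet> transpose s') * t i j j i"
    by (simp add: inner_vec_def sum_distrib_right transpose_def)
  finally show ?thesis by simp
qed

lemma outer_mult_outer: "outer w ** outer w = (w \<bullet> w) *\<^sub>R outer w"
  by (simp add: vec_eq_iff matrix_matrix_mult_def outer_def inner_vec_def sum_distrib_right sum_distrib_left mult_ac)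

text \<open>The Householder reflection along \<open>w\<close>, with \<open>2 / 5\<close> equal to
  \<open>2 / (w \<bullet> w)\<close>. For \<open>w = e_u + 2 e_v\<close> its row \<open>u\<close> is
  \<open>(3/5, -4/5)\<close>, so that only rational coefficients occur.\<close>

lemma orthogonal_reflection:
  assumes "w \<bullet> w = (5 :: real)"
  shows "orthogonal_matrix (mat 1 - (2 / 5) *\<^sub>R outer w)"
  unfolding orthogonal_matrix
  by (simp add: transpose_diff transpose_scalar mm.diff_left mm.diff_right mm.scaleR_left mm.scaleR_right
      outer_mult_outer assms scaleR_diff_right scaleR_left_distrib[symmetric])

lemma orthogonal_permutation:
  assumes "bij \<sigma>" shows "orthogonal_matrix (\<chi> i j. if j = \<sigma> i then (1::real) else 0)"
proof -
  have "(\<chi> i j. if j = \<sigma> i then (1::real) else 0) ** transpose (\<chi> i j. if j = \<sigma> i then 1 else 0) = mat 1"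
    using assms by (auto simp: vec_eq_iff matrix_matrix_mult_def transpose_def mat_def mult_delta_left bij_def inj_eq)
  then show ?thesis using matrix_left_right_inverse unfolding orthogonal_matrix by blast
qed

lemma orthogonal_sign: "orthogonal_matrix (diag_mat (\<lambda>x. if x = e then -1 else 1))"
  unfolding orthogonal_matrix transpose_diag_mat diag_mat_mult diag_mat_1[symmetric]
  by (rule arg_cong[where f = diag_mat]) auto

lemma sum_product4:
  fixes f :: "'a \<Rightarrow> 'b::comm_semiring_0"
  shows "(\<Sum>a\<in>A. f a) * (\<Sum>b\<in>B. g b) * (\<Sum>c\<in>C. h c) * (\<Sum>d\<in>D. k d) =
    (\<Sum>a\<in>A. \<Sum>b\<in>B. \<Sum>c\<in>C. \<Sum>d\<in>D. f a * g b * h c * k d)"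
  by (simp only: sum_distrib_left[symmetric] sum_distrib_right[symmetric])

lemma sum2_product:
  fixes f :: "'a \<Rightarrow> 'b \<Rightarrow> 'c::comm_semiring_0"
  shows "(\<Sum>a\<in>A. \<Sum>b\<in>B. f a b) * (\<Sum>c\<in>C. \<Sum>d\<in>D. g c d) =
    (\<Sum>a\<in>A. \<Sum>b\<in>B. \<Sum>c\<in>C. \<Sum>d\<in>D. f a b * g c d)"
  by (simp only: sum_distrib_left[symmetric] sum_distrib_right[symmetric])

locale spherical_moments = prob_space F for F :: "(real^'q^'p) measure" +
  assumes sets_F: "sets F = sets borel"
    and spherical: "matrix_spherical F"
    and moment4: "integrable F (\<lambda>Z. norm Z ^ 4)"
begin

lemma measurable_F: "f \<in> borel_measurable borel \<Longrightarrow> f \<in> borel_measurable F"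
  by (simp add: measurable_cong_sets[OF sets_F refl])

lemma measurable_entry: "(\<lambda>Z :: real^'q^'p. Z $ j $ k) \<in> borel_measurable borel"
  by (intro borel_measurable_continuous_onI continuous_intros)

lemma abs_entry_le: "\<bar>(Z :: real^'q^'p) $ j $ k\<bar> \<le> norm Z"
  using Finite_Cartesian_Product.norm_nth_le[of "Z $ j" k] Finite_Cartesian_Product.norm_nth_le[of Z j] by simp

lemma integrable_4: "integrable F (\<lambda>Z. Z $ a $ i * Z $ b $ j * Z $ c $ k * Z $ d $ l)"
proof (rule Bochner_Integration.integrable_bound[OF moment4])
  show "(\<lambda>Z. Z $ a $ i * Z $ b $ j * Z $ c $ k * Z $ d $ l) \<in> borel_measurable F"
    by (intro measurable_F borel_measurable_times measurable_entry)
  have "\<bar>Z $ a $ i * Z $ b $ j * Z $ c $ k * Z $ d $ l\<bar> \<le> norm Z * norm Z * norm Z * norm Z" for Z :: "real^'q^'p"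
    unfolding abs_mult by (intro mult_mono abs_entry_le) auto
  then show "AE Z in F. norm (Z $ a $ i * Z $ b $ j * Z $ c $ k * Z $ d $ l) \<le> norm (norm Z ^ 4)"
    by (simp add: power4_eq_xxxx mult.assoc)
qed

text \<open>Sphericity with the identity as right factor; the action on columns is reached by
  transposing the distribution.\<close>

lemma integral_left_orthogonal:
  assumes f: "f \<in> borel_measurable borel" and O1: "orthogonal_matrix O1"
  shows "(\<integral>Z. f (O1 ** Z) \<partial>F) = (\<integral>Z. f Z \<partial>F :: real)"
proof -
  have m: "(\<lambda>Z. O1 ** Z ** transpose (mat 1)) \<in> measurable F borel"
    unfolding measurable_cong_sets[OF sets_F refl]
    by (intro borel_measurable_continuous_onI mm.continuous_on continuous_intros)
  have "(\<integral>Z. f Z \<partial>F) = (\<integral>Z. f Z \<partial>distr F borel (\<lambda>Z. O1 ** Z ** transpose (mat 1)))"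
    using spherical O1 orthogonal_matrix_id unfolding matrix_spherical_def by metis
  also have "\<dots> = (\<integral>Z. f (O1 ** Z ** transpose (mat 1)) \<partial>F)"
    by (rule integral_distr[OF m f])
  finally show ?thesis by simp
qed

lemma sign_mult: "(diag_mat d ** Z) $ a $ k = d a * Z $ a $ k"
  by (simp add: matrix_matrix_mult_def diag_mat_def mult_delta_left)

lemma permutation_mult: "((\<chi> i j. if j = \<sigma> i then (1::real) else 0) ** Z) $ a $ k = Z $ \<sigma> a $ k"
  by (simp add: matrix_matrix_mult_def mult_delta_left)

lemma reflection_mult:
  assumes "u \<noteq> v"
  shows "((mat 1 - (2 / 5) *\<^sub>R outer (axis u 1 + 2 *\<^sub>R axis v 1)) ** Z) $ u $ k =
    (\<Sum>a\<in>{u, v}. (if a = u then 3 / 5 else - 4 / 5) * Z $ a $ k)"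
proof -
  have "(outer (axis u 1 + 2 *\<^sub>R axis v 1) ** Z) $ u $ k =
     (\<Sum>b\<in>UNIV. (if b = u then Z $ b $ k else 0) + (if b = v then 2 * Z $ b $ k else 0))"
    using assms by (auto simp: matrix_matrix_mult_def outer_def axis_def intro!: sum.cong)
  also have "\<dots> = Z $ u $ k + 2 * Z $ v $ k" by (simp add: sum.distrib)
  finally show ?thesis using assms by (simp add: mm.diff_left mm.scaleR_left) (simp add: field_simps)
qed

text \<open>The column indices stay fixed and arbitrary. The three clauses come from sign matrices,
  permutation matrices and reflections acting on the rows; four factors \<open>1/5\<close> from the
  reflection account for the number 625.\<close>

lemma isotropic4_rows:
  "isotropic4 (\<lambda>a b c d. \<integral>Z. Z $ a $ i * Z $ b $ j * Z $ c $ k * Z $ d $ l \<partial>F)"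
  unfolding isotropic4_def
proof (intro conjI allI impI)
  let ?f = "\<lambda>a b c d (Z :: real^'q^'p). Z $ a $ i * Z $ b $ j * Z $ c $ k * Z $ d $ l"
  have mf: "?f a b c d \<in> borel_measurable borel" for a b c d
    by (intro borel_measurable_times measurable_entry)
  show "integral\<^sup>L F (?f a b c d) = (\<Prod>x\<leftarrow>[a, b, c, d]. if x = e then -1 else 1) * integral\<^sup>L F (?f a b c d)" for e a b c d
  proof -
    define s :: "'p \<Rightarrow> real" where "s x = (if x = e then -1 else 1)" for x
    have "orthogonal_matrix (diag_mat s)" using orthogonal_sign[of e] by (simp add: s_def[abs_def])
    from integral_left_orthogonal[OF mf this, of a b c d, symmetric]
    have "integral\<^sup>L F (?f a b c d) = (\<integral>Z. (s a * s b * s c * s d) * ?f a b c d Z \<partial>F)"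
      unfolding sign_mult by (simp only: mult_ac)
    moreover have "(\<Prod>x\<leftarrow>[a, b, c, d]. if x = e then -1 else 1) = s a * s b * s c * s d"
      unfolding s_def[symmetric] by (simp add: mult.assoc)
    ultimately show ?thesis by (simp only: integral_mult_right_zero)
  qed
  show "integral\<^sup>L F (?f (\<sigma> a) (\<sigma> b) (\<sigma> c) (\<sigma> d)) = integral\<^sup>L F (?f a b c d)" if "bij \<sigma>" for \<sigma> a b c d
    using integral_left_orthogonal[OF mf orthogonal_permutation[OF that], of a b c d]
    by (simp only: permutation_mult)
  show "625 * integral\<^sup>L F (?f u u u u) =
        (\<Sum>a\<in>{u, v}. \<Sum>b\<in>{u, v}. \<Sum>c\<in>{u, v}. \<Sum>d\<in>{u, v}.
          (\<Prod>x\<leftarrow>[a, b, c, d]. if x = u then 3 else -4) * integral\<^sup>L F (?f a b c d))" if uv: "u \<noteq> v" for u v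
  proof -
    let ?w = "axis u 1 + 2 *\<^sub>R axis v 1 :: real^'p"
    let ?r = "\<lambda>a. if a = u then 3 / 5 else - 4 / 5 :: real"
    have "?w \<bullet> ?w = 5" using uv
      by (simp add: inner_add_left inner_add_right inner_axis_axis)
    from integral_left_orthogonal[OF mf orthogonal_reflection[OF this], of u u u u]
    have "integral\<^sup>L F (?f u u u u) = (\<integral>Z. (\<Sum>a\<in>{u, v}. ?r a * Z $ a $ i) * (\<Sum>a\<in>{u, v}. ?r a * Z $ a $ j)
        * (\<Sum>a\<in>{u, v}. ?r a * Z $ a $ k) * (\<Sum>a\<in>{u, v}. ?r a * Z $ a $ l) \<partial>F)"
      by (simp only: reflection_mult[OF uv])
    also have "\<dots> = (\<integral>Z. (\<Sum>a\<in>{u, v}. \<Sum>b\<in>{u, v}. \<Sum>c\<in>{u, v}. \<Sum>d\<in>{u, v}.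
        (?r a * ?r b * ?r c * ?r d) * ?f a b c d Z) \<partial>F)"
      by (intro Bochner_Integration.integral_cong refl)
        (simp only: sum_product4, intro sum.cong refl, simp only: mult_ac)
    also have "\<dots> = (\<Sum>a\<in>{u, v}. \<Sum>b\<in>{u, v}. \<Sum>c\<in>{u, v}. \<Sum>d\<in>{u, v}.
        (?r a * ?r b * ?r c * ?r d) * integral\<^sup>L F (?f a b c d))"
      by (simp only: Bochner_Integration.integral_sum Bochner_Integration.integrable_sum integrable_4
          integrable_mult_right integral_mult_right_zero)
    also have "\<dots> = (\<Sum>a\<in>{u, v}. \<Sum>b\<in>{u, v}. \<Sum>c\<in>{u, v}. \<Sum>d\<in>{u, v}.
        (1 / 625) * ((\<Prod>x\<leftarrow>[a, b, c, d]. if x = u then 3 else -4) * integral\<^sup>L F (?f a b c d)))"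
      by (intro sum.cong refl) auto
    finally show ?thesis by (simp only: sum_distrib_left[symmetric])
  qed
qed

lemma moment4_rows:
  assumes "a \<noteq> b"
  shows "(\<integral>Z. Z $ j1 $ k1 * Z $ j2 $ k2 * Z $ j3 $ k3 * Z $ j4 $ k4 \<partial>F) =
    (if j1 = j2 \<and> j3 = j4 then \<integral>Z. Z $ a $ k1 * Z $ a $ k2 * Z $ b $ k3 * Z $ b $ k4 \<partial>F else 0) +
    (if j1 = j3 \<and> j2 = j4 then \<integral>Z. Z $ a $ k1 * Z $ b $ k2 * Z $ a $ k3 * Z $ b $ k4 \<partial>F else 0) +
    (if j1 = j4 \<and> j2 = j3 then \<integral>Z. Z $ a $ k1 * Z $ b $ k2 * Z $ b $ k3 * Z $ a $ k4 \<partial>F else 0)"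
  by (rule isotropic4_form[OF isotropic4_rows assms])

lemma moment2: "(\<integral>Z. Z $ j1 $ k1 * Z $ j2 $ k2 \<partial>F) = 0" if "j1 \<noteq> j2"
proof -
  have m: "(\<lambda>Z :: real^'q^'p. Z $ j1 $ k1 * Z $ j2 $ k2) \<in> borel_measurable borel"
    by (intro borel_measurable_times measurable_entry)
  from integral_left_orthogonal[OF m orthogonal_sign[of j1]] that
  have "(\<integral>Z. Z $ j1 $ k1 * Z $ j2 $ k2 \<partial>F) = - (\<integral>Z. Z $ j1 $ k1 * Z $ j2 $ k2 \<partial>F)"
    by (simp add: sign_mult)
  then show ?thesis by simp
qed

lemma moment2_rows: "(\<integral>Z. Z $ j1 $ k1 * Z $ j1 $ k2 \<partial>F) = (\<integral>Z. Z $ j2 $ k1 * Z $ j2 $ k2 \<partial>F)"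
proof (cases "j1 = j2")
  case False
  obtain \<sigma> where s: "bij \<sigma>" "\<sigma> j1 = j2" using bij_two_points[OF False False[symmetric]] by metis
  have m: "(\<lambda>Z :: real^'q^'p. Z $ j1 $ k1 * Z $ j1 $ k2) \<in> borel_measurable borel"
    by (intro borel_measurable_times measurable_entry)
  from integral_left_orthogonal[OF m orthogonal_permutation[OF s(1)]] show ?thesis
    by (simp only: permutation_mult s)
qed simp

lemma moment1: "(\<integral>Z. Z $ j $ k \<partial>F) = 0"
  using integral_left_orthogonal[OF measurable_entry orthogonal_sign[of j], of j k] by (simp add: sign_mult)

text \<open>Exchanges the roles of rows and columns, so that every moment identity for rows yields
  one for columns.\<close>

lemma spherical_moments_transpose: "spherical_moments (distr F borel transpose)"
proof -
  have [measurable]: "transpose \<in> measurable F (borel :: (real^'p^'q) measure)"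
    unfolding measurable_cong_sets[OF sets_F refl]
    by (intro borel_measurable_continuous_onI linear_continuous_on bounded_linear_transpose)
  interpret T: prob_space "distr F borel (transpose :: real^'q^'p \<Rightarrow> real^'p^'q)" by (rule prob_space_distr) measurable
  show ?thesis
  proof
    show "sets (distr F borel (transpose :: real^'q^'p \<Rightarrow> real^'p^'q)) = sets borel" by simp
    show "matrix_spherical (distr F borel (transpose :: real^'q^'p \<Rightarrow> real^'p^'q))"
      unfolding matrix_spherical_def
    proof (intro allI impI)
      fix O1 :: "real^'q^'q" and O2 :: "real^'p^'p" assume O: "orthogonal_matrix O1" "orthogonal_matrix O2"
      have m1: "(\<lambda>Z. O1 ** Z ** transpose O2) \<in> borel_measurable borel" for O1 :: "real^'m^'m" and O2 :: "real^'n^'n"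
        by (intro borel_measurable_continuous_onI mm.continuous_on continuous_intros)
      have m2: "(\<lambda>Z. O2 ** Z ** transpose O1) \<in> measurable F borel"
        using m1[of O2 O1] by (simp add: measurable_cong_sets[OF sets_F refl])
      have mt: "transpose \<in> measurable borel (borel :: (real^'p^'q) measure)"
        by (intro borel_measurable_continuous_onI linear_continuous_on bounded_linear_transpose)
      have "distr (distr F borel transpose) borel (\<lambda>Z. O1 ** Z ** transpose O2) =
        distr F borel ((\<lambda>Z. O1 ** Z ** transpose O2) \<circ> transpose)"
        by (rule distr_distr[OF m1]) measurable
      also have "(\<lambda>Z. O1 ** Z ** transpose O2) \<circ> transpose = transpose \<circ> (\<lambda>Z. O2 ** Z ** transpose O1)"
        by (simp add: fun_eq_iff matrix_transpose_mul matrix_mul_assoc)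
      also have "distr F borel \<dots> = distr (distr F borel (\<lambda>Z. O2 ** Z ** transpose O1)) borel transpose"
        by (rule distr_distr[OF mt m2, symmetric])
      also have "distr F borel (\<lambda>Z. O2 ** Z ** transpose O1) = F"
        using spherical O unfolding matrix_spherical_def by blast
      finally show "distr (distr F borel transpose) borel (\<lambda>Z. O1 ** Z ** transpose O2) =
        distr F borel (transpose :: real^'q^'p \<Rightarrow> real^'p^'q)" .
    qed
    have "(\<lambda>Z :: real^'p^'q. norm Z ^ 4) \<in> borel_measurable borel" by measurable
    then show "integrable (distr F borel transpose) (\<lambda>Z :: real^'p^'q. norm Z ^ 4)"
      using moment4 by (subst integrable_distr_eq) (auto simp: \<open>transpose \<in> measurable F borel\<close>)
  qed
qed

lemma integral_transpose:
  assumes "f \<in> borel_measurable borel"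
  shows "(\<integral>Z. f Z \<partial>distr F borel (transpose :: real^'q^'p \<Rightarrow> real^'p^'q)) = (\<integral>Z. f (transpose Z) \<partial>F :: real)"
proof (rule integral_distr[OF _ assms])
  show "transpose \<in> measurable F (borel :: (real^'p^'q) measure)"
    unfolding measurable_cong_sets[OF sets_F refl]
    by (intro borel_measurable_continuous_onI linear_continuous_on bounded_linear_transpose)
qed

lemma isotropic4_cols:
  "isotropic4 (\<lambda>a b c d. \<integral>Z. Z $ i $ a * Z $ j $ b * Z $ k $ c * Z $ l $ d \<partial>F)"
proof -
  interpret T: spherical_moments "distr F borel (transpose :: real^'q^'p \<Rightarrow> real^'p^'q)"
    by (rule spherical_moments_transpose)
  have "(\<integral>Z. Z $ a $ i * Z $ b $ j * Z $ c $ k * Z $ d $ l \<partial>distr F borel (transpose :: real^'q^'p \<Rightarrow> real^'p^'q)) =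
     (\<integral>Z. Z $ i $ a * Z $ j $ b * Z $ k $ c * Z $ l $ d \<partial>F)" for a b c d
    by (subst integral_transpose) (intro borel_measurable_times T.measurable_entry, simp add: transpose_def)
  then show ?thesis using T.isotropic4_rows[of i j k l] by simp
qed

lemma moment2_eq:
  "(\<integral>Z. Z $ j1 $ k1 * Z $ j2 $ k2 \<partial>F) = (if j1 = j2 \<and> k1 = k2 then \<integral>Z. (Z $ j $ k)\<^sup>2 \<partial>F else 0)"
proof -
  interpret T: spherical_moments "distr F borel (transpose :: real^'q^'p \<Rightarrow> real^'p^'q)"
    by (rule spherical_moments_transpose)
  have t: "(\<integral>Z. Z $ k1 $ j1 * Z $ k2 $ j2 \<partial>distr F borel (transpose :: real^'q^'p \<Rightarrow> real^'p^'q)) =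
     (\<integral>Z. Z $ j1 $ k1 * Z $ j2 $ k2 \<partial>F)" for j1 j2 k1 k2
    by (subst integral_transpose) (intro borel_measurable_times T.measurable_entry, simp add: transpose_def)
  consider "j1 \<noteq> j2" | "k1 \<noteq> k2" | "j1 = j2" "k1 = k2" by blast
  then show ?thesis
  proof cases
    case 1 then show ?thesis using moment2[OF 1] by simp
  next
    case 2 then show ?thesis using T.moment2[OF 2, of j1 j2] by (simp add: t)
  next
    case 3
    then show ?thesis
      using moment2_rows[of j1 k1 k1 j] T.moment2_rows[of k1 j j k] by (simp add: t power2_eq_square)
  qed
qed

text \<open>Of the three row pairings one contributes \<open>\<alpha>\<close> and two contribute
  \<open>\<beta>\<close>. Consequently the numerators in the limit law are
  \<open>2 \<alpha> + 2 \<beta>\<close> and \<open>2 \<alpha> - 2 \<beta>\<close>, the variances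
  that the quadratic forms below turn out to have.\<close>

lemma moment4_values:
  assumes j: "j1 \<noteq> j2" and k: "k1 \<noteq> k2"
  defines "\<alpha> \<equiv> \<integral>Z. (Z $ j1 $ k1)\<^sup>2 * (Z $ j2 $ k2)\<^sup>2 \<partial>F"
    and "\<beta> \<equiv> \<integral>Z. Z $ j1 $ k1 * Z $ j1 $ k2 * Z $ j2 $ k1 * Z $ j2 $ k2 \<partial>F"
  shows "(\<integral>Z. (Z $ j1 $ k1)\<^sup>2 * (Z $ j1 $ k2)\<^sup>2 \<partial>F) = \<alpha> + 2 * \<beta>"
proof -
  have "(\<integral>Z. (Z $ j1 $ k1)\<^sup>2 * (Z $ j1 $ k2)\<^sup>2 \<partial>F) = (\<integral>Z. Z $ j1 $ k1 * Z $ j1 $ k1 * Z $ j1 $ k2 * Z $ j1 $ k2 \<partial>F)"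
    by (simp add: power2_eq_square mult_ac)
  also have "\<dots> = (\<integral>Z. Z $ j1 $ k1 * Z $ j1 $ k1 * Z $ j2 $ k2 * Z $ j2 $ k2 \<partial>F)
    + (\<integral>Z. Z $ j1 $ k1 * Z $ j2 $ k1 * Z $ j1 $ k2 * Z $ j2 $ k2 \<partial>F)
    + (\<integral>Z. Z $ j1 $ k1 * Z $ j2 $ k1 * Z $ j2 $ k2 * Z $ j1 $ k2 \<partial>F)"
    by (subst moment4_rows[OF j]) simp
  finally show ?thesis by (simp add: \<alpha>_def \<beta>_def power2_eq_square mult_ac)
qed

text \<open>The quadratic form of \<open>kronecker s t\<close> at \<open>vec_cols Z\<close>. Its
  sample mean is the coordinate of the uncentred covariance along
  \<open>kronecker s t\<close>.\<close>

definition quad :: "real^'q^'q \<Rightarrow> real^'p^'p \<Rightarrow> real^'q^'p \<Rightarrow> real" where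
  "quad s t Z = kronecker s t \<bullet> outer (vec_cols Z)"

lemma quad_eq: "quad s t Z = (\<Sum>k1\<in>UNIV. \<Sum>k2\<in>UNIV. \<Sum>j1\<in>UNIV. \<Sum>j2\<in>UNIV. s $ k1 $ k2 * t $ j1 $ j2 * (Z $ j1 $ k1 * Z $ j2 $ k2))"
proof -
  have "quad s t Z = (\<Sum>k1\<in>UNIV. \<Sum>j1\<in>UNIV. \<Sum>k2\<in>UNIV. \<Sum>j2\<in>UNIV. s $ k1 $ k2 * t $ j1 $ j2 * (Z $ j1 $ k1 * Z $ j2 $ k2))"
    by (simp add: quad_def inner_vec_def kronecker_def outer_def vec_cols_def sum_UNIV_prod)
  then show ?thesis by (simp add: sum.swap[where A = "UNIV :: 'p set" and B = "UNIV :: 'q set"])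
qed

text \<open>Contraction over the columns first and the rows second; the traceless factors annihilate the
  pairing \<open>(12)(34)\<close> in both steps.\<close>

lemma integral_quad_quad:
  assumes j: "j1 \<noteq> j2" and k: "k1 \<noteq> k2" and s: "trace s = 0" and t: "trace t = 0"
  defines "\<alpha> \<equiv> \<integral>Z. (Z $ j1 $ k1)\<^sup>2 * (Z $ j2 $ k2)\<^sup>2 \<partial>F"
    and "\<beta> \<equiv> \<integral>Z. Z $ j1 $ k1 * Z $ j1 $ k2 * Z $ j2 $ k1 * Z $ j2 $ k2 \<partial>F"
  shows "(\<integral>Z. quad s t Z * quad s' t' Z \<partial>F) =
    (s \<bullet> s') * ((t \<bullet> t') * \<alpha> + (t \<bullet> transpose t') * \<beta>) +
    (s \<bullet> transpose s') * ((t \<bullet> t') * \<beta> + (t \<bullet> transpose t') * \<alpha>)"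
proof -
  let ?m = "\<lambda>a1 a2 a3 a4 b1 b2 b3 b4. \<integral>Z. Z $ a1 $ b1 * Z $ a2 $ b2 * Z $ a3 $ b3 * Z $ a4 $ b4 \<partial>F"
  let ?S = "\<lambda>f. \<Sum>a\<in>UNIV. \<Sum>b\<in>UNIV. \<Sum>c\<in>UNIV. \<Sum>d\<in>UNIV. f a b c d :: real"
  have "quad s t Z * quad s' t' Z = ?S (\<lambda>b1 b2 b3 b4. ?S (\<lambda>a1 a2 a3 a4.
      (s $ b1 $ b2 * s' $ b3 $ b4 * (t $ a1 $ a2 * t' $ a3 $ a4)) * (Z $ a1 $ b1 * Z $ a2 $ b2 * Z $ a3 $ b3 * Z $ a4 $ b4)))" for Z
  proof -
    have "quad s t Z * quad s' t' Z = (\<Sum>b1\<in>UNIV. \<Sum>b2\<in>UNIV. \<Sum>b3\<in>UNIV. \<Sum>b4\<in>UNIV.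
      (\<Sum>a1\<in>UNIV. \<Sum>a2\<in>UNIV. s $ b1 $ b2 * t $ a1 $ a2 * (Z $ a1 $ b1 * Z $ a2 $ b2)) *
      (\<Sum>a3\<in>UNIV. \<Sum>a4\<in>UNIV. s' $ b3 $ b4 * t' $ a3 $ a4 * (Z $ a3 $ b3 * Z $ a4 $ b4)))"
      unfolding quad_eq by (rule sum2_product)
    also have "\<dots> = ?S (\<lambda>b1 b2 b3 b4. ?S (\<lambda>a1 a2 a3 a4.
      (s $ b1 $ b2 * t $ a1 $ a2 * (Z $ a1 $ b1 * Z $ a2 $ b2)) * (s' $ b3 $ b4 * t' $ a3 $ a4 * (Z $ a3 $ b3 * Z $ a4 $ b4))))"
      by (simp only: sum2_product)
    finally show ?thesis by (simp only: mult_ac)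
  qed
  then have "(\<integral>Z. quad s t Z * quad s' t' Z \<partial>F) = ?S (\<lambda>b1 b2 b3 b4. ?S (\<lambda>a1 a2 a3 a4.
      (s $ b1 $ b2 * s' $ b3 $ b4 * (t $ a1 $ a2 * t' $ a3 $ a4)) * ?m a1 a2 a3 a4 b1 b2 b3 b4))"
    by (simp only: Bochner_Integration.integral_sum Bochner_Integration.integrable_sum integrable_4
          integrable_mult_right integral_mult_right_zero)
  also have "\<dots> = ?S (\<lambda>b1 b2 b3 b4. s $ b1 $ b2 * s' $ b3 $ b4 *
      ?S (\<lambda>a1 a2 a3 a4. t $ a1 $ a2 * t' $ a3 $ a4 * ?m a1 a2 a3 a4 b1 b2 b3 b4))"
    by (simp only: sum_distrib_left mult.assoc)
  also have "\<dots> = ?S (\<lambda>b1 b2 b3 b4. s $ b1 $ b2 * s' $ b3 $ b4 *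
      ((t \<bullet> t') * ?m j1 j2 j1 j2 b1 b2 b3 b4 + (t \<bullet> transpose t') * ?m j1 j2 j2 j1 b1 b2 b3 b4))"
    by (simp only: isotropic4_contract[OF isotropic4_rows j t])
  also have "\<dots> = (t \<bullet> t') * ?S (\<lambda>b1 b2 b3 b4. s $ b1 $ b2 * s' $ b3 $ b4 * ?m j1 j2 j1 j2 b1 b2 b3 b4)
     + (t \<bullet> transpose t') * ?S (\<lambda>b1 b2 b3 b4. s $ b1 $ b2 * s' $ b3 $ b4 * ?m j1 j2 j2 j1 b1 b2 b3 b4)"
    by (simp only: sum_distrib_left sum.distrib[symmetric] distrib_left mult_ac)
  also have "\<dots> = (t \<bullet> t') * ((s \<bullet> s') * ?m j1 j2 j1 j2 k1 k2 k1 k2 + (s \<bullet> transpose s') * ?m j1 j2 j1 j2 k1 k2 k2 k1)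
     + (t \<bullet> transpose t') * ((s \<bullet> s') * ?m j1 j2 j2 j1 k1 k2 k1 k2 + (s \<bullet> transpose s') * ?m j1 j2 j2 j1 k1 k2 k2 k1)"
    by (simp only: isotropic4_contract[OF isotropic4_cols k s])
  also have "?m j1 j2 j1 j2 k1 k2 k1 k2 = \<alpha>" by (simp add: \<alpha>_def power2_eq_square mult_ac)
  also have "?m j1 j2 j2 j1 k1 k2 k2 k1 = \<alpha>" by (simp add: \<alpha>_def power2_eq_square mult_ac)
  also have "?m j1 j2 j1 j2 k1 k2 k2 k1 = \<beta>" by (simp add: \<beta>_def mult_ac)
  also have "?m j1 j2 j2 j1 k1 k2 k1 k2 = \<beta>" by (simp add: \<beta>_def mult_ac)
  finally show ?thesis by (simp add: algebra_simps)
qed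

end

section \<open>Weak limits via Laplace transforms\<close>

text \<open>The step function is constant beyond \<open>b\<close>, so truncating \<open>u\<close> at
  \<open>b + 1\<close> changes nothing and keeps the logarithm away from 0. As a function of
  \<open>exp (- u)\<close> it then extends continuously to all of the unit interval.\<close>

lemma cts_step_exp:
  assumes "a < b" "0 \<le> u"
  shows "cts_step a b u = cts_step a b (- ln (max (exp (- u)) (exp (- (b + 1)))))"
proof -
  have "max (exp (- u)) (exp (- (b + 1))) = exp (- min u (b + 1))"
    by (auto simp: max_def min_def)
  then show ?thesis using assms by (auto simp: cts_step_def min_def)
qed

text \<open>After the substitution \<open>y = exp (- x)\<close> the Laplace transforms at the natural numbers are the
  moments of a distribution on \<open>[0, 1]\<close>, and Weierstrass approximation applies.\<close>

theorem laplace_imp_weak_conv: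
  fixes \<mu> :: "nat \<Rightarrow> real measure"
  assumes \<mu>: "\<And>n. real_distribution (\<mu> n)" and \<nu>: "real_distribution \<nu>"
    and nn: "\<And>n. AE x in \<mu> n. 0 \<le> x" "AE x in \<nu>. 0 \<le> x"
    and conv: "\<And>t. 0 \<le> t \<Longrightarrow> (\<lambda>n. \<integral>x. exp (- (t * x)) \<partial>\<mu> n) \<longlonglongrightarrow> (\<integral>x. exp (- (t * x)) \<partial>\<nu>)"
  shows "weak_conv_m \<mu> \<nu>"
proof (rule integral_cts_step_conv_imp_weak_conv[OF \<mu> \<nu>])
  fix a b :: real assume ab: "a < b"
  define h where "h y = cts_step a b (- ln (max y (exp (- (b + 1)))))" for y
  have cont: "continuous_on UNIV (cts_step a b)"
    using cts_step_uniformly_continuous[OF ab] by (rule uniformly_continuous_imp_continuous)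
  have "max y (exp (- (b + 1))) \<noteq> 0" for y
    using less_max_iff_disj[of 0 y "exp (- (b + 1))"] by (metis exp_gt_zero less_irrefl)
  then have "continuous_on {0..1} (\<lambda>y. - ln (max y (exp (- (b + 1)))))"
    by (intro continuous_on_minus continuous_on_ln continuous_on_max continuous_on_id continuous_on_const) blast
  then have "continuous_on {0..1} h"
    unfolding h_def by (rule continuous_on_compose2[OF cont]) simp
  have approx: "\<exists>p. (\<lambda>n. \<integral>x. p x \<partial>\<mu> n) \<longlonglongrightarrow> (\<integral>x. p x \<partial>\<nu>) \<and>
     (\<forall>\<rho>. real_distribution \<rho> \<longrightarrow> (AE x in \<rho>. 0 \<le> x) \<longrightarrow> \<bar>(\<integral>x. cts_step a b x \<partial>\<rho>) - (\<integral>x. p x \<partial>\<rho>)\<bar> \<le> e)"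
    if e: "e > 0" for e
  proof -
    obtain g where g: "real_polynomial_function g" "\<And>y. y \<in> {0..1} \<Longrightarrow> \<bar>h y - g y\<bar> < e"
      using Stone_Weierstrass_real_polynomial_function[OF compact_Icc \<open>continuous_on {0..1} h\<close> e] by blast
    obtain c m where gs: "g = (\<lambda>y. \<Sum>i\<le>m. c i * y ^ i)"
      using g(1) unfolding real_polynomial_function_iff_sum by (elim exE)
    \<comment> \<open>The approximating polynomial at \<open>exp (- x)\<close>. Its integral is a
      combination of Laplace transforms at natural numbers, and the error is uniform over all
      distributions on the nonnegative reals.\<close>
    define p where "p x = (\<Sum>i\<le>m. c i * exp (- (real i * x)))" for x :: real
    have int_exp: "integrable \<rho> (\<lambda>x. exp (- (real i * x)))"
      if "real_distribution \<rho>" "AE x in \<rho>. 0 \<le> x" for \<rho> i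
    proof -
      interpret real_distribution \<rho> by fact
      show ?thesis using that(2) by (intro integrable_const_bound[of _ 1]) auto
    qed
    have int_p: "(\<integral>x. p x \<partial>\<rho>) = (\<Sum>i\<le>m. c i * (\<integral>x. exp (- (real i * x)) \<partial>\<rho>))" "integrable \<rho> p"
      if "real_distribution \<rho>" "AE x in \<rho>. 0 \<le> x" for \<rho>
      unfolding p_def using int_exp[OF that] by auto
    have "(\<lambda>n. \<integral>x. p x \<partial>\<mu> n) \<longlonglongrightarrow> (\<integral>x. p x \<partial>\<nu>)"
      unfolding int_p(1)[OF \<mu> nn(1)] int_p(1)[OF \<nu> nn(2)]
      by (intro tendsto_sum tendsto_mult tendsto_const conv) auto
    moreover have "\<bar>(\<integral>x. cts_step a b x \<partial>\<rho>) - (\<integral>x. p x \<partial>\<rho>)\<bar> \<le> e"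
      if \<rho>: "real_distribution \<rho>" and pos: "AE x in \<rho>. 0 \<le> x" for \<rho>
    proof -
      interpret real_distribution \<rho> by fact
      have close: "\<bar>cts_step a b x - p x\<bar> \<le> e" if "0 \<le> x" for x
      proof -
        have "p x = g (exp (- x))"
          by (simp add: p_def gs exp_of_nat_mult[symmetric])
        moreover have "cts_step a b x = h (exp (- x))" unfolding h_def by (rule cts_step_exp[OF ab that])
        ultimately show ?thesis using g(2)[of "exp (- x)"] that by simp
      qed
      have "(\<integral>x. cts_step a b x \<partial>\<rho>) - (\<integral>x. p x \<partial>\<rho>) = (\<integral>x. cts_step a b x - p x \<partial>\<rho>)"
        using integrable_cts_step[OF ab] int_p(2)[OF \<rho> pos] by simp
      also have "\<bar>\<dots>\<bar> \<le> (\<integral>x. \<bar>cts_step a b x - p x\<bar> \<partial>\<rho>)" by (rule integral_abs_bound)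
      also have "\<dots> \<le> (\<integral>x. e \<partial>\<rho>)"
        using integrable_cts_step[OF ab] int_p(2)[OF \<rho> pos] pos close
        by (intro integral_mono_AE) auto
      finally show ?thesis using prob_space by simp
    qed
    ultimately show ?thesis by blast
  qed
  show "(\<lambda>n. integral\<^sup>L (\<mu> n) (cts_step a b)) \<longlonglongrightarrow> integral\<^sup>L \<nu> (cts_step a b)"
  proof (rule LIMSEQ_I)
    fix r :: real assume "0 < r"
    then obtain p where p: "(\<lambda>n. \<integral>x. p x \<partial>\<mu> n) \<longlonglongrightarrow> (\<integral>x. p x \<partial>\<nu>)"
      and close: "\<And>\<rho>. real_distribution \<rho> \<Longrightarrow> (AE x in \<rho>. 0 \<le> x) \<Longrightarrow> \<bar>(\<integral>x. cts_step a b x \<partial>\<rho>) - (\<integral>x. p x \<partial>\<rho>)\<bar> \<le> r / 3"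
      using approx[of "r / 3"] by auto
    obtain N where N: "\<And>n. n \<ge> N \<Longrightarrow> norm ((\<integral>x. p x \<partial>\<mu> n) - (\<integral>x. p x \<partial>\<nu>)) < r / 3"
      using LIMSEQ_D[OF p, of "r / 3"] \<open>0 < r\<close> by auto
    show "\<exists>N. \<forall>n\<ge>N. norm (integral\<^sup>L (\<mu> n) (cts_step a b) - integral\<^sup>L \<nu> (cts_step a b)) < r"
    proof (intro exI allI impI)
      fix n assume "n \<ge> N"
      then show "norm (integral\<^sup>L (\<mu> n) (cts_step a b) - integral\<^sup>L \<nu> (cts_step a b)) < r"
        using N[of n] close[OF \<mu> nn(1), of n] close[OF \<nu> nn(2)] unfolding real_norm_def by linarith
    qed
  qed
qed

section \<open>Gaussian randomization, scalar central limit theorem and comparison of Laplace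
  transforms\<close>

abbreviation gaussian :: "real measure" where "gaussian \<equiv> density lborel std_normal_density"

lemma prob_space_gaussian: "prob_space gaussian" by (rule prob_space_normal_density) simp

interpretation gauss: prob_space gaussian by (rule prob_space_gaussian)
interpretation gauss_prod: product_sigma_finite "\<lambda>_. gaussian"
  by (simp add: product_sigma_finite_def gauss.sigma_finite_measure_axioms)

lemma sets_gaussian [measurable_cong]: "sets gaussian = sets borel" by simp

lemma integral_iexp_gaussian: "(\<integral>x. iexp (s * x) \<partial>gaussian) = complex_of_real (exp (- (s\<^sup>2) / 2))"
  using char_std_normal_distribution unfolding char_def by metis

context prob_space
begin

text \<open>Since the standard Gaussian has characteristic function \<open>exp (- s^2 / 2)\<close>,
  the exponential of a negative sum of squares is a Gaussian average of bounded complex exponentials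
  of linear forms; Fubini exchanges the two averages.\<close>

lemma gaussian_mixing:
  fixes W :: "'j \<Rightarrow> 'a \<Rightarrow> real"
  assumes J: "finite J" and W [measurable]: "\<And>j. W j \<in> borel_measurable M"
  shows "complex_of_real (\<integral>\<omega>. exp (- (t\<^sup>2 / 2 * (\<Sum>j\<in>J. (W j \<omega>)\<^sup>2))) \<partial>M) =
    (\<integral>g. (\<integral>\<omega>. iexp (\<Sum>j\<in>J. t * g j * W j \<omega>) \<partial>M) \<partial>PiM J (\<lambda>_. gaussian))"
proof -
  interpret G: prob_space "PiM J (\<lambda>_. gaussian)" by (rule prob_space_PiM) (rule prob_space_gaussian)
  interpret PG: pair_prob_space "PiM J (\<lambda>_. gaussian)" M ..
  have inner: "(\<integral>g. iexp (\<Sum>j\<in>J. t * g j * w j) \<partial>PiM J (\<lambda>_. gaussian)) = complex_of_real (exp (- (t\<^sup>2 / 2 * (\<Sum>j\<in>J. (w j)\<^sup>2))))" for w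
  proof -
    have "(\<integral>g. iexp (\<Sum>j\<in>J. t * g j * w j) \<partial>PiM J (\<lambda>_. gaussian)) =
       (\<integral>g. (\<Prod>j\<in>J. iexp ((t * w j) * g j)) \<partial>PiM J (\<lambda>_. gaussian))"
      using J by (simp add: exp_sum[symmetric] sum_distrib_left mult_ac)
    also have "\<dots> = (\<Prod>j\<in>J. \<integral>x. iexp ((t * w j) * x) \<partial>gaussian)"
      by (rule gauss_prod.product_integral_prod[OF J]) (auto intro!: gauss.integrable_const_bound[of _ 1])
    also have "\<dots> = (\<Prod>j\<in>J. complex_of_real (exp (- ((t * w j)\<^sup>2) / 2)))"
      by (simp only: integral_iexp_gaussian)
    also have "\<dots> = complex_of_real (exp (\<Sum>j\<in>J. - ((t * w j)\<^sup>2) / 2))"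
      using J by (simp add: exp_sum)
    also have "(\<Sum>j\<in>J. - ((t * w j)\<^sup>2) / 2) = - (t\<^sup>2 / 2 * (\<Sum>j\<in>J. (w j)\<^sup>2))"
      by (simp add: sum_distrib_left sum_negf[symmetric] power_mult_distrib)
    finally show ?thesis .
  qed
  have m: "(\<lambda>(g, \<omega>). iexp (\<Sum>j\<in>J. t * g j * W j \<omega>)) \<in> borel_measurable (PiM J (\<lambda>_. gaussian) \<Otimes>\<^sub>M M)"
    by measurable
  have "integrable (PiM J (\<lambda>_. gaussian) \<Otimes>\<^sub>M M) (\<lambda>(g, \<omega>). iexp (\<Sum>j\<in>J. t * g j * W j \<omega>))"
    by (rule PG.P.integrable_const_bound[of _ 1, OF _ m]) auto
  then have "(\<integral>\<omega>. (\<integral>g. iexp (\<Sum>j\<in>J. t * g j * W j \<omega>) \<partial>PiM J (\<lambda>_. gaussian)) \<partial>M) =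
    (\<integral>g. (\<integral>\<omega>. iexp (\<Sum>j\<in>J. t * g j * W j \<omega>) \<partial>M) \<partial>PiM J (\<lambda>_. gaussian))"
    by (rule PG.Fubini_integral)
  then show ?thesis unfolding inner by simp
qed

text \<open>A random quadratic form is tested against exponentials by Gaussian randomization, which reduces
  its limit to the limits of the linear statistics.\<close>

lemma laplace_quadratic_limit:
  fixes W :: "nat \<Rightarrow> 'j \<Rightarrow> 'a \<Rightarrow> real" and c :: "'j \<Rightarrow> real"
  assumes J: "finite J" and W [measurable]: "\<And>n j. W n j \<in> borel_measurable M"
    and lim: "\<And>g. (\<lambda>n. \<integral>\<omega>. iexp (\<Sum>j\<in>J. g j * W n j \<omega>) \<partial>M) \<longlonglongrightarrow>
       complex_of_real (exp (- (\<Sum>j\<in>J. c j * (g j)\<^sup>2) / 2))"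
    and t: "0 \<le> t"
  shows "(\<lambda>n. \<integral>\<omega>. exp (- (t * (\<Sum>j\<in>J. (W n j \<omega>)\<^sup>2))) \<partial>M) \<longlonglongrightarrow>
    (\<integral>g. exp (- (t * (\<Sum>j\<in>J. c j * (g j)\<^sup>2))) \<partial>PiM J (\<lambda>_. gaussian))"
proof -
  interpret G: prob_space "PiM J (\<lambda>_. gaussian)" by (rule prob_space_PiM) (rule prob_space_gaussian)
  \<comment> \<open>Chosen so that \<open>r^2 / 2 = t\<close>, the form in which
    \<open>gaussian_mixing\<close> is stated.\<close>
  define r where "r = sqrt (2 * t)"
  have r: "t = r\<^sup>2 / 2" using t by (simp add: r_def)
  have mix: "complex_of_real (\<integral>\<omega>. exp (- (t * (\<Sum>j\<in>J. (W n j \<omega>)\<^sup>2))) \<partial>M) =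
    (\<integral>g. (\<integral>\<omega>. iexp (\<Sum>j\<in>J. r * g j * W n j \<omega>) \<partial>M) \<partial>PiM J (\<lambda>_. gaussian))" for n
    unfolding r by (rule gaussian_mixing[OF J W])
  have "(\<lambda>n. \<integral>g. (\<integral>\<omega>. iexp (\<Sum>j\<in>J. r * g j * W n j \<omega>) \<partial>M) \<partial>PiM J (\<lambda>_. gaussian)) \<longlonglongrightarrow>
    (\<integral>g. complex_of_real (exp (- (t * (\<Sum>j\<in>J. c j * (g j)\<^sup>2)))) \<partial>PiM J (\<lambda>_. gaussian))"
  proof (rule integral_dominated_convergence[where w = "\<lambda>_. 1"])
    show "(\<lambda>g. complex_of_real (exp (- (t * (\<Sum>j\<in>J. c j * (g j)\<^sup>2))))) \<in> borel_measurable (PiM J (\<lambda>_. gaussian))"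
      by measurable
    show "(\<lambda>g. \<integral>\<omega>. iexp (\<Sum>j\<in>J. r * g j * W n j \<omega>) \<partial>M) \<in> borel_measurable (PiM J (\<lambda>_. gaussian))" for n
      by measurable
    show "AE g in PiM J (\<lambda>_. gaussian). (\<lambda>n. \<integral>\<omega>. iexp (\<Sum>j\<in>J. r * g j * W n j \<omega>) \<partial>M) \<longlonglongrightarrow>
      complex_of_real (exp (- (t * (\<Sum>j\<in>J. c j * (g j)\<^sup>2))))"
    proof (rule AE_I2)
      fix g
      have eq: "- (t * (\<Sum>j\<in>J. c j * (g j)\<^sup>2)) = - (\<Sum>j\<in>J. c j * (r * g j)\<^sup>2) / 2"
        by (simp add: r power_mult_distrib sum_distrib_left sum_divide_distrib mult_ac)
      show "(\<lambda>n. \<integral>\<omega>. iexp (\<Sum>j\<in>J. r * g j * W n j \<omega>) \<partial>M) \<longlonglongrightarrow>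
        complex_of_real (exp (- (t * (\<Sum>j\<in>J. c j * (g j)\<^sup>2))))"
        unfolding eq by (rule lim)
    qed
    show "AE g in PiM J (\<lambda>_. gaussian). norm (\<integral>\<omega>. iexp (\<Sum>j\<in>J. r * g j * W n j \<omega>) \<partial>M) \<le> 1" for n
    proof (rule AE_I2)
      fix g
      have "norm (\<integral>\<omega>. iexp (\<Sum>j\<in>J. r * g j * W n j \<omega>) \<partial>M) \<le> (\<integral>\<omega>. norm (iexp (\<Sum>j\<in>J. r * g j * W n j \<omega>)) \<partial>M)"
        by (rule integral_norm_bound)
      then show "norm (\<integral>\<omega>. iexp (\<Sum>j\<in>J. r * g j * W n j \<omega>) \<partial>M) \<le> 1" by (simp add: prob_space)
    qed
  qed simp
  then have "(\<lambda>n. complex_of_real (\<integral>\<omega>. exp (- (t * (\<Sum>j\<in>J. (W n j \<omega>)\<^sup>2))) \<partial>M)) \<longlonglongrightarrow>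
    complex_of_real (\<integral>g. exp (- (t * (\<Sum>j\<in>J. c j * (g j)\<^sup>2))) \<partial>PiM J (\<lambda>_. gaussian))"
    unfolding mix[symmetric] integral_complex_of_real .
  then show ?thesis by (simp only: tendsto_of_real_iff)
qed

text \<open>The argument of the characteristic function is absorbed into \<open>Y\<close>. Zero
  variance is treated apart because the central limit theorem divides by the standard deviation; it
  does occur, for instance for the zero linear form.\<close>

lemma clt_char:
  fixes Y :: "nat \<Rightarrow> 'a \<Rightarrow> real"
  assumes indep: "indep_vars (\<lambda>_. borel) Y UNIV" and distr: "\<And>n. distr M borel (Y n) = \<mu>"
    and mean: "\<And>n. expectation (Y n) = 0" and sq: "\<And>n. integrable M (\<lambda>\<omega>. (Y n \<omega>)\<^sup>2)"
    and var: "\<And>n. expectation (\<lambda>\<omega>. (Y n \<omega>)\<^sup>2) = v"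
  shows "(\<lambda>n. \<integral>\<omega>. iexp ((\<Sum>i<n. Y i \<omega>) / sqrt (real n)) \<partial>M) \<longlonglongrightarrow> complex_of_real (exp (- v / 2))"
proof (cases "v = 0")
  case True
  have rv [measurable]: "Y i \<in> borel_measurable M" for i using indep unfolding indep_vars_def2 by simp
  have "AE \<omega> in M. (Y i \<omega>)\<^sup>2 = 0" for i
    using integral_nonneg_eq_0_iff_AE[OF sq, of i] var[of i] True by simp
  then have "AE \<omega> in M. \<forall>i. Y i \<omega> = 0" by (simp add: AE_all_countable)
  then have "AE \<omega> in M. iexp ((\<Sum>i<n. Y i \<omega>) / sqrt (real n)) = 1" for n by eventually_elim simp
  then have "(\<integral>\<omega>. iexp ((\<Sum>i<n. Y i \<omega>) / sqrt (real n)) \<partial>M) = (\<integral>\<omega>. 1 \<partial>M)" for n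
    by (intro integral_cong_AE) auto
  then show ?thesis using True by (simp add: prob_space)
next
  case False
  have rv [measurable]: "Y i \<in> borel_measurable M" for i using indep unfolding indep_vars_def2 by simp
  have "0 \<le> v" using var[of 0] by (metis integral_nonneg_AE AE_I2 zero_le_power2)
  then have v: "0 < v" using False by simp
  have "weak_conv_m (\<lambda>n. distr M borel (\<lambda>x. (\<Sum>i<n. Y i x) / sqrt (n * (sqrt v)\<^sup>2))) std_normal_distribution"
    using v mean sq var by (intro central_limit_theorem_zero_mean[OF indep _ _ _ _ distr]) auto
  then have "(\<lambda>n. char (distr M borel (\<lambda>x. (\<Sum>i<n. Y i x) / sqrt (n * (sqrt v)\<^sup>2))) (sqrt v)) \<longlonglongrightarrow> char std_normal_distribution (sqrt v)"
    by (intro levy_continuity1 real_distribution_distr real_dist_normal_dist) auto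
  moreover have "char (distr M borel (\<lambda>x. (\<Sum>i<n. Y i x) / sqrt (n * (sqrt v)\<^sup>2))) (sqrt v) = (\<integral>\<omega>. iexp ((\<Sum>i<n. Y i \<omega>) / sqrt (real n)) \<partial>M)" for n
  proof -
    have "sqrt v * (x / sqrt (n * (sqrt v)\<^sup>2)) = x / sqrt (real n)" for x
      using v by (simp add: real_sqrt_mult)
    then show ?thesis unfolding char_def by (subst integral_distr) auto
  qed
  ultimately show ?thesis using v by (simp add: char_std_normal_distribution)
qed

lemma expectation_sum_square:
  fixes Y :: "nat \<Rightarrow> 'a \<Rightarrow> real"
  assumes indep: "indep_vars (\<lambda>_. borel) Y UNIV"
    and mean: "\<And>n. expectation (Y n) = 0" and sq: "\<And>n. integrable M (\<lambda>\<omega>. (Y n \<omega>)\<^sup>2)"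
    and var: "\<And>n. expectation (\<lambda>\<omega>. (Y n \<omega>)\<^sup>2) = v"
  shows "integrable M (\<lambda>\<omega>. (\<Sum>i<n. Y i \<omega>)\<^sup>2) \<and> expectation (\<lambda>\<omega>. (\<Sum>i<n. Y i \<omega>)\<^sup>2) = real n * v"
proof (induction n)
  case (Suc n)
  have rv [measurable]: "Y i \<in> borel_measurable M" for i using indep unfolding indep_vars_def2 by simp
  have int: "integrable M (Y i)" for i by (rule square_integrable_imp_integrable[OF rv sq])
  have "indep_vars (\<lambda>_. borel) Y (insert n {..<n})" by (rule indep_vars_subset[OF indep]) auto
  then have iv: "indep_var borel (Y n) borel (\<lambda>\<omega>. \<Sum>i<n. Y i \<omega>)" by (intro indep_vars_sum) auto
  have ints: "integrable M (\<lambda>\<omega>. \<Sum>i<n. Y i \<omega>)" using int by simp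
  have c: "integrable M (\<lambda>\<omega>. Y n \<omega> * (\<Sum>i<n. Y i \<omega>))" "expectation (\<lambda>\<omega>. Y n \<omega> * (\<Sum>i<n. Y i \<omega>)) = 0"
    using indep_var_integrable[OF iv int ints] indep_var_lebesgue_integral[OF iv int ints] by (auto simp: mean)
  have e: "(\<Sum>i<Suc n. Y i \<omega>)\<^sup>2 = (\<Sum>i<n. Y i \<omega>)\<^sup>2 + 2 * (Y n \<omega> * (\<Sum>i<n. Y i \<omega>)) + (Y n \<omega>)\<^sup>2" for \<omega>
    by (simp add: power2_eq_square algebra_simps)
  show ?case unfolding e using Suc c sq[of n] var[of n] by (simp add: algebra_simps)
qed (simp add: prob_space)

text \<open>Markov's inequality for the squared sum: the threshold is \<open>n powr (6 / 5)\<close>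
  and the second moment is \<open>n * v\<close>, which leaves
  \<open>v * n powr (- 1 / 5)\<close>.\<close>

lemma prob_mean_large:
  fixes Y :: "nat \<Rightarrow> 'a \<Rightarrow> real"
  assumes indep: "indep_vars (\<lambda>_. borel) Y UNIV"
    and mean: "\<And>n. expectation (Y n) = 0" and sq: "\<And>n. integrable M (\<lambda>\<omega>. (Y n \<omega>)\<^sup>2)"
    and var: "\<And>n. expectation (\<lambda>\<omega>. (Y n \<omega>)\<^sup>2) = v"
  shows "(\<lambda>n. prob {\<omega> \<in> space M. real n powr (- 2 / 5) \<le> \<bar>(\<Sum>i<n. Y i \<omega>) / real n\<bar>}) \<longlonglongrightarrow> 0"
proof (rule tendsto_sandwich[of "\<lambda>_. 0" _ _ "\<lambda>n. v * real n powr (- 1 / 5)"])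
  have rv [measurable]: "Y i \<in> borel_measurable M" for i using indep unfolding indep_vars_def2 by simp
  show "\<forall>\<^sub>F n in sequentially. prob {\<omega> \<in> space M. real n powr (- 2 / 5) \<le> \<bar>(\<Sum>i<n. Y i \<omega>) / real n\<bar>} \<le> v * real n powr (- 1 / 5)"
  proof (rule eventually_sequentiallyI[of 1])
    fix n :: nat assume n: "1 \<le> n"
    note s = expectation_sum_square[OF assms, of n]
    have eq: "real n powr (- 2 / 5) \<le> \<bar>x / real n\<bar> \<longleftrightarrow> real n powr (6 / 5) \<le> x\<^sup>2" for x :: real
    proof -
      have "real n powr (- 2 / 5) * real n = real n powr (3 / 5)"
        using n powr_add[of "real n" "- 2 / 5" 1] by simp
      then have "real n powr (- 2 / 5) \<le> \<bar>x / real n\<bar> \<longleftrightarrow> real n powr (3 / 5) \<le> \<bar>x\<bar>"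
        using n by (simp add: le_divide_eq)
      also have "\<dots> \<longleftrightarrow> (real n powr (3 / 5))\<^sup>2 \<le> x\<^sup>2"
        by (metis abs_le_square_iff abs_of_nonneg powr_ge_zero)
      also have "(real n powr (3 / 5))\<^sup>2 = real n powr (6 / 5)"
        using powr_add[of "real n" "3 / 5" "3 / 5"] by (simp add: power2_eq_square)
      finally show ?thesis .
    qed
    have "prob {\<omega> \<in> space M. real n powr (6 / 5) \<le> (\<Sum>i<n. Y i \<omega>)\<^sup>2} \<le> (\<integral>\<omega>. (\<Sum>i<n. Y i \<omega>)\<^sup>2 \<partial>M) / real n powr (6 / 5)"
      using s n by (intro integral_Markov_inequality_measure[where A = "space M"]) auto
    also have "\<dots> = v * real n powr (- 1 / 5)"
    proof -
      have "real n powr (- 1 / 5) * real n powr (6 / 5) = real n"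
        using n powr_add[of "real n" "- 1 / 5" "6 / 5"] by simp
      then show ?thesis using s n by (simp add: divide_eq_eq mult_ac)
    qed
    finally show "prob {\<omega> \<in> space M. real n powr (- 2 / 5) \<le> \<bar>(\<Sum>i<n. Y i \<omega>) / real n\<bar>} \<le> v * real n powr (- 1 / 5)"
      unfolding eq .
  qed
  have "(\<lambda>n. real n powr (- 1 / 5)) \<longlonglongrightarrow> 0"
    by (rule tendsto_neg_powr) (auto simp: filterlim_real_sequentially)
  from tendsto_mult_left[OF this, of v] show "(\<lambda>n. v * real n powr (- 1 / 5)) \<longlonglongrightarrow> 0" by simp
qed auto

text \<open>The function \<open>exp (- x)\<close> is 1-Lipschitz on the nonnegative reals, which
  settles the complement of \<open>E n\<close>; on \<open>E n\<close> itself the difference is at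
  most 1 and the probability is small.\<close>

lemma laplace_close:
  fixes T Q :: "nat \<Rightarrow> 'a \<Rightarrow> real"
  assumes T [measurable]: "\<And>n. T n \<in> borel_measurable M" and Q [measurable]: "\<And>n. Q n \<in> borel_measurable M"
    and T0: "\<And>n \<omega>. 0 \<le> T n \<omega>" and Q0: "\<And>n \<omega>. 0 \<le> Q n \<omega>"
    and E [measurable]: "\<And>n. E n \<in> sets M" and PE: "(\<lambda>n. prob (E n)) \<longlonglongrightarrow> 0"
    and close: "\<forall>\<^sub>F n in sequentially. \<forall>\<omega>\<in>space M - E n. \<bar>T n \<omega> - Q n \<omega>\<bar> \<le> e n" and e: "e \<longlonglongrightarrow> 0"
    and t: "0 \<le> t" and lim: "(\<lambda>n. \<integral>\<omega>. exp (- (t * Q n \<omega>)) \<partial>M) \<longlonglongrightarrow> L"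
  shows "(\<lambda>n. \<integral>\<omega>. exp (- (t * T n \<omega>)) \<partial>M) \<longlonglongrightarrow> L"
proof -
  have lip: "\<bar>exp (- x) - exp (- y)\<bar> \<le> \<bar>x - y\<bar>" if "0 \<le> x" "0 \<le> y" for x y :: real
  proof -
    have *: "exp (- x) - exp (- y) \<le> y - x" if "0 \<le> x" "x \<le> y" for x y :: real
    proof -
      have "1 - exp (- (y - x)) \<le> y - x" using exp_ge_add_one_self[of "- (y - x)"] by linarith
      then have "exp (- x) * (1 - exp (- (y - x))) \<le> 1 * (y - x)"
        using that by (intro mult_mono) auto
      moreover have "exp (- x) * (1 - exp (- (y - x))) = exp (- x) - exp (- y)"
        by (simp add: right_diff_distrib exp_add[symmetric])
      ultimately show ?thesis by simp
    qed
    show ?thesis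
    proof (cases "x \<le> y")
      case True then show ?thesis using *[OF that(1) True] by simp
    next
      case False then show ?thesis using *[OF that(2), of x] by simp
    qed
  qed
  have i: "integrable M (\<lambda>\<omega>. exp (- (t * T n \<omega>)))" "integrable M (\<lambda>\<omega>. exp (- (t * Q n \<omega>)))" for n
    using t T0 Q0 by (auto intro!: integrable_const_bound[of _ 1])
  have bound: "\<forall>\<^sub>F n in sequentially. norm ((\<integral>\<omega>. exp (- (t * T n \<omega>)) \<partial>M) - (\<integral>\<omega>. exp (- (t * Q n \<omega>)) \<partial>M)) \<le> t * \<bar>e n\<bar> + prob (E n)"
    using close
  proof eventually_elim
    case (elim n)
    have "(\<integral>\<omega>. exp (- (t * T n \<omega>)) \<partial>M) - (\<integral>\<omega>. exp (- (t * Q n \<omega>)) \<partial>M) = (\<integral>\<omega>. exp (- (t * T n \<omega>)) - exp (- (t * Q n \<omega>)) \<partial>M)"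
      using i by simp
    also have "\<bar>\<dots>\<bar> \<le> (\<integral>\<omega>. \<bar>exp (- (t * T n \<omega>)) - exp (- (t * Q n \<omega>))\<bar> \<partial>M)" by (rule integral_abs_bound)
    also have "\<dots> \<le> (\<integral>\<omega>. t * \<bar>e n\<bar> + indicator (E n) \<omega> \<partial>M)"
    proof (rule integral_mono)
      fix \<omega> assume \<omega>: "\<omega> \<in> space M"
      show "\<bar>exp (- (t * T n \<omega>)) - exp (- (t * Q n \<omega>))\<bar> \<le> t * \<bar>e n\<bar> + indicator (E n) \<omega>"
      proof (cases "\<omega> \<in> E n")
        case True
        have "0 < exp (- (t * T n \<omega>))" "exp (- (t * T n \<omega>)) \<le> 1" "0 < exp (- (t * Q n \<omega>))" "exp (- (t * Q n \<omega>)) \<le> 1"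
          using t T0[of n \<omega>] Q0[of n \<omega>] by auto
        then have "\<bar>exp (- (t * T n \<omega>)) - exp (- (t * Q n \<omega>))\<bar> \<le> 1" by linarith
        then show ?thesis using True t by (simp add: add_increasing)
      next
        case False
        have "\<bar>exp (- (t * T n \<omega>)) - exp (- (t * Q n \<omega>))\<bar> \<le> \<bar>t * T n \<omega> - t * Q n \<omega>\<bar>"
          using t T0[of n \<omega>] Q0[of n \<omega>] by (intro lip) auto
        also have "\<dots> = t * \<bar>T n \<omega> - Q n \<omega>\<bar>" using t by (simp add: right_diff_distrib[symmetric] abs_mult)
        also have "\<dots> \<le> t * \<bar>e n\<bar>" using elim \<omega> False t by (intro mult_left_mono) force+
        finally show ?thesis using False by simp
      qed
    next
      have m: "(\<lambda>\<omega>. t * \<bar>e n\<bar> + indicator (E n) \<omega>) \<in> borel_measurable M" by measurable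
      show "integrable M (\<lambda>\<omega>. t * \<bar>e n\<bar> + indicator (E n) \<omega>)"
        by (rule integrable_const_bound[of _ "t * \<bar>e n\<bar> + 1", OF _ m]) (use t in \<open>auto simp: indicator_def\<close>)
    qed (use i in auto)
    also have "\<dots> = t * \<bar>e n\<bar> + prob (E n)"
    proof -
      have "integrable M (\<lambda>\<omega>. indicator (E n) \<omega> :: real)"
        by (rule integrable_const_bound[of _ 1]) (auto simp: indicator_def)
      then show ?thesis
        by (subst Bochner_Integration.integral_add) (auto simp: prob_space sets.Int_space_eq2)
    qed
    finally show ?case by simp
  qed
  have "(\<lambda>n. t * \<bar>e n\<bar> + prob (E n)) \<longlonglongrightarrow> t * \<bar>0\<bar> + 0"
    by (intro tendsto_add tendsto_mult tendsto_const tendsto_rabs e PE)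
  then have "(\<lambda>n. t * \<bar>e n\<bar> + prob (E n)) \<longlonglongrightarrow> 0" by simp
  with bound have "(\<lambda>n. (\<integral>\<omega>. exp (- (t * T n \<omega>)) \<partial>M) - (\<integral>\<omega>. exp (- (t * Q n \<omega>)) \<partial>M)) \<longlonglongrightarrow> 0"
    by (rule Lim_null_comparison)
  from tendsto_add[OF this lim] show ?thesis by simp
qed

end

text \<open>The limit of the statistic and the weighted sum of chi-square variates both factor into
  powers of such one-dimensional Gaussian integrals, so their closed form is irrelevant.\<close>

lemma laplace_chi_square:
  assumes "0 \<le> c"
  shows "(\<integral>u. exp (- (c * u)) \<partial>chi_square d) = (\<integral>x. exp (- (c * x\<^sup>2)) \<partial>gaussian) ^ d"
proof -
  have "(\<integral>u. exp (- (c * u)) \<partial>chi_square d) = (\<integral>x. exp (- (c * (\<Sum>i<d. (x i)\<^sup>2))) \<partial>PiM {..<d} (\<lambda>_. gaussian))"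
    unfolding chi_square_def by (rule integral_distr) measurable
  also have "\<dots> = (\<integral>x. (\<Prod>i<d. exp (- (c * (x i)\<^sup>2))) \<partial>PiM {..<d} (\<lambda>_. gaussian))"
    by (simp add: exp_sum[symmetric] sum_distrib_left sum_negf)
  also have "\<dots> = (\<Prod>i<d. \<integral>x. exp (- (c * x\<^sup>2)) \<partial>gaussian)"
    using assms by (intro gauss_prod.product_integral_prod gauss.integrable_const_bound[of _ 1]) auto
  finally show ?thesis by simp
qed

lemma real_distribution_chi_square: "real_distribution (chi_square d)"
proof -
  interpret G: prob_space "PiM {..<d} (\<lambda>_. gaussian)" by (rule prob_space_PiM) (rule prob_space_gaussian)
  show ?thesis unfolding chi_square_def by (rule G.real_distribution_distr) measurable
qed

lemma AE_chi_square_nonneg: "AE u in chi_square d. 0 \<le> u"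
  unfolding chi_square_def by (subst AE_distr_iff) (auto intro!: sum_nonneg)

lemma chi_square_mixture:
  fixes c1 c2 :: real and d1 d2 :: nat
  assumes c: "0 \<le> c1" "0 \<le> c2"
  defines "\<nu> \<equiv> distr (chi_square d1 \<Otimes>\<^sub>M chi_square d2) borel (\<lambda>(u, v). c1 * u + c2 * v)"
  shows "real_distribution \<nu>" "AE x in \<nu>. 0 \<le> x"
    "0 \<le> t \<Longrightarrow> (\<integral>x. exp (- (t * x)) \<partial>\<nu>) =
       (\<integral>x. exp (- (t * c1 * x\<^sup>2)) \<partial>gaussian) ^ d1 * (\<integral>x. exp (- (t * c2 * x\<^sup>2)) \<partial>gaussian) ^ d2"
proof -
  interpret C1: real_distribution "chi_square d1" by (rule real_distribution_chi_square)
  interpret C2: real_distribution "chi_square d2" by (rule real_distribution_chi_square)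
  interpret C: pair_prob_space "chi_square d1" "chi_square d2" ..
  have [measurable]: "(\<lambda>(u, v). c1 * u + c2 * v) \<in> borel_measurable (chi_square d1 \<Otimes>\<^sub>M chi_square d2)"
    by measurable
  show "real_distribution \<nu>" unfolding \<nu>_def by (rule C.P.real_distribution_distr) measurable
  have nn: "AE x in chi_square d1 \<Otimes>\<^sub>M chi_square d2. 0 \<le> fst x \<and> 0 \<le> snd x"
  proof (rule C.AE_pair_measure)
    show "{x \<in> space (chi_square d1 \<Otimes>\<^sub>M chi_square d2). 0 \<le> fst x \<and> 0 \<le> snd x} \<in> sets (chi_square d1 \<Otimes>\<^sub>M chi_square d2)"
      by measurable
    show "AE x in chi_square d1. AE y in chi_square d2. 0 \<le> fst (x, y) \<and> 0 \<le> snd (x, y)"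
      using AE_chi_square_nonneg[of d1] AE_chi_square_nonneg[of d2] by (auto elim!: eventually_mono)
  qed
  show "AE x in \<nu>. 0 \<le> x"
  proof -
    have "AE x in chi_square d1 \<Otimes>\<^sub>M chi_square d2. 0 \<le> (case x of (u, v) \<Rightarrow> c1 * u + c2 * v)"
      using nn
    proof eventually_elim
      case (elim x) then show ?case using c by (cases x) simp
    qed
    then show ?thesis unfolding \<nu>_def by (subst AE_distr_iff) auto
  qed
  assume t: "0 \<le> t"
  have "(\<integral>x. exp (- (t * x)) \<partial>\<nu>) = (\<integral>x. exp (- (t * c1 * fst x)) * exp (- (t * c2 * snd x)) \<partial>(chi_square d1 \<Otimes>\<^sub>M chi_square d2))"
    unfolding \<nu>_def by (subst integral_distr) (auto simp: case_prod_beta exp_add[symmetric] algebra_simps)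
  also have "\<dots> = (\<integral>u. (\<integral>v. exp (- (t * c1 * u)) * exp (- (t * c2 * v)) \<partial>chi_square d2) \<partial>chi_square d1)"
  proof -
    have m: "(\<lambda>x. exp (- (t * c1 * fst x)) * exp (- (t * c2 * snd x))) \<in> borel_measurable (chi_square d1 \<Otimes>\<^sub>M chi_square d2)"
      by measurable
    have "AE x in chi_square d1 \<Otimes>\<^sub>M chi_square d2. norm (exp (- (t * c1 * fst x)) * exp (- (t * c2 * snd x))) \<le> 1"
      using nn
    proof eventually_elim
      case (elim x)
      then have "0 \<le> t * c1 * fst x" "0 \<le> t * c2 * snd x" using t c by auto
      then show ?case by (simp add: exp_add[symmetric])
    qed
    then have "integrable (chi_square d1 \<Otimes>\<^sub>M chi_square d2) (\<lambda>x. exp (- (t * c1 * fst x)) * exp (- (t * c2 * snd x)))"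
      by (rule C.P.integrable_const_bound[OF _ m])
    from C.integral_fst'[OF this] show ?thesis by simp
  qed
  also have "\<dots> = (\<integral>u. exp (- (t * c1 * u)) \<partial>chi_square d1) * (\<integral>v. exp (- (t * c2 * v)) \<partial>chi_square d2)"
    by simp
  finally show "(\<integral>x. exp (- (t * x)) \<partial>\<nu>) =
       (\<integral>x. exp (- (t * c1 * x\<^sup>2)) \<partial>gaussian) ^ d1 * (\<integral>x. exp (- (t * c2 * x\<^sup>2)) \<partial>gaussian) ^ d2"
    using t c by (simp add: laplace_chi_square)
qed

lemma laplace_gaussian_quadratic:
  assumes J: "finite J1" "finite J2" "J1 \<inter> J2 = {}" and c: "0 \<le> c1" "0 \<le> c2" "0 \<le> t"
  shows "(\<integral>g. exp (- (t * (\<Sum>j\<in>J1 \<union> J2. (if j \<in> J1 then c1 else c2) * (g j)\<^sup>2))) \<partial>PiM (J1 \<union> J2) (\<lambda>_. gaussian))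
    = (\<integral>x. exp (- (t * c1 * x\<^sup>2)) \<partial>gaussian) ^ card J1 * (\<integral>x. exp (- (t * c2 * x\<^sup>2)) \<partial>gaussian) ^ card J2"
proof -
  let ?c = "\<lambda>j. if j \<in> J1 then c1 else c2"
  have "(\<integral>g. exp (- (t * (\<Sum>j\<in>J1 \<union> J2. ?c j * (g j)\<^sup>2))) \<partial>PiM (J1 \<union> J2) (\<lambda>_. gaussian))
    = (\<integral>g. (\<Prod>j\<in>J1 \<union> J2. exp (- (t * ?c j * (g j)\<^sup>2))) \<partial>PiM (J1 \<union> J2) (\<lambda>_. gaussian))"
    using J by (simp add: exp_sum[symmetric] sum_distrib_left sum_negf mult.assoc)
  also have "\<dots> = (\<Prod>j\<in>J1 \<union> J2. \<integral>x. exp (- (t * ?c j * x\<^sup>2)) \<partial>gaussian)"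
    using J c by (intro gauss_prod.product_integral_prod gauss.integrable_const_bound[of _ 1]) auto
  also have "\<dots> = (\<Prod>j\<in>J1. \<integral>x. exp (- (t * ?c j * x\<^sup>2)) \<partial>gaussian) * (\<Prod>j\<in>J2. \<integral>x. exp (- (t * ?c j * x\<^sup>2)) \<partial>gaussian)"
    using J by (rule prod.union_disjoint)
  also have "(\<Prod>j\<in>J1. \<integral>x. exp (- (t * ?c j * x\<^sup>2)) \<partial>gaussian) = (\<Prod>j\<in>J1. \<integral>x. exp (- (t * c1 * x\<^sup>2)) \<partial>gaussian)"
    by (rule prod.cong) auto
  also have "(\<Prod>j\<in>J2. \<integral>x. exp (- (t * ?c j * x\<^sup>2)) \<partial>gaussian) = (\<Prod>j\<in>J2. \<integral>x. exp (- (t * c2 * x\<^sup>2)) \<partial>gaussian)"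
    using J by (intro prod.cong) auto
  finally show ?thesis by simp
qed

section \<open>Almost sure invertibility of the sample covariance\<close>

lemma linear_vec_cols: "linear (vec_cols :: real^'q^'p \<Rightarrow> _)"
  by (rule linearI) (simp_all add: vec_eq_iff vec_cols_def)

lemma inner_outer_vec: "v \<bullet> (outer w *v v) = (v \<bullet> w)\<^sup>2" for v w :: "real^'n"
  unfolding inner_outer[symmetric]
  by (simp add: inner_vec_def outer_def power2_eq_square sum_product mult_ac)

text \<open>A vector at which the form vanishes is orthogonal to all centred observations, hence to
  the differences from \<open>x 0\<close>, in which the mean cancels. These differences are the rows
  of an invertible matrix.\<close>

lemma spd_sample_cov:
  fixes x :: "nat \<Rightarrow> real^'q^'p" and h :: "'q \<times> 'p \<Rightarrow> nat"
  assumes n: "0 < n" "\<And>a. h a < n" and det: "det (\<chi> a. vec_cols (x (h a) - x 0)) \<noteq> 0"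
  shows "spd (sample_cov x n)"
  unfolding spd_def
proof (intro conjI allI impI)
  let ?m = "sample_mean x n"
  show "transpose (sample_cov x n) = sample_cov x n"
    by (simp add: sample_cov_def transpose_scalar linear_sum[OF bounded_linear.linear[OF bounded_linear_transpose]])
  fix v :: "real^('q \<times> 'p)" assume v: "v \<noteq> 0"
  have eq: "v \<bullet> (sample_cov x n *v v) = (1 / real n) * (\<Sum>i<n. (v \<bullet> vec_cols (x i - ?m))\<^sup>2)"
    by (simp add: sample_cov_def inner_outer[symmetric] inner_sum_right)
       (simp add: inner_outer inner_outer_vec)
  have "0 \<le> (\<Sum>i<n. (v \<bullet> vec_cols (x i - ?m))\<^sup>2)" by (intro sum_nonneg) simp
  moreover have "(\<Sum>i<n. (v \<bullet> vec_cols (x i - ?m))\<^sup>2) \<noteq> 0"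
  proof
    assume "(\<Sum>i<n. (v \<bullet> vec_cols (x i - ?m))\<^sup>2) = 0"
    then have z: "v \<bullet> vec_cols (x i - ?m) = 0" if "i < n" for i
      using that by (subst (asm) sum_nonneg_eq_0_iff) auto
    have "vec_cols (x (h a) - x 0) \<bullet> v = 0" for a
    proof -
      have "vec_cols (x (h a) - x 0) = vec_cols (x (h a) - ?m) - vec_cols (x 0 - ?m)"
        by (simp add: linear_diff[OF linear_vec_cols])
      then show ?thesis using z[OF n(2)[of a]] z[OF n(1)] by (simp add: inner_diff_left inner_diff_right inner_commute)
    qed
    then have "(\<chi> a. vec_cols (x (h a) - x 0)) *v v = 0"
      by (simp add: matrix_mult_dot vec_eq_iff)
    then have "matrix_inv (\<chi> a. vec_cols (x (h a) - x 0)) *v ((\<chi> a. vec_cols (x (h a) - x 0)) *v v) = 0"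
      by (simp only: matrix_vector_mult_0_right)
    then show False using v by (simp add: matrix_vector_mul_assoc matrix_inv_mult[OF det])
  qed
  ultimately show "0 < v \<bullet> (sample_cov x n *v v)" unfolding eq using n by simp
qed

lemma linear_det_row:
  "linear (\<lambda>w. det (\<chi> b. if b = a then w else r b) :: real)" for r :: "'n \<Rightarrow> real^'n"
proof (rule linearI)
  show "det (\<chi> b. if b = a then x + y else r b) = det (\<chi> b. if b = a then x else r b) + det (\<chi> b. if b = a then y else r b)" for x y
    using det_row_add[of a "\<lambda>_. x" "\<lambda>_. y" r] by simp
  show "det (\<chi> b. if b = a then c *\<^sub>R x else r b) = c *\<^sub>R det (\<chi> b. if b = a then x else r b)" for c x
    using det_row_mul[of a c "\<lambda>_. x" r] unfolding scalar_mult_eq_scaleR by simp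
qed

lemma linear_zero_set_null:
  fixes f :: "'a::euclidean_space \<Rightarrow> real"
  assumes f: "linear f" and nz: "f z \<noteq> 0"
  shows "{y. f (y - x) = 0} \<in> null_sets lborel"
proof -
  define G where "G = adjoint f 1"
  have G: "f y = G \<bullet> y" for y using adjoint_works[OF f, of y 1] by (simp add: G_def inner_commute)
  then have "G \<noteq> 0" using nz by auto
  have eq: "{y. f (y - x) = 0} = {y. G \<bullet> y = G \<bullet> x}" by (auto simp: G inner_diff_right)
  have "negligible {y. G \<bullet> y = G \<bullet> x}" using \<open>G \<noteq> 0\<close> by (intro negligible_hyperplane) simp
  moreover have "{y. G \<bullet> y = G \<bullet> x} \<in> sets lborel" by (simp add: closed_hyperplane borel_closed)
  ultimately show ?thesis unfolding eq by (simp add: negligible_iff_null_sets null_sets_completion_iff)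
qed

text \<open>Rows are exchanged one at a time from the coordinate basis for random differences; given the other
  rows, the determinant is a nonzero linear functional of the new one.\<close>

lemma AE_det_differences:
  fixes F :: "(real^'q^'p) measure" and h :: "'q \<times> 'p \<Rightarrow> nat"
  assumes F: "prob_space F" "sets F = sets borel" "absolutely_continuous lborel F"
    and h: "inj h" "\<And>a. h a \<noteq> 0" and A: "finite A"
  shows "AE x in PiM (insert 0 (h ` A)) (\<lambda>_. F).
    det (\<chi> a. if a \<in> A then vec_cols (x (h a) - x 0) else axis a 1) \<noteq> 0"
  using A
proof (induction A rule: finite_induct)
  case empty
  have "(\<chi> a. axis a 1) = (mat 1 :: real^('q \<times> 'p)^('q \<times> 'p))" by (simp add: vec_eq_iff mat_def axis_def)
  then show ?case by simp
next
  case (insert a A)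
  interpret F: prob_space F by (rule F)
  interpret FP: product_sigma_finite "\<lambda>_::nat. F" by (simp add: product_sigma_finite_def F.sigma_finite_measure_axioms)
  let ?I = "insert 0 (h ` A)"
  let ?D = "\<lambda>x. det (\<chi> b. if b \<in> insert a A then vec_cols (x (h b) - x 0) else axis b 1)"
  have fin: "finite ?I" "h a \<notin> ?I" using insert.hyps h by (auto dest: injD)
  have entry: "(\<lambda>x. x i $ j $ k) \<in> borel_measurable (PiM I (\<lambda>_. F))" if "i \<in> I" for i :: nat and I j k
  proof -
    have "(\<lambda>Z :: real^'q^'p. Z $ j $ k) \<in> borel_measurable F"
      unfolding measurable_cong_sets[OF F(2) refl] by (intro borel_measurable_continuous_onI continuous_intros)
    from measurable_compose[OF measurable_component_singleton[OF that] this] show ?thesis by simp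
  qed
  have mD: "?D \<in> borel_measurable (PiM (insert (h a) ?I) (\<lambda>_. F))"
    unfolding det_def
  proof (intro borel_measurable_sum borel_measurable_times borel_measurable_const borel_measurable_prod)
    fix \<sigma> b
    show "(\<lambda>x. (\<chi> b. if b \<in> insert a A then vec_cols (x (h b) - x 0) else axis b 1) $ b $ \<sigma> b)
       \<in> borel_measurable (PiM (insert (h a) ?I) (\<lambda>_. F))"
      by (cases "b \<in> insert a A") (auto simp: vec_cols_def intro!: borel_measurable_diff entry)
  qed
  define N where "N = {x \<in> space (PiM (insert (h a) ?I) (\<lambda>_. F)). ?D x = 0}"
  have N: "N \<in> sets (PiM (insert (h a) ?I) (\<lambda>_. F))" unfolding N_def using mD by measurable
  have "emeasure (PiM (insert (h a) ?I) (\<lambda>_. F)) N = (\<integral>\<^sup>+x. indicator N x \<partial>PiM (insert (h a) ?I) (\<lambda>_. F))"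
    using N by simp
  \<comment> \<open>Fubini isolates the new observation \<open>h a\<close>; the others, including
    the base point 0, are fixed outside the null set of the induction hypothesis.\<close>
  also have "\<dots> = (\<integral>\<^sup>+x. (\<integral>\<^sup>+y. indicator N (x(h a := y)) \<partial>F) \<partial>PiM ?I (\<lambda>_. F))"
    using N by (intro FP.product_nn_integral_insert fin) simp
  also have "\<dots> = (\<integral>\<^sup>+x. 0 \<partial>PiM ?I (\<lambda>_. F))"
  proof (rule nn_integral_cong_AE)
    show "AE x in PiM ?I (\<lambda>_. F). (\<integral>\<^sup>+y. indicator N (x(h a := y)) \<partial>F) = 0"
      using insert.IH
    proof eventually_elim
      case (elim x)
      let ?r = "\<lambda>b. if b \<in> A then vec_cols (x (h b) - x 0) else axis b 1"
      let ?L = "\<lambda>z. det (\<chi> b. if b = a then vec_cols z else ?r b)"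
      have lin: "linear ?L" using linear_compose[OF linear_vec_cols linear_det_row[of a ?r]] by (simp add: o_def)
      \<comment> \<open>For this \<open>z\<close> the new row is \<open>axis a 1\<close>, so the
        functional takes the previous determinant as its value and is not identically zero.\<close>
      define z :: "real^'q^'p" where "z = (\<chi> j k. if (k, j) = a then 1 else 0)"
      have "vec_cols z = axis a 1" by (auto simp: vec_eq_iff vec_cols_def z_def axis_def)
      then have "(\<chi> b. if b = a then vec_cols z else ?r b) = (\<chi> b. ?r b)" using insert.hyps by (auto simp: vec_eq_iff)
      then have "?L z \<noteq> 0" using elim by simp
      then have "{y. ?L (y - x 0) = 0} \<in> null_sets F"
        using linear_zero_set_null[OF lin, of z "x 0"] F(3) by (auto simp: absolutely_continuous_def)
      then have "AE y in F. ?L (y - x 0) \<noteq> 0" by (rule AE_I') auto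
      then have "AE y in F. indicator N (x(h a := y)) = (0 :: ennreal)"
      proof eventually_elim
        case (elim y)
        have "(\<chi> b. if b \<in> insert a A then vec_cols ((x(h a := y)) (h b) - (x(h a := y)) 0) else axis b 1)
          = (\<chi> b. if b = a then vec_cols (y - x 0) else ?r b)"
          using h(2)[of a, symmetric] h(1) insert.hyps(2)
          by (intro Cart_lambda_cong) (simp add: inj_eq)
        then have "?D (x(h a := y)) \<noteq> 0" using elim by metis
        then show ?case by (simp add: N_def)
      qed
      then show ?case by (simp add: nn_integral_0_iff_AE cong: nn_integral_cong_AE)
    qed
  qed
  finally have "N \<in> null_sets (PiM (insert (h a) ?I) (\<lambda>_. F))" using N by (simp add: null_sets_def)
  then have "AE x in PiM (insert (h a) ?I) (\<lambda>_. F). ?D x \<noteq> 0"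
    by (rule AE_I') (auto simp: N_def)
  moreover have "insert (h a) ?I = insert 0 (h ` insert a A)" by auto
  ultimately show ?case by (simp only:)
qed

lemma (in prob_space) AE_spd_sample_cov:
  fixes Z :: "nat \<Rightarrow> 'a \<Rightarrow> real^'q^'p"
  assumes F: "prob_space F" "sets F = sets borel" "absolutely_continuous lborel F"
    and indep: "indep_vars (\<lambda>_. borel) Z UNIV" and distr: "\<And>i. distr M borel (Z i) = F"
    and n: "CARD('q \<times> 'p) < n"
  shows "AE \<omega> in M. spd (sample_cov (\<lambda>i. Z i \<omega>) n)"
proof -
  obtain h0 :: "'q \<times> 'p \<Rightarrow> nat" where h0: "bij_betw h0 UNIV {0..<CARD('q \<times> 'p)}"
    using ex_bij_betw_finite_nat[OF finite] by blast
  \<comment> \<open>Index 0 is kept for the base point of the differences, so one observation more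
    than \<open>CARD('q \<times> 'p)\<close> is required.\<close>
  define h where "h a = Suc (h0 a)" for a
  have h: "inj h" "h a \<noteq> 0" "h a < n" for a
  proof -
    show "inj h" using h0 by (auto simp: h_def inj_on_def bij_betw_def)
    show "h a \<noteq> 0" by (simp add: h_def)
    have "h0 a < CARD('q \<times> 'p)" using h0 by (auto simp: bij_betw_def)
    then show "h a < n" using n unfolding h_def by linarith
  qed
  let ?I = "insert 0 (range h)"
  have rv: "Z i \<in> measurable M borel" for i using indep unfolding indep_vars_def2 by simp
  have "indep_vars (\<lambda>_. borel) Z ?I" by (rule indep_vars_subset[OF indep]) auto
  then have d: "distr M (PiM ?I (\<lambda>_. borel)) (\<lambda>\<omega>. \<lambda>i\<in>?I. Z i \<omega>) = PiM ?I (\<lambda>_. F)"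
    using indep_vars_iff_distr_eq_PiM[where I = ?I and X = Z and M' = "\<lambda>_. borel"] rv by (simp add: distr)
  let ?D = "\<lambda>x. det (\<chi> a. vec_cols (x (h a) - x 0))"
  have "AE x in PiM ?I (\<lambda>_. F). ?D x \<noteq> 0"
    using AE_det_differences[OF F h(1) h(2), of UNIV] by simp
  then have "AE x in distr M (PiM ?I (\<lambda>_. borel)) (\<lambda>\<omega>. \<lambda>i\<in>?I. Z i \<omega>). ?D x \<noteq> 0" unfolding d .
  then have "AE \<omega> in M. ?D (\<lambda>i\<in>?I. Z i \<omega>) \<noteq> 0"
    by (rule AE_distrD[rotated]) (intro measurable_restrict rv)
  then show ?thesis
  proof eventually_elim
    case (elim \<omega>)
    then have "?D (\<lambda>i. Z i \<omega>) \<noteq> 0" by simp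
    then show ?case using h n by (intro spd_sample_cov[of n h]) auto
  qed
qed

section \<open>The limit theorem\<close>

text \<open>Equivariance of the fit combined with invariance of the trace expression. It removes
  \<open>\<Sigma>1\<close>, \<open>\<Sigma>2\<close> and the scale \<open>m11\<close> from the
  problem.\<close>

lemma fitted_stat_congruence:
  fixes S :: "real^('q::finite \<times> 'p::finite)^('q \<times> 'p)"
  assumes S: "spd S" and C: "det C1 \<noteq> 0" "det C2 \<noteq> 0"
  shows "fitted_stat (kronecker C2 C1 ** S ** transpose (kronecker C2 C1)) = fitted_stat S"
proof -
  obtain A B where fit: "separable_fit S A B" using separable_fit_exists[OF S] by blast
  let ?K = "kronecker C2 C1"
  have K: "det ?K \<noteq> 0" using C by (intro det_kronecker_nz)
  have "kronecker (C2 ** B ** transpose C2) (C1 ** A ** transpose C1) = ?K ** kronecker B A ** transpose ?K"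
    by (simp add: kronecker_mult transpose_kronecker)
  then have "fitted_stat (?K ** S ** transpose ?K) = separability_stat (?K ** S ** transpose ?K) (?K ** kronecker B A ** transpose ?K)"
    using fitted_stat_eq[OF spd_congruence[OF S K] separable_fit_congruence[OF fit C]] by simp
  also have "\<dots> = separability_stat S (kronecker B A)"
    by (rule separability_stat_congruence[OF spd_det_nz[OF S] K])
  finally show ?thesis by (simp add: fitted_stat_eq[OF S fit])
qed

lemma fitted_stat_nonneg: "0 \<le> fitted_stat S"
proof (cases "spd S")
  case True
  obtain A B where fit: "separable_fit S A B" using separable_fit_exists[OF True] by blast
  then have "spd A" "spd B" by (auto simp: separable_fit_def)
  from norm_separability_matrix[OF True this] show ?thesis
    unfolding fitted_stat_eq[OF True fit] by (metis zero_le_power2)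
qed (simp add: fitted_stat_def)

lemma norm_outer_le: "norm (outer v) \<le> (norm v)\<^sup>2"
  using psd_norm_le_trace[OF psd_outer, of v] by (simp add: power2_norm_eq_inner)

lemma spd_near_mat_1:
  assumes sym: "transpose (S :: real^'n^'n) = S" and near: "norm (S - mat 1) \<le> 1 / 2"
  shows "spd S"
  unfolding spd_def
proof (intro conjI allI impI)
  fix x :: "real^'n" assume x: "x \<noteq> 0"
  have "\<bar>outer x \<bullet> (S - mat 1)\<bar> \<le> (norm x)\<^sup>2 * (1 / 2)"
    using near by (intro order_trans[OF Cauchy_Schwarz_ineq2] mult_mono norm_outer_le) auto
  moreover have "x \<bullet> (S *v x) = (norm x)\<^sup>2 + outer x \<bullet> (S - mat 1)"
    by (simp add: inner_diff_right inner_mat_1 power2_norm_eq_inner) (simp add: inner_outer)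
  moreover have "0 < (norm x)\<^sup>2" using x by simp
  ultimately show "0 < x \<bullet> (S *v x)" by linarith
qed (rule sym)

section \<open>Affine changes of the sample\<close>

lemma vec_cols_mult: "vec_cols (A ** Z ** B) = kronecker (transpose B) A *v vec_cols Z"
proof -
  have "(\<Sum>l\<in>UNIV. (\<Sum>j\<in>UNIV. A $ i $ j * Z $ j $ l) * B $ l $ k) = (\<Sum>l\<in>UNIV. \<Sum>j\<in>UNIV. B $ l $ k * A $ i $ j * Z $ j $ l)" for i k
    by (simp add: sum_distrib_right sum_distrib_left mult_ac)
  then show ?thesis
    by (simp add: vec_eq_iff vec_cols_def matrix_vector_mult_def kronecker_def transpose_def matrix_matrix_mult_def sum_UNIV_prod)
qed

lemma outer_matrix_vector_mult: "outer (K *v v) = K ** outer v ** transpose K" for v :: "real^'n"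
  by (simp add: vec_eq_iff outer_def matrix_vector_mult_def matrix_matrix_mult_def transpose_def
      sum_product sum_distrib_left sum_distrib_right mult_ac)

lemma sample_mean_affine:
  fixes Z :: "nat \<Rightarrow> real^'q^'p"
  assumes "0 < n"
  shows "sample_mean (\<lambda>i. M + A ** Z i ** B) n = M + A ** sample_mean Z n ** B"
  using assms
  by (simp add: sample_mean_def sum.distrib scaleR_add_right mm.sum_left mm.sum_right mm.scaleR_left mm.scaleR_right
      sum_constant_scaleR del: sum_constant)

lemma sample_cov_affine:
  fixes Z :: "nat \<Rightarrow> real^'q^'p"
  assumes "0 < n"
  shows "sample_cov (\<lambda>i. M + A ** Z i ** B) n
    = kronecker (transpose B) A ** sample_cov Z n ** transpose (kronecker (transpose B) A)"
proof -
  have "M + A ** Z i ** B - sample_mean (\<lambda>i. M + A ** Z i ** B) n = A ** (Z i - sample_mean Z n) ** B" for i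
    by (simp add: sample_mean_affine[OF assms] mm.diff_left mm.diff_right)
  then show ?thesis
    by (simp add: sample_cov_def vec_cols_mult outer_matrix_vector_mult mm.sum_left mm.sum_right mm.scaleR_left mm.scaleR_right)
qed

text \<open>Separates a sum of independent terms from the outer product of the mean, which is
  quadratic in a small quantity and does not affect the limit.\<close>

lemma sample_cov_expand:
  fixes Z :: "nat \<Rightarrow> real^'q^'p"
  assumes n: "0 < n"
  shows "sample_cov Z n = (1 / real n) *\<^sub>R (\<Sum>i<n. outer (vec_cols (Z i))) - outer (vec_cols (sample_mean Z n))"
proof -
  have "sample_cov Z n $ a $ b = ((1 / real n) *\<^sub>R (\<Sum>i<n. outer (vec_cols (Z i))) - outer (vec_cols (sample_mean Z n))) $ a $ b" for a b
  proof -
    define x y where "x i = vec_cols (Z i) $ a" and "y i = vec_cols (Z i) $ b" for i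
    have m: "vec_cols (sample_mean Z n) $ a = (\<Sum>i<n. x i) / real n" "vec_cols (sample_mean Z n) $ b = (\<Sum>i<n. y i) / real n"
      by (simp_all add: vec_cols_def sample_mean_def x_def y_def)
    have "sample_cov Z n $ a $ b = (\<Sum>i<n. (x i - (\<Sum>i<n. x i) / real n) * (y i - (\<Sum>i<n. y i) / real n)) / real n"
      by (simp add: sample_cov_def outer_def linear_diff[OF linear_vec_cols] m) (simp add: x_def y_def)
    also have "(\<Sum>i<n. (x i - (\<Sum>i<n. x i) / real n) * (y i - (\<Sum>i<n. y i) / real n)) =
      (\<Sum>i<n. x i * y i) - (\<Sum>i<n. x i) * (\<Sum>i<n. y i) / real n"
      using n by (simp add: algebra_simps sum.distrib sum_subtractf sum_distrib_left[symmetric] sum_distrib_right[symmetric] sum_divide_distrib[symmetric])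
    finally show ?thesis
      using n by (simp add: outer_def m x_def[symmetric] y_def[symmetric] diff_divide_distrib)
  qed
  then show ?thesis by (simp add: vec_eq_iff)
qed

lemma norm_matrix_le_sum: "norm (A :: real^'n^'m) \<le> (\<Sum>i\<in>UNIV. \<Sum>j\<in>UNIV. \<bar>A $ i $ j\<bar>)"
proof -
  have "norm A \<le> (\<Sum>i\<in>UNIV. norm (A $ i))" unfolding norm_vec_def by (rule L2_set_le_sum) simp
  also have "\<dots> \<le> (\<Sum>i\<in>UNIV. \<Sum>j\<in>UNIV. \<bar>A $ i $ j\<bar>)" by (intro sum_mono norm_le_l1_cart)
  finally show ?thesis .
qed

section \<open>Mean and covariance of the quadratic forms\<close>

context spherical_moments
begin

lemma quad_measurable: "quad s t \<in> borel_measurable borel"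
  unfolding quad_eq[abs_def]
  by (intro borel_measurable_sum borel_measurable_times borel_measurable_const measurable_entry)

lemma norm_vec_cols: "norm (vec_cols Z) = norm (Z :: real^'q^'p)"
proof -
  have "(norm (vec_cols Z))\<^sup>2 = (norm Z)\<^sup>2"
    unfolding norm_matrix_sq power2_norm_eq_inner
    by (simp add: inner_vec_def vec_cols_def sum_UNIV_prod power2_eq_square[symmetric]) (rule sum.swap)
  then show ?thesis by simp
qed

lemma abs_quad_le: "\<bar>quad s t Z\<bar> \<le> norm s * norm t * (norm Z)\<^sup>2"
proof -
  have "\<bar>quad s t Z\<bar> \<le> norm (kronecker s t) * norm (outer (vec_cols Z))"
    unfolding quad_def by (rule Cauchy_Schwarz_ineq2)
  also have "\<dots> \<le> (norm s * norm t) * (norm Z)\<^sup>2"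
    using norm_outer_le[of "vec_cols Z"] by (intro mult_mono) (auto simp: norm_kronecker norm_vec_cols)
  finally show ?thesis .
qed

lemma integrable_quad_quad: "integrable F (\<lambda>Z. quad s t Z * quad s' t' Z)"
proof (rule Bochner_Integration.integrable_bound)
  show "integrable F (\<lambda>Z. (norm s * norm t) * (norm s' * norm t') * norm Z ^ 4)" using moment4 by simp
  show "(\<lambda>Z. quad s t Z * quad s' t' Z) \<in> borel_measurable F"
    by (intro measurable_F borel_measurable_times quad_measurable)
  have "\<bar>quad s t Z * quad s' t' Z\<bar> \<le> (norm s * norm t * (norm Z)\<^sup>2) * (norm s' * norm t' * (norm Z)\<^sup>2)" for Z
    unfolding abs_mult by (intro mult_mono abs_quad_le) auto
  then show "AE Z in F. norm (quad s t Z * quad s' t' Z) \<le> norm ((norm s * norm t) * (norm s' * norm t') * norm Z ^ 4)"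
    by (simp add: abs_mult power4_eq_xxxx power2_eq_square mult_ac)
qed

lemma integrable_quad: "integrable F (quad s t)"
  by (rule square_integrable_imp_integrable)
    (use integrable_quad_quad[of s t s t] in \<open>simp_all add: measurable_F quad_measurable power2_eq_square\<close>)

lemma integrable_2: "integrable F (\<lambda>Z. Z $ a $ i * Z $ b $ j)"
proof (rule square_integrable_imp_integrable)
  show "(\<lambda>Z. Z $ a $ i * Z $ b $ j) \<in> borel_measurable F" by (intro measurable_F borel_measurable_times measurable_entry)
  show "integrable F (\<lambda>Z. (Z $ a $ i * Z $ b $ j)\<^sup>2)"
    using integrable_4[of a i b j a i b j] by (simp add: power2_eq_square mult_ac)
qed

lemma integral_quad:
  assumes "trace s = 0" shows "(\<integral>Z. quad s t Z \<partial>F) = 0"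
proof -
  \<comment> \<open>Any position may stand here, because \<open>moment2_eq\<close> holds for every
    choice of it.\<close>
  define m where "m = (\<integral>Z. (Z $ undefined $ undefined)\<^sup>2 \<partial>F)"
  have "(\<integral>Z. quad s t Z \<partial>F) = (\<Sum>k1\<in>UNIV. \<Sum>k2\<in>UNIV. \<Sum>j1\<in>UNIV. \<Sum>j2\<in>UNIV. s $ k1 $ k2 * t $ j1 $ j2 * (\<integral>Z. Z $ j1 $ k1 * Z $ j2 $ k2 \<partial>F))"
    unfolding quad_eq by (simp only: Bochner_Integration.integral_sum Bochner_Integration.integrable_sum integrable_2
          integrable_mult_right integral_mult_right_zero)
  also have "\<dots> = (\<Sum>k1\<in>UNIV. \<Sum>k2\<in>UNIV. \<Sum>j1\<in>UNIV. \<Sum>j2\<in>UNIV. if j2 = j1 then if k2 = k1 then s $ k1 $ k2 * t $ j1 $ j2 * m else 0 else 0)"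
    by (intro sum.cong refl) (subst moment2_eq[of _ _ _ _ undefined undefined], simp add: m_def)
  also have "\<dots> = (\<Sum>k1\<in>UNIV. \<Sum>k2\<in>UNIV. if k2 = k1 then s $ k1 $ k2 * (\<Sum>j1\<in>UNIV. t $ j1 $ j1 * m) else 0)"
    by (intro sum.cong refl) (simp add: sum_distrib_left mult_ac)
  also have "\<dots> = trace s * (\<Sum>j1\<in>UNIV. t $ j1 $ j1 * m)"
    by (simp add: trace_def sum_distrib_right)
  finally show ?thesis using assms by simp
qed

text \<open>Transposition fixes both factors of a symmetric pair and negates both factors of an
  alternating one, so the formula of \<open>integral_quad_quad\<close> collapses to the two stated
  values. For one pair of each kind \<open>s\<close> and \<open>s'\<close> are orthogonal.\<close>

lemma integral_quad_basis:
  assumes j: "j1 \<noteq> j2" and k: "k1 \<noteq> k2"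
    and bq: "matrix_basis Sq Aq" and bp: "matrix_basis Sp Ap"
    and x: "x \<in> Sq \<times> Sp \<union> Aq \<times> Ap" "y \<in> Sq \<times> Sp \<union> Aq \<times> Ap"
  defines "\<alpha> \<equiv> \<integral>Z. (Z $ j1 $ k1)\<^sup>2 * (Z $ j2 $ k2)\<^sup>2 \<partial>F"
    and "\<beta> \<equiv> \<integral>Z. Z $ j1 $ k1 * Z $ j1 $ k2 * Z $ j2 $ k1 * Z $ j2 $ k2 \<partial>F"
  shows "(\<integral>Z. quad (fst x) (snd x) Z * quad (fst y) (snd y) Z \<partial>F) =
    (if x = y then if x \<in> Sq \<times> Sp then 2 * \<alpha> + 2 * \<beta> else 2 * \<alpha> - 2 * \<beta> else 0)"
proof -
  interpret Q: matrix_basis Sq Aq by (rule bq)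
  interpret P: matrix_basis Sp Ap by (rule bp)
  obtain s t s' t' where st: "x = (s, t)" "y = (s', t')" by (cases x, cases y)
  have tr: "trace s = 0" "trace t = 0" using x Q.trace_0 P.trace_0 by (auto simp: st)
  have main: "(\<integral>Z. quad s t Z * quad s' t' Z \<partial>F) =
    (s \<bullet> s') * ((t \<bullet> t') * \<alpha> + (t \<bullet> transpose t') * \<beta>) +
    (s \<bullet> transpose s') * ((t \<bullet> t') * \<beta> + (t \<bullet> transpose t') * \<alpha>)"
    unfolding \<alpha>_def \<beta>_def by (rule integral_quad_quad[OF j k tr])
  have sym: "transpose u = u" if "u \<in> Sq" for u using that Q.Sy(1) by (auto simp: traceless_symmetric_def)
  have sym': "transpose u = u" if "u \<in> Sp" for u using that P.Sy(1) by (auto simp: traceless_symmetric_def)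
  have alt: "transpose u = - u" if "u \<in> Aq" for u using that Q.Al(1) by (auto simp: alternating_def)
  have alt': "transpose u = - u" if "u \<in> Ap" for u using that P.Al(1) by (auto simp: alternating_def)
  consider "s \<in> Sq" "t \<in> Sp" "s' \<in> Sq" "t' \<in> Sp" | "s \<in> Aq" "t \<in> Ap" "s' \<in> Aq" "t' \<in> Ap"
    | "s \<in> Sq" "t \<in> Sp" "s' \<in> Aq" "t' \<in> Ap" | "s \<in> Aq" "t \<in> Ap" "s' \<in> Sq" "t' \<in> Sp"
    using x by (auto simp: st)
  then show ?thesis
  proof cases
    case 1
    have "s \<bullet> s' = (if s = s' then 1 else 0)" "t \<bullet> t' = (if t = t' then 1 else 0)"
      using 1 Q.Sy(2) P.Sy(2) by (auto simp: orthonormal_def)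
    then show ?thesis using 1 by (auto simp: st main sym sym')
  next
    case 2
    then have "s \<notin> Sq" using Q.disjoint by blast
    moreover have "s \<bullet> s' = (if s = s' then 1 else 0)" "t \<bullet> t' = (if t = t' then 1 else 0)"
      using 2 Q.Al(2) P.Al(2) by (auto simp: orthonormal_def)
    ultimately show ?thesis using 2 by (auto simp: st main alt alt')
  next
    case 3
    then have "s \<noteq> s'" "s \<bullet> s' = 0" using Q.disjoint Q.inner_Sy_Al by auto
    then show ?thesis using 3 by (simp add: st main alt)
  next
    case 4
    then have "s \<noteq> s'" "s \<bullet> s' = 0" using Q.disjoint Q.inner_Al_Sy by auto
    then show ?thesis using 4 by (simp add: st main sym)
  qed
qed

lemma integral_quad_sum_square:
  assumes j: "j1 \<noteq> j2" and k: "k1 \<noteq> k2"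
    and bq: "matrix_basis Sq Aq" and bp: "matrix_basis Sp Ap"
  defines "\<alpha> \<equiv> \<integral>Z. (Z $ j1 $ k1)\<^sup>2 * (Z $ j2 $ k2)\<^sup>2 \<partial>F"
    and "\<beta> \<equiv> \<integral>Z. Z $ j1 $ k1 * Z $ j1 $ k2 * Z $ j2 $ k1 * Z $ j2 $ k2 \<partial>F"
    and "J \<equiv> Sq \<times> Sp \<union> Aq \<times> Ap"
  shows "integrable F (\<lambda>Z. (\<Sum>x\<in>J. g x * quad (fst x) (snd x) Z)\<^sup>2)"
    "(\<integral>Z. (\<Sum>x\<in>J. g x * quad (fst x) (snd x) Z)\<^sup>2 \<partial>F) =
      (\<Sum>x\<in>J. (if x \<in> Sq \<times> Sp then 2 * \<alpha> + 2 * \<beta> else 2 * \<alpha> - 2 * \<beta>) * (g x)\<^sup>2)"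
proof -
  have fin: "finite J"
    using bq bp by (auto simp: J_def matrix_basis_def orthonormal_def)
  have sq: "(\<Sum>x\<in>J. g x * quad (fst x) (snd x) Z)\<^sup>2 =
    (\<Sum>x\<in>J. \<Sum>y\<in>J. (g x * g y) * (quad (fst x) (snd x) Z * quad (fst y) (snd y) Z))" for Z
    by (simp add: power2_eq_square sum_product mult_ac)
  show "integrable F (\<lambda>Z. (\<Sum>x\<in>J. g x * quad (fst x) (snd x) Z)\<^sup>2)"
    unfolding sq by (intro Bochner_Integration.integrable_sum integrable_mult_right integrable_quad_quad)
  have "(\<integral>Z. (\<Sum>x\<in>J. g x * quad (fst x) (snd x) Z)\<^sup>2 \<partial>F) =
    (\<Sum>x\<in>J. \<Sum>y\<in>J. (g x * g y) * (\<integral>Z. quad (fst x) (snd x) Z * quad (fst y) (snd y) Z \<partial>F))"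
    unfolding sq by (simp only: Bochner_Integration.integral_sum Bochner_Integration.integrable_sum integrable_quad_quad
          integrable_mult_right integral_mult_right_zero)
  also have "\<dots> = (\<Sum>x\<in>J. \<Sum>y\<in>J. if y = x then (if x \<in> Sq \<times> Sp then 2 * \<alpha> + 2 * \<beta> else 2 * \<alpha> - 2 * \<beta>) * (g x)\<^sup>2 else 0)"
  proof (intro sum.cong refl)
    fix x y assume "x \<in> J" "y \<in> J"
    then show "(g x * g y) * (\<integral>Z. quad (fst x) (snd x) Z * quad (fst y) (snd y) Z \<partial>F) =
      (if y = x then (if x \<in> Sq \<times> Sp then 2 * \<alpha> + 2 * \<beta> else 2 * \<alpha> - 2 * \<beta>) * (g x)\<^sup>2 else 0)"
      using integral_quad_basis[OF j k bq bp, of x y] unfolding J_def \<alpha>_def \<beta>_def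
      by (cases "y = x") (simp_all add: power2_eq_square mult.commute)
  qed
  also have "\<dots> = (\<Sum>x\<in>J. (if x \<in> Sq \<times> Sp then 2 * \<alpha> + 2 * \<beta> else 2 * \<alpha> - 2 * \<beta>) * (g x)\<^sup>2)"
    using fin by (simp add: sum.delta)
  finally show "(\<integral>Z. (\<Sum>x\<in>J. g x * quad (fst x) (snd x) Z)\<^sup>2 \<partial>F) =
      (\<Sum>x\<in>J. (if x \<in> Sq \<times> Sp then 2 * \<alpha> + 2 * \<beta> else 2 * \<alpha> - 2 * \<beta>) * (g x)\<^sup>2)" .
qed

text \<open>Otherwise the entry would vanish almost surely, but a coordinate hyperplane has Lebesgue
  measure zero.\<close>

lemma second_moment_pos:
  assumes "absolutely_continuous lborel F"
  shows "0 < (\<integral>Z. (Z $ j $ k)\<^sup>2 \<partial>F)"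
proof (rule ccontr)
  assume "\<not> 0 < (\<integral>Z. (Z $ j $ k)\<^sup>2 \<partial>F)"
  moreover have "0 \<le> (\<integral>Z. (Z $ j $ k)\<^sup>2 \<partial>F)" by simp
  ultimately have "(\<integral>Z. (Z $ j $ k)\<^sup>2 \<partial>F) = 0" by linarith
  then have "AE Z in F. (Z $ j $ k)\<^sup>2 = 0"
    using integrable_2[of j k j k] by (subst (asm) integral_nonneg_eq_0_iff_AE) (auto simp: power2_eq_square)
  moreover have "AE Z in F. Z $ j $ k \<noteq> 0"
  proof -
    have lin: "linear (\<lambda>Z :: real^'q^'p. Z $ j $ k)" by (rule linearI) simp_all
    have "{Z :: real^'q^'p. (Z - 0) $ j $ k = 0} \<in> null_sets lborel"
      by (rule linear_zero_set_null[OF lin, of "\<chi> j k. 1"]) simp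
    then have "{Z :: real^'q^'p. Z $ j $ k = 0} \<in> null_sets F" using assms by (auto simp: absolutely_continuous_def)
    then show ?thesis by (rule AE_I') auto
  qed
  ultimately have "AE Z in F. False" by eventually_elim simp
  then show False by simp
qed

end

context spherical_moments
begin

text \<open>The sample means of these variables control \<open>S - I\<close>.\<close>

definition entry_power :: "('q \<times> 'p) \<times> ('q \<times> 'p) option \<Rightarrow> real^'q^'p \<Rightarrow> real" where
  "entry_power x Z = (case snd x of None \<Rightarrow> vec_cols Z $ fst x
     | Some b \<Rightarrow> vec_cols Z $ fst x * vec_cols Z $ b - (\<integral>Z. vec_cols Z $ fst x * vec_cols Z $ b \<partial>F))"

lemma entry_power_measurable: "entry_power x \<in> borel_measurable borel"
  unfolding entry_power_def vec_cols_def
  by (cases "snd x") (auto intro!: borel_measurable_diff borel_measurable_times measurable_entry)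

lemma integral_entry_power: "(\<integral>Z. entry_power x Z \<partial>F) = 0"
  using prob_space
  by (cases "snd x") (simp_all add: entry_power_def vec_cols_def moment1 integrable_2)

lemma integrable_entry_power_square: "integrable F (\<lambda>Z. (entry_power x Z)\<^sup>2)"
proof (cases "snd x")
  case None
  then show ?thesis by (simp add: entry_power_def vec_cols_def power2_eq_square integrable_2)
next
  case (Some b)
  let ?z = "\<lambda>Z :: real^'q^'p. Z $ snd (fst x) $ fst (fst x)" and ?w = "\<lambda>Z :: real^'q^'p. Z $ snd b $ fst b"
  define m where "m = (\<integral>Z. ?z Z * ?w Z \<partial>F)"
  have ep: "entry_power x Z = ?z Z * ?w Z - m" for Z
    by (simp add: entry_power_def Some m_def vec_cols_def)
  have "(entry_power x Z)\<^sup>2 = ?z Z * ?w Z * ?z Z * ?w Z - 2 * m * (?z Z * ?w Z) + m\<^sup>2" for Z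
    unfolding ep by (simp add: power2_eq_square algebra_simps)
  then show ?thesis
    by (simp only:) (intro Bochner_Integration.integrable_add Bochner_Integration.integrable_diff integrable_mult_right
        integrable_2 integrable_4 integrable_const)
qed

end

section \<open>The limit law for a standardized sample\<close>

lemma sample_cov_measurable:
  fixes Z :: "nat \<Rightarrow> 'a \<Rightarrow> real^'q^'p"
  assumes Z [measurable]: "\<And>i. Z i \<in> borel_measurable P"
  shows "(\<lambda>\<omega>. sample_cov (\<lambda>i. Z i \<omega>) n) \<in> borel_measurable P"
proof -
  have v: "(\<lambda>z :: real^'q^'p. vec_cols z) \<in> borel_measurable borel"
    by (intro borel_measurable_continuous_onI linear_continuous_on linear_conv_bounded_linear[THEN iffD1] linear_vec_cols)
  have o: "(\<lambda>v :: real^('q \<times> 'p). outer v) \<in> borel_measurable borel"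
    unfolding outer_def by (intro borel_measurable_continuous_onI continuous_on_vec_lambda2 continuous_intros)
  have mean: "(\<lambda>\<omega>. sample_mean (\<lambda>i. Z i \<omega>) n) \<in> borel_measurable P" unfolding sample_mean_def by measurable
  have "(\<lambda>\<omega>. outer (vec_cols (Z i \<omega> - sample_mean (\<lambda>i. Z i \<omega>) n))) \<in> borel_measurable P" for i
    by (intro measurable_compose[OF _ o] measurable_compose[OF _ v] borel_measurable_diff Z mean)
  then show ?thesis unfolding sample_cov_def by measurable
qed

lemma tendsto_real_powr_neg: "0 < a \<Longrightarrow> (\<lambda>n. real n powr (- a)) \<longlonglongrightarrow> 0"
  by (rule tendsto_neg_powr) (auto simp: filterlim_real_sequentially)

theorem fitted_stat_limit:
  fixes Z :: "nat \<Rightarrow> 'a \<Rightarrow> real^'q^'p" and F :: "(real^'q^'p) measure" and j1 j2 :: 'p and k1 k2 :: 'q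
  assumes "prob_space P" and "spherical_moments F" and ac: "absolutely_continuous lborel F"
    and indep: "prob_space.indep_vars P (\<lambda>_. borel) Z UNIV" and distr: "\<And>i. distr P borel (Z i) = F"
    and card: "CARD('p) \<ge> 2" "CARD('q) \<ge> 2" and j: "j1 \<noteq> j2" and k: "k1 \<noteq> k2"
  defines "m11 \<equiv> (\<integral>Z. (Z $ j1 $ k1)\<^sup>2 \<partial>F)"
    and "m1122 \<equiv> (\<integral>Z. (Z $ j1 $ k1)\<^sup>2 * (Z $ j2 $ k2)\<^sup>2 \<partial>F)"
    and "m1112 \<equiv> (\<integral>Z. (Z $ j1 $ k1)\<^sup>2 * (Z $ j1 $ k2)\<^sup>2 \<partial>F)"
    and "d1 \<equiv> (CARD('p) + 2) * (CARD('p) - 1) * (CARD('q) + 2) * (CARD('q) - 1) div 4"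
    and "d2 \<equiv> CARD('p) * CARD('q) * (CARD('p) - 1) * (CARD('q) - 1) div 4"
  shows "weak_conv_m (\<lambda>n. distr P borel (\<lambda>\<omega>. real n * fitted_stat ((1 / m11) *\<^sub>R sample_cov (\<lambda>i. Z i \<omega>) n)))
    (distr (chi_square d1 \<Otimes>\<^sub>M chi_square d2) borel
       (\<lambda>(u, v). (m1122 + m1112) / m11\<^sup>2 * u + (3 * m1122 - m1112) / m11\<^sup>2 * v))"
proof -
  interpret P: prob_space P by fact
  interpret F: spherical_moments F by fact
  have rv [measurable]: "Z i \<in> measurable P borel" for i using indep unfolding P.indep_vars_def2 by simp
  have integral_Z: "(\<integral>\<omega>. f (Z i \<omega>) \<partial>P) = (\<integral>z. f z \<partial>F)" if "f \<in> borel_measurable borel" for f :: "real^'q^'p \<Rightarrow> real" and i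
    unfolding distr[of i, symmetric] by (rule integral_distr[symmetric, OF rv that])
  have integrable_Z: "integrable P (\<lambda>\<omega>. f (Z i \<omega>))" if "f \<in> borel_measurable borel" "integrable F f" for f :: "real^'q^'p \<Rightarrow> real" and i
    using that(2) unfolding distr[of i, symmetric] by (subst (asm) integrable_distr_eq[OF rv that(1)])
  have indep_Z: "P.indep_vars (\<lambda>_. borel) (\<lambda>i \<omega>. f (Z i \<omega>)) UNIV" if "f \<in> borel_measurable borel" for f :: "real^'q^'p \<Rightarrow> real"
    by (rule P.indep_vars_compose2[OF indep]) (simp add: that)
  have distr_Z: "distr P borel (\<lambda>\<omega>. f (Z i \<omega>)) = distr F borel f" if "f \<in> borel_measurable borel" for f :: "real^'q^'p \<Rightarrow> real" and i
    unfolding distr[of i, symmetric] using distr_distr[OF that rv[of i]] by (simp add: comp_def)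
  have m11: "0 < m11" unfolding m11_def by (rule F.second_moment_pos[OF ac])
  define \<beta> where "\<beta> = (\<integral>Z. Z $ j1 $ k1 * Z $ j1 $ k2 * Z $ j2 $ k1 * Z $ j2 $ k2 \<partial>F)"
  have m1112: "m1112 = m1122 + 2 * \<beta>"
    unfolding m1112_def m1122_def \<beta>_def by (rule F.moment4_values[OF j k])
  obtain Sq Aq :: "(real^'q^'q) set" where bq: "matrix_basis Sq Aq" using matrix_basis_exists by blast
  obtain Sp Ap :: "(real^'p^'p) set" where bp: "matrix_basis Sp Ap" using matrix_basis_exists by blast
  interpret Q: matrix_basis Sq Aq by (rule bq)
  interpret B: matrix_basis Sp Ap by (rule bp)
  define J where "J = Sq \<times> Sp \<union> Aq \<times> Ap"
  have finJ: "finite (Sq \<times> Sp)" "finite (Aq \<times> Ap)" "finite J"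
    using Q.Sy(2) Q.Al(2) B.Sy(2) B.Al(2) by (auto simp: J_def orthonormal_def)
  have disjJ: "(Sq \<times> Sp) \<inter> (Aq \<times> Ap) = {}" using Q.disjoint by blast
  have trJ: "trace (fst x) = 0" "trace (snd x) = 0" if "x \<in> J" for x
    using that Q.trace_0 B.trace_0 by (auto simp: J_def)
  have nJ: "norm (kronecker (fst x) (snd x)) = 1" if "x \<in> J" for x
    using that orthonormal_norm[OF Q.Sy(2)] orthonormal_norm[OF Q.Al(2)] orthonormal_norm[OF B.Sy(2)] orthonormal_norm[OF B.Al(2)]
    by (auto simp: J_def norm_kronecker)
  have card1: "card (Sq \<times> Sp) = d1"
  proof -
    have "4 * card (Sq \<times> Sp) = (2 * card Sq) * (2 * card Sp)" by (simp add: card_cartesian_product)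
    then have "4 * card (Sq \<times> Sp) = (CARD('p) + 2) * (CARD('p) - 1) * (CARD('q) + 2) * (CARD('q) - 1)"
      unfolding Q.Sy(3) B.Sy(3) by (simp only: mult_ac)
    then show ?thesis unfolding d1_def by (metis nonzero_mult_div_cancel_left zero_neq_numeral)
  qed
  have card2: "card (Aq \<times> Ap) = d2"
  proof -
    have "4 * card (Aq \<times> Ap) = (2 * card Aq) * (2 * card Ap)" by (simp add: card_cartesian_product)
    then have "4 * card (Aq \<times> Ap) = CARD('p) * CARD('q) * (CARD('p) - 1) * (CARD('q) - 1)"
      unfolding Q.Al(3) B.Al(3) by (simp only: mult_ac)
    then show ?thesis unfolding d2_def by (metis nonzero_mult_div_cancel_left zero_neq_numeral)
  qed
  define c1 where "c1 = (m1122 + m1112) / m11\<^sup>2"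
  define c2 where "c2 = (3 * m1122 - m1112) / m11\<^sup>2"
  have c1: "c1 = (2 * m1122 + 2 * \<beta>) / m11\<^sup>2" and c2: "c2 = (2 * m1122 - 2 * \<beta>) / m11\<^sup>2"
    by (simp_all add: c1_def c2_def m1112)
  \<comment> \<open>Up to the factor \<open>m11^2\<close> the numbers \<open>c1\<close> and
    \<open>c2\<close> are second moments of the forms of one basis pair of each kind; both kinds
    exist because the dimensions are at least 2.\<close>
  have nonneg: "0 \<le> c1" "0 \<le> c2"
  proof -
    have "0 < card Sq" "0 < card Sp" "0 < card Aq" "0 < card Ap"
      using Q.Sy(3) B.Sy(3) Q.Al(3) B.Al(3) card
      by (auto intro!: Nat.gr0I)
    then obtain s t a b where "s \<in> Sq" "t \<in> Sp" "a \<in> Aq" "b \<in> Ap" by (metis card_gt_0_iff ex_in_conv)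
    then have "s \<in> Sq" "t \<in> Sp" "a \<in> Aq" "b \<in> Ap" "a \<notin> Sq" using Q.disjoint by auto
    then have "2 * m1122 + 2 * \<beta> = (\<integral>Z. F.quad s t Z * F.quad s t Z \<partial>F)"
      and "2 * m1122 - 2 * \<beta> = (\<integral>Z. F.quad a b Z * F.quad a b Z \<partial>F)"
      using F.integral_quad_basis[OF j k bq bp, of "(s, t)" "(s, t)"] F.integral_quad_basis[OF j k bq bp, of "(a, b)" "(a, b)"]
      by (simp_all add: m1122_def \<beta>_def)
    then show "0 \<le> c1" "0 \<le> c2" unfolding c1 c2 by simp_all
  qed

  \<comment> \<open>\<open>T\<close> will be the scaled statistic and \<open>U\<close> its
    approximation by squares of the normalized sums \<open>W\<close>. The law of \<open>U\<close> is
    governed by the central limit theorem, and \<open>T - U\<close> is bounded outside the rare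
    events \<open>E\<close>.\<close>
  define S where "S n \<omega> = (1 / m11) *\<^sub>R sample_cov (\<lambda>i. Z i \<omega>) n" for n \<omega>
  define T where "T n \<omega> = real n * fitted_stat (S n \<omega>)" for n \<omega>
  define W where "W n x \<omega> = (\<Sum>i<n. F.quad (fst x) (snd x) (Z i \<omega>) / m11) / sqrt (real n)" for n x \<omega>
  define U where "U n \<omega> = (\<Sum>x\<in>J. (W n x \<omega>)\<^sup>2)" for n \<omega>
  have quadm [measurable]: "(\<lambda>\<omega>. F.quad s t (Z i \<omega>)) \<in> borel_measurable P" for s t i
    by (rule measurable_compose[OF rv F.quad_measurable])
  have Wm [measurable]: "W n x \<in> borel_measurable P" for n x unfolding W_def by measurable
  have Um: "U n \<in> borel_measurable P" for n unfolding U_def by measurable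
  have Sm: "(\<lambda>\<omega>. S n \<omega>) \<in> borel_measurable P" for n
    unfolding S_def using sample_cov_measurable[of Z P n] rv by measurable
  have Tm: "T n \<in> borel_measurable P" for n
    unfolding T_def by (intro borel_measurable_times borel_measurable_const measurable_compose[OF Sm fitted_stat_measurable])
  have T0: "0 \<le> T n \<omega>" for n \<omega> by (simp add: T_def fitted_stat_nonneg)
  have U0: "0 \<le> U n \<omega>" for n \<omega> by (auto simp: U_def intro!: sum_nonneg)

  have char_lim: "(\<lambda>n. \<integral>\<omega>. iexp (\<Sum>x\<in>J. g x * W n x \<omega>) \<partial>P) \<longlonglongrightarrow>
       complex_of_real (exp (- (\<Sum>x\<in>J. (if x \<in> Sq \<times> Sp then c1 else c2) * (g x)\<^sup>2) / 2))" for g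
  proof -
    define f where "f z = (\<Sum>x\<in>J. (g x / m11) * F.quad (fst x) (snd x) z)" for z
    have f: "f \<in> borel_measurable borel" unfolding f_def using F.quad_measurable by measurable
    note sq = F.integral_quad_sum_square[OF j k bq bp, folded J_def m1122_def \<beta>_def, of "\<lambda>x. g x / m11", folded f_def]
    have mean: "(\<integral>z. f z \<partial>F) = 0"
      unfolding f_def by (simp add: F.integrable_quad F.integral_quad trJ)
    have var: "(\<integral>z. (f z)\<^sup>2 \<partial>F) = (\<Sum>x\<in>J. (if x \<in> Sq \<times> Sp then c1 else c2) * (g x)\<^sup>2)"
      unfolding sq(2) by (intro sum.cong refl) (simp add: c1 c2 power_divide)
    have f2: "(\<lambda>z. (f z)\<^sup>2) \<in> borel_measurable borel" using f by measurable
    have "(\<lambda>n. \<integral>\<omega>. iexp ((\<Sum>i<n. f (Z i \<omega>)) / sqrt (real n)) \<partial>P) \<longlonglongrightarrow>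
       complex_of_real (exp (- (\<Sum>x\<in>J. (if x \<in> Sq \<times> Sp then c1 else c2) * (g x)\<^sup>2) / 2))"
      by (rule P.clt_char[OF indep_Z[OF f] distr_Z[OF f]])
        (simp_all only: integral_Z[OF f] mean integral_Z[OF f2] var integrable_Z[OF f2 sq(1)])
    moreover have "(\<Sum>x\<in>J. g x * W n x \<omega>) = (\<Sum>i<n. f (Z i \<omega>)) / sqrt (real n)" for n \<omega>
      unfolding W_def f_def
      by (subst sum.swap) (simp add: sum_distrib_left sum_divide_distrib)
    ultimately show ?thesis by simp
  qed

  define r where "r n = real n powr (- 2 / 5)" for n
  define E where "E n = (\<Union>x. {\<omega> \<in> space P. r n \<le> \<bar>(\<Sum>i<n. F.entry_power x (Z i \<omega>)) / real n\<bar>})" for n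
  have em [measurable]: "(\<lambda>\<omega>. F.entry_power x (Z i \<omega>)) \<in> borel_measurable P" for x i
    by (rule measurable_compose[OF rv F.entry_power_measurable])
  have Em: "E n \<in> sets P" for n unfolding E_def by (intro sets.finite_UN) measurable
  have PE: "(\<lambda>n. P.prob (E n)) \<longlonglongrightarrow> 0"
  proof (rule tendsto_sandwich[of "\<lambda>_. 0" _ _ "\<lambda>n. \<Sum>x\<in>UNIV. P.prob {\<omega> \<in> space P. r n \<le> \<bar>(\<Sum>i<n. F.entry_power x (Z i \<omega>)) / real n\<bar>}"])
    show "\<forall>\<^sub>F n in sequentially. P.prob (E n) \<le> (\<Sum>x\<in>UNIV. P.prob {\<omega> \<in> space P. r n \<le> \<bar>(\<Sum>i<n. F.entry_power x (Z i \<omega>)) / real n\<bar>})"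
      unfolding E_def by (intro always_eventually allI P.finite_measure_subadditive_finite) (auto intro!: image_subsetI)
    have "(\<lambda>n. P.prob {\<omega> \<in> space P. r n \<le> \<bar>(\<Sum>i<n. F.entry_power x (Z i \<omega>)) / real n\<bar>}) \<longlonglongrightarrow> 0" for x
    proof -
      have e2: "(\<lambda>z. (F.entry_power x z)\<^sup>2) \<in> borel_measurable borel" using F.entry_power_measurable by measurable
      show ?thesis
        unfolding r_def
        by (rule P.prob_mean_large[OF indep_Z[OF F.entry_power_measurable]])
          (simp_all only: integral_Z[OF F.entry_power_measurable] F.integral_entry_power
             integral_Z[OF e2] integrable_Z[OF e2 F.integrable_entry_power_square])
    qed
    then show "(\<lambda>n. \<Sum>x\<in>UNIV. P.prob {\<omega> \<in> space P. r n \<le> \<bar>(\<Sum>i<n. F.entry_power x (Z i \<omega>)) / real n\<bar>}) \<longlonglongrightarrow> 0" by (intro tendsto_null_sum)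
  qed auto

  obtain C \<delta> where C: "0 \<le> C" "0 < \<delta>" and expand:
    "\<And>(S :: real^('q \<times> 'p)^('q \<times> 'p)) A B. spd S \<Longrightarrow> separable_fit S A B \<Longrightarrow> norm (S - mat 1) \<le> \<delta> \<Longrightarrow>
      \<bar>separability_stat S (kronecker B A) - (\<Sum>(s, t)\<in>J. (kronecker s t \<bullet> (S - mat 1))\<^sup>2)\<bar> \<le> C * norm (S - mat 1) ^ 3"
    using separability_stat_expansion[OF bq bp] unfolding J_def by blast
  define N where "N = real CARD('q \<times> 'p)"
  \<comment> \<open>The 2 counts the deviation \<open>H\<close> of the second moments and the outer
    product of the mean, each of norm at most \<open>N^2 * r n\<close>; division by
    \<open>m11\<close> is the standardization.\<close>
  define c where "c = 2 * N\<^sup>2 / m11"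
  have N0: "0 \<le> N" by (simp add: N_def)
  have c0: "0 \<le> c" using m11 by (simp add: c_def)
  have r_lim: "r \<longlonglongrightarrow> 0" using tendsto_real_powr_neg[of "2 / 5"] by (simp add: r_def[abs_def])
  \<comment> \<open>From here on \<open>c * r n\<close> is at most \<open>\<delta>\<close>, so that
    the expansion applies, and at most 1/2, so that \<open>S n \<omega>\<close> is positive
    definite.\<close>
  have "\<forall>\<^sub>F n in sequentially. r n < min 1 (min \<delta> (1 / 2) / (c + 1))"
    using r_lim C(2) c0 by (intro order_tendstoD(2)) auto
  then have close: "\<forall>\<^sub>F n in sequentially. \<forall>\<omega>\<in>space P - E n.
      \<bar>T n \<omega> - U n \<omega>\<bar> \<le> (C * c^3 + real (card J) * (3 * c\<^sup>2)) * real n powr (- 1 / 5)"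
    using eventually_gt_at_top[of 0]
  proof eventually_elim
    case (elim n)
    show ?case
    proof
      fix \<omega> assume \<omega>: "\<omega> \<in> space P - E n"
      have n: "0 < n" by (rule elim(2))
      have r0: "0 \<le> r n" and r1: "r n \<le> 1" using elim(1) by (auto simp: r_def)
      have "r n * (c + 1) \<le> min \<delta> (1 / 2)" using elim(1) c0 by (simp add: less_divide_eq)
      then have cr: "c * r n \<le> \<delta>" "c * r n \<le> 1 / 2" using r0 by (auto simp: algebra_simps)
      have ent: "\<bar>(\<Sum>i<n. F.entry_power x (Z i \<omega>)) / real n\<bar> \<le> r n" for x
      proof -
        have "\<not> r n \<le> \<bar>(\<Sum>i<n. F.entry_power x (Z i \<omega>)) / real n\<bar>" using \<omega> unfolding E_def by blast
        then show ?thesis by linarith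
      qed
      define \<mu> where "\<mu> = vec_cols (sample_mean (\<lambda>i. Z i \<omega>) n)"
      define H where "H = (1 / real n) *\<^sub>R (\<Sum>i<n. outer (vec_cols (Z i \<omega>))) - m11 *\<^sub>R mat 1"
      have mua: "\<mu> $ a = (\<Sum>i<n. F.entry_power (a, None) (Z i \<omega>)) / real n" for a
        by (simp add: \<mu>_def F.entry_power_def vec_cols_def sample_mean_def)
      have "norm \<mu> \<le> (\<Sum>a\<in>UNIV. \<bar>\<mu> $ a\<bar>)" by (rule norm_le_l1_cart)
      also have "\<dots> \<le> (\<Sum>a\<in>(UNIV :: ('q \<times> 'p) set). r n)" by (rule sum_mono) (simp only: mua ent)
      finally have mu: "norm \<mu> \<le> N * r n" by (simp add: N_def)
      have mab: "(\<integral>Z. vec_cols Z $ a * vec_cols Z $ b \<partial>F) = (if a = b then m11 else 0)" for a b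
        using F.moment2_eq[of "snd a" "fst a" "snd b" "fst b" j1 k1]
        by (auto simp: vec_cols_def m11_def prod_eq_iff)
      have Hab: "H $ a $ b = (\<Sum>i<n. F.entry_power (a, Some b) (Z i \<omega>)) / real n" for a b
        using n by (simp add: H_def F.entry_power_def mab outer_def mat_def sum_subtractf diff_divide_distrib)
      have "norm H \<le> (\<Sum>a\<in>UNIV. \<Sum>b\<in>UNIV. \<bar>H $ a $ b\<bar>)" by (rule norm_matrix_le_sum)
      also have "\<dots> \<le> (\<Sum>a\<in>(UNIV :: ('q \<times> 'p) set). \<Sum>b\<in>(UNIV :: ('q \<times> 'p) set). r n)"
        by (intro sum_mono) (simp only: Hab ent)
      finally have Hn: "norm H \<le> N\<^sup>2 * r n" by (simp add: N_def power2_eq_square)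
      have on: "norm (outer \<mu>) \<le> N\<^sup>2 * (r n)\<^sup>2"
        using norm_outer_le[of \<mu>] power_mono[OF mu norm_ge_zero, of 2] by (simp add: power_mult_distrib)
      have SH: "S n \<omega> - mat 1 = (1 / m11) *\<^sub>R (H - outer \<mu>)"
        using m11 n by (simp add: S_def sample_cov_expand H_def \<mu>_def scaleR_diff_right)
      have r2: "(r n)\<^sup>2 \<le> r n" using r0 r1 by (simp add: power2_eq_square mult_left_le)
      have Sn: "norm (S n \<omega> - mat 1) \<le> c * r n"
      proof -
        have "norm (H - outer \<mu>) \<le> N\<^sup>2 * r n + N\<^sup>2 * (r n)\<^sup>2" using norm_triangle_ineq4[of H "outer \<mu>"] Hn on by linarith
        also have "\<dots> \<le> N\<^sup>2 * r n + N\<^sup>2 * r n" using r2 by (intro add_left_mono mult_left_mono) auto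
        finally have "norm (H - outer \<mu>) / m11 \<le> (2 * N\<^sup>2 * r n) / m11"
          using m11 by (intro divide_right_mono) (auto simp: mult_ac)
        then show ?thesis unfolding SH using m11 by (simp add: c_def)
      qed
      have "transpose (S n \<omega>) = S n \<omega>"
        by (simp add: S_def sample_cov_def transpose_scalar linear_sum[OF bounded_linear.linear[OF bounded_linear_transpose]])
      then have spd: "spd (S n \<omega>)" using Sn cr by (intro spd_near_mat_1) auto
      obtain A B where fit: "separable_fit (S n \<omega>) A B" using separable_fit_exists[OF spd] by blast
      have "\<bar>fitted_stat (S n \<omega>) - (\<Sum>(s, t)\<in>J. (kronecker s t \<bullet> (S n \<omega> - mat 1))\<^sup>2)\<bar> \<le> C * norm (S n \<omega> - mat 1) ^ 3"
        unfolding fitted_stat_eq[OF spd fit] using Sn cr by (intro expand[OF spd fit]) auto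
      also have "\<dots> \<le> C * (c * r n) ^ 3" using C Sn by (intro mult_left_mono power_mono) auto
      finally have e1: "\<bar>fitted_stat (S n \<omega>) - (\<Sum>x\<in>J. (kronecker (fst x) (snd x) \<bullet> (S n \<omega> - mat 1))\<^sup>2)\<bar> \<le> C * (c * r n) ^ 3"
        by (simp add: case_prod_beta)
      define u where "u x = (\<Sum>i<n. F.quad (fst x) (snd x) (Z i \<omega>) / m11) / real n" for x
      \<comment> \<open>The coordinate of \<open>S - I\<close> differs from \<open>u x\<close> by
        the contribution \<open>v\<close> of the mean, which is of order \<open>(r n)^2\<close>;
        hence the squares differ by order \<open>(r n)^3\<close>.\<close>
      have bnd: "\<bar>(kronecker (fst x) (snd x) \<bullet> (S n \<omega> - mat 1))\<^sup>2 - (u x)\<^sup>2\<bar> \<le> 3 * c\<^sup>2 * (r n)^3" if x: "x \<in> J" for x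
      proof -
        let ?K = "kronecker (fst x) (snd x)"
        have "?K \<bullet> mat 1 = 0"
          using inner_kronecker[of "fst x" "snd x" "mat 1" "mat 1"] trJ[OF x] by (simp add: inner_mat_1)
        then have uH: "u x = (?K \<bullet> H) / m11"
          by (simp add: u_def H_def inner_diff_right inner_sum_right F.quad_def sum_divide_distrib mult.commute)
        define v where "v = (?K \<bullet> outer \<mu>) / m11"
        have KS: "?K \<bullet> (S n \<omega> - mat 1) = u x - v"
          unfolding SH uH v_def by (simp add: inner_diff_right diff_divide_distrib)
        have N2c: "N\<^sup>2 / m11 \<le> c" using m11 by (simp add: c_def divide_right_mono)
        have "\<bar>?K \<bullet> H\<bar> \<le> N\<^sup>2 * r n" using Cauchy_Schwarz_ineq2[of ?K H] Hn by (simp add: nJ[OF x])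
        then have "\<bar>u x\<bar> \<le> N\<^sup>2 * r n / m11" unfolding uH using m11 by (simp add: divide_right_mono)
        also have "\<dots> \<le> c * r n" using mult_right_mono[OF N2c r0] by simp
        finally have ux: "\<bar>u x\<bar> \<le> c * r n" .
        have "\<bar>?K \<bullet> outer \<mu>\<bar> \<le> N\<^sup>2 * (r n)\<^sup>2" using Cauchy_Schwarz_ineq2[of ?K "outer \<mu>"] on by (simp add: nJ[OF x])
        then have "\<bar>v\<bar> \<le> N\<^sup>2 * (r n)\<^sup>2 / m11" unfolding v_def using m11 by (simp add: divide_right_mono)
        also have "\<dots> \<le> c * (r n)\<^sup>2" using mult_right_mono[OF N2c, of "(r n)\<^sup>2"] by simp
        finally have vx: "\<bar>v\<bar> \<le> c * (r n)\<^sup>2" .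
        have "\<bar>(u x - v)\<^sup>2 - (u x)\<^sup>2\<bar> = \<bar>v * v - 2 * (u x * v)\<bar>" by (simp add: power2_eq_square algebra_simps)
        also have "\<dots> \<le> \<bar>v\<bar> * \<bar>v\<bar> + 2 * (\<bar>u x\<bar> * \<bar>v\<bar>)"
          by (rule order_trans[OF abs_triangle_ineq4]) (simp add: abs_mult)
        also have "\<dots> \<le> (c * (r n)\<^sup>2) * (c * (r n)\<^sup>2) + 2 * ((c * r n) * (c * (r n)\<^sup>2))"
          using ux vx c0 r0 by (intro add_mono mult_left_mono mult_mono) auto
        also have "\<dots> = c\<^sup>2 * ((r n)\<^sup>2 * (r n)\<^sup>2) + 2 * c\<^sup>2 * (r n)^3" by (simp add: power2_eq_square power3_eq_cube)
        also have "(r n)\<^sup>2 * (r n)\<^sup>2 \<le> r n * (r n)\<^sup>2" using r2 by (intro mult_right_mono) auto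
        also have "r n * (r n)\<^sup>2 = (r n)^3" by (simp add: power2_eq_square power3_eq_cube)
        finally show ?thesis unfolding KS by (simp add: mult_left_mono)
      qed
      have "\<bar>(\<Sum>x\<in>J. (kronecker (fst x) (snd x) \<bullet> (S n \<omega> - mat 1))\<^sup>2) - (\<Sum>x\<in>J. (u x)\<^sup>2)\<bar> \<le> (\<Sum>x\<in>J. 3 * c\<^sup>2 * (r n)^3)"
        unfolding sum_subtractf[symmetric] by (rule order_trans[OF sum_abs], rule sum_mono, rule bnd)
      then have e2: "\<bar>(\<Sum>x\<in>J. (kronecker (fst x) (snd x) \<bullet> (S n \<omega> - mat 1))\<^sup>2) - (\<Sum>x\<in>J. (u x)\<^sup>2)\<bar> \<le> real (card J) * (3 * c\<^sup>2 * (r n)^3)"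
        by simp
      have Uu: "U n \<omega> = real n * (\<Sum>x\<in>J. (u x)\<^sup>2)"
        unfolding U_def W_def u_def sum_distrib_left using n
        by (intro sum.cong refl) (simp add: power_divide power2_eq_square)
      have "\<bar>fitted_stat (S n \<omega>) - (\<Sum>x\<in>J. (u x)\<^sup>2)\<bar> \<le> C * (c * r n) ^ 3 + real (card J) * (3 * c\<^sup>2 * (r n)^3)"
        using e1 e2 by linarith
      also have "\<dots> = (C * c^3 + real (card J) * (3 * c\<^sup>2)) * (r n)^3" by (simp add: power_mult_distrib algebra_simps)
      finally have "real n * \<bar>fitted_stat (S n \<omega>) - (\<Sum>x\<in>J. (u x)\<^sup>2)\<bar> \<le> real n * ((C * c^3 + real (card J) * (3 * c\<^sup>2)) * (r n)^3)"
        by (rule mult_left_mono) simp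
      moreover have "real n * \<bar>fitted_stat (S n \<omega>) - (\<Sum>x\<in>J. (u x)\<^sup>2)\<bar> = \<bar>T n \<omega> - U n \<omega>\<bar>"
        by (simp add: T_def Uu right_diff_distrib[symmetric] abs_mult)
      moreover have "real n * (r n)^3 = real n powr (- 1 / 5)"
      proof -
        have "(r n)^3 = real n powr (- 6 / 5)"
          using n by (simp add: r_def powr_powr powr_realpow[symmetric] del: powr_realpow)
        then show ?thesis using n powr_add[of "real n" 1 "- 6 / 5"] by simp
      qed
      ultimately show "\<bar>T n \<omega> - U n \<omega>\<bar> \<le> (C * c^3 + real (card J) * (3 * c\<^sup>2)) * real n powr (- 1 / 5)"
        by (metis mult.assoc mult.commute)
    qed
  qed
  have e_lim: "(\<lambda>n. (C * c^3 + real (card J) * (3 * c\<^sup>2)) * real n powr (- 1 / 5)) \<longlonglongrightarrow> 0"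
    using tendsto_mult_left[OF tendsto_real_powr_neg[of "1 / 5"]] by simp

  note mix = chi_square_mixture[OF nonneg]
  have laplace: "(\<lambda>n. \<integral>\<omega>. exp (- (t * T n \<omega>)) \<partial>P) \<longlonglongrightarrow>
    (\<integral>x. exp (- (t * x)) \<partial>distr (chi_square d1 \<Otimes>\<^sub>M chi_square d2) borel (\<lambda>(u, v). c1 * u + c2 * v))" if t: "0 \<le> t" for t
  proof (rule P.laplace_close[OF Tm Um T0 U0 Em PE close e_lim t])
    have "(\<lambda>n. \<integral>\<omega>. exp (- (t * U n \<omega>)) \<partial>P) \<longlonglongrightarrow>
      (\<integral>g. exp (- (t * (\<Sum>x\<in>J. (if x \<in> Sq \<times> Sp then c1 else c2) * (g x)\<^sup>2))) \<partial>PiM J (\<lambda>_. gaussian))"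
      unfolding U_def by (rule P.laplace_quadratic_limit[OF finJ(3) Wm char_lim t])
    also have "(\<integral>g. exp (- (t * (\<Sum>x\<in>J. (if x \<in> Sq \<times> Sp then c1 else c2) * (g x)\<^sup>2))) \<partial>PiM J (\<lambda>_. gaussian)) =
      (\<integral>x. exp (- (t * x)) \<partial>distr (chi_square d1 \<Otimes>\<^sub>M chi_square d2) borel (\<lambda>(u, v). c1 * u + c2 * v))"
      unfolding J_def laplace_gaussian_quadratic[OF finJ(1,2) disjJ nonneg t] card1 card2 mix(3)[OF t] ..
    finally show "(\<lambda>n. \<integral>\<omega>. exp (- (t * U n \<omega>)) \<partial>P) \<longlonglongrightarrow>
      (\<integral>x. exp (- (t * x)) \<partial>distr (chi_square d1 \<Otimes>\<^sub>M chi_square d2) borel (\<lambda>(u, v). c1 * u + c2 * v))" .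
  qed
  have "weak_conv_m (\<lambda>n. distr P borel (T n)) (distr (chi_square d1 \<Otimes>\<^sub>M chi_square d2) borel (\<lambda>(u, v). c1 * u + c2 * v))"
  proof (rule laplace_imp_weak_conv)
    show "real_distribution (distr P borel (T n))" for n by (rule P.real_distribution_distr[OF Tm])
    show "AE x in distr P borel (T n). 0 \<le> x" for n using Tm T0 by (subst AE_distr_iff) auto
    show "(\<lambda>n. \<integral>x. exp (- (t * x)) \<partial>distr P borel (T n)) \<longlonglongrightarrow>
      (\<integral>x. exp (- (t * x)) \<partial>distr (chi_square d1 \<Otimes>\<^sub>M chi_square d2) borel (\<lambda>(u, v). c1 * u + c2 * v))" if "0 \<le> t" for t
    proof -
      have "(\<integral>x. exp (- (t * x)) \<partial>distr P borel (T n)) = (\<integral>\<omega>. exp (- (t * T n \<omega>)) \<partial>P)" for n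
        by (rule integral_distr[OF Tm]) measurable
      then show ?thesis using laplace[OF that] by simp
    qed
  qed (rule mix)+
  then show ?thesis unfolding T_def S_def c1_def c2_def .
qed

text \<open>The preimages of \<open>A\<close> under \<open>f\<close> and \<open>g\<close> differ by
  subsets of a null set, and such subsets are measurable in the completion. This handles the
  selection \<open>S1\<close>, \<open>S2\<close>, whose measurability is not assumed.\<close>

lemma measurable_completion_AE:
  assumes f: "f \<in> borel_measurable M" and eq: "AE x in M. f x = g x"
  shows "g \<in> borel_measurable (completion M)"
proof (rule measurableI)
  fix A :: "'b set" assume A: "A \<in> sets borel"
  have D: "Measurable.pred (completion M) (\<lambda>x. f x \<noteq> g x \<and> g x \<in> A)" "Measurable.pred (completion M) (\<lambda>x. f x \<noteq> g x \<and> f x \<in> A)"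
    using eq by (auto intro!: sets_completion_AE elim!: eventually_mono)
  have [measurable]: "Measurable.pred (completion M) (\<lambda>x. f x \<in> A)"
    using measurable_completion[OF f] A by (rule pred_sets2[rotated])
  have "(\<lambda>x. g x \<in> A) = (\<lambda>x. (f x \<in> A \<and> \<not> (f x \<noteq> g x \<and> f x \<in> A)) \<or> (f x \<noteq> g x \<and> g x \<in> A))"
    by auto
  moreover have "Measurable.pred (completion M) \<dots>" using D by measurable
  ultimately have "Measurable.pred (completion M) (\<lambda>x. g x \<in> A)" by simp
  then show "g -` A \<inter> space (completion M) \<in> sets (completion M)"
    by (simp add: pred_def vimage_def Int_def conj_commute)
qed simp

lemma weak_conv_m_eventually_cong:
  assumes "\<forall>\<^sub>F n in sequentially. \<mu> n = \<nu> n" "weak_conv_m \<mu> \<rho>"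
  shows "weak_conv_m \<nu> \<rho>"
  unfolding weak_conv_m_def weak_conv_def
proof (intro allI impI)
  fix x assume "isCont (cdf \<rho>) x"
  then have "(\<lambda>n. cdf (\<mu> n) x) \<longlonglongrightarrow> cdf \<rho> x" using assms(2) by (simp add: weak_conv_m_def weak_conv_def)
  moreover have "\<forall>\<^sub>F n in sequentially. cdf (\<mu> n) x = cdf (\<nu> n) x" using assms(1) by eventually_elim simp
  ultimately show "(\<lambda>n. cdf (\<nu> n) x) \<longlonglongrightarrow> cdf \<rho> x" by (simp cong: tendsto_cong)
qed

theorem theorem1:
  fixes M :: "real^'q^'p"
    and \<Sigma>1 :: "real^'p^'p" and \<Sigma>2 :: "real^'q^'q"
    and F :: "(real^'q^'p) measure"
    and P :: "'a measure"
    and X :: "nat \<Rightarrow> 'a \<Rightarrow> real^'q^'p"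
    and S1 :: "nat \<Rightarrow> 'a \<Rightarrow> real^'p^'p" and S2 :: "nat \<Rightarrow> 'a \<Rightarrow> real^'q^'q"
    and j1 j2 :: 'p and k1 k2 :: 'q
  assumes "CARD('p) \<ge> 2" and "CARD('q) \<ge> 2"
    and "spd \<Sigma>1" and "spd \<Sigma>2"
    and "prob_space F" and "sets F = sets borel"
    and "absolutely_continuous lborel F"
    and "matrix_spherical F"
    and "integrable F (\<lambda>Z. norm Z ^ 4)"
    and "prob_space P"
    and "prob_space.indep_vars P (\<lambda>_. borel) X UNIV"
    and "\<And>i. distr P borel (X i) = matrix_elliptical M \<Sigma>1 \<Sigma>2 F"
    and "\<And>n. AE \<omega> in P. (\<exists>A B. separable_solution (\<lambda>i. X i \<omega>) n A B) \<longrightarrow>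
                 separable_solution (\<lambda>i. X i \<omega>) n (S1 n \<omega>) (S2 n \<omega>)"
    and "j1 \<noteq> j2" and "k1 \<noteq> k2"
  defines "V \<equiv> \<lambda>n \<omega>. separability_matrix (sample_cov (\<lambda>i. X i \<omega>) n) (S1 n \<omega>) (S2 n \<omega>)"
    and "m11 \<equiv> (\<integral>Z. (Z $ j1 $ k1)\<^sup>2 \<partial>F)"
    and "m1122 \<equiv> (\<integral>Z. (Z $ j1 $ k1)\<^sup>2 * (Z $ j2 $ k2)\<^sup>2 \<partial>F)"
    and "m1112 \<equiv> (\<integral>Z. (Z $ j1 $ k1)\<^sup>2 * (Z $ j1 $ k2)\<^sup>2 \<partial>F)"
    and "d1 \<equiv> (CARD('p) + 2) * (CARD('p) - 1) * (CARD('q) + 2) * (CARD('q) - 1) div 4"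
    and "d2 \<equiv> CARD('p) * CARD('q) * (CARD('p) - 1) * (CARD('q) - 1) div 4"
  shows "converges_in_distribution P (\<lambda>n \<omega>. real n * (norm (V n \<omega> - mat 1))\<^sup>2)
           (distr (chi_square d1 \<Otimes>\<^sub>M chi_square d2) borel
             (\<lambda>(u, v). (m1122 + m1112) / m11\<^sup>2 * u + (3 * m1122 - m1112) / m11\<^sup>2 * v))"
proof -
  interpret P: prob_space P by (rule assms(10))
  have F: "spherical_moments F"
    using assms(5,6,8,9) by (simp add: spherical_moments_def spherical_moments_axioms_def)
  define C1 where "C1 = mat_sqrt \<Sigma>1"
  define C2 where "C2 = mat_sqrt \<Sigma>2"
  have spdC: "spd C1" "spd C2" using assms(3,4) by (simp_all add: C1_def C2_def mat_sqrt)
  have C: "det C1 \<noteq> 0" "det C2 \<noteq> 0" using spdC by (simp_all add: spd_det_nz)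
  \<comment> \<open>The inverse of the affine map of the model; it recovers a sequence
    \<open>Z\<close> of independent variables with law \<open>F\<close> from the
    observations.\<close>
  define w where "w x = matrix_inv C1 ** (x - M) ** matrix_inv C2" for x
  define Z where "Z i \<omega> = w (X i \<omega>)" for i \<omega>
  have w: "w \<in> borel_measurable borel"
    unfolding w_def by (intro borel_measurable_continuous_onI mm.continuous_on continuous_intros)
  have X_rv: "X i \<in> measurable P borel" for i using assms(11) unfolding P.indep_vars_def2 by simp
  have indep: "P.indep_vars (\<lambda>_. borel) Z UNIV"
    unfolding Z_def by (rule P.indep_vars_compose2[OF assms(11)]) (simp add: w)
  have w_inv: "w (M + C1 ** z ** C2) = z" for z
  proof -
    have "w (M + C1 ** z ** C2) = (matrix_inv C1 ** C1) ** z ** (C2 ** matrix_inv C2)"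
      by (simp add: w_def matrix_mul_assoc)
    then show ?thesis by (simp add: matrix_inv_mult C)
  qed
  have X_eq: "X i \<omega> = M + C1 ** Z i \<omega> ** C2" for i \<omega>
  proof -
    have "C1 ** Z i \<omega> ** C2 = (C1 ** matrix_inv C1) ** (X i \<omega> - M) ** (matrix_inv C2 ** C2)"
      by (simp add: Z_def w_def matrix_mul_assoc)
    then show ?thesis by (simp add: matrix_inv_mult C)
  qed
  have distr: "distr P borel (Z i) = F" for i
  proof -
    have m: "(\<lambda>z. M + C1 ** z ** C2) \<in> measurable F borel"
      unfolding measurable_cong_sets[OF assms(6) refl]
      by (intro borel_measurable_continuous_onI continuous_intros mm.continuous_on)
    have "distr P borel (Z i) = distr (distr P borel (X i)) borel w"
      using distr_distr[OF w X_rv[of i]] by (simp add: comp_def Z_def[abs_def])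
    also have "distr P borel (X i) = distr F borel (\<lambda>z. M + C1 ** z ** C2)"
      unfolding assms(12) matrix_elliptical_def C1_def C2_def ..
    also have "distr \<dots> borel w = distr F borel (w \<circ> (\<lambda>z. M + C1 ** z ** C2))"
      by (rule distr_distr[OF w m])
    also have "w \<circ> (\<lambda>z. M + C1 ** z ** C2) = (\<lambda>z. z)" by (simp add: fun_eq_iff w_inv)
    also have "distr F borel (\<lambda>z. z) = F" by (rule distr_id2) (simp add: assms(6))
    finally show ?thesis .
  qed
  have m11: "0 < m11" unfolding m11_def by (rule spherical_moments.second_moment_pos[OF F assms(7)])
  define S where "S n \<omega> = (1 / m11) *\<^sub>R sample_cov (\<lambda>i. Z i \<omega>) n" for n \<omega>
  define T where "T n \<omega> = real n * fitted_stat (S n \<omega>)" for n \<omega>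
  let ?V = "\<lambda>n \<omega>. real n * (norm (V n \<omega> - mat 1))\<^sup>2"
  \<comment> \<open>The scale \<open>m11\<close> is carried by the row factor, so a single use of
    \<open>fitted_stat_congruence\<close> removes it together with the scatter matrices.\<close>
  define K where "K = kronecker C2 (sqrt m11 *\<^sub>R C1)"
  have cov: "sample_cov (\<lambda>i. X i \<omega>) n = K ** S n \<omega> ** transpose K" if "0 < n" for n \<omega>
  proof -
    have "K = sqrt m11 *\<^sub>R kronecker C2 C1" by (simp add: K_def kr.scaleR_right)
    then have "K ** S n \<omega> ** transpose K = kronecker C2 C1 ** sample_cov (\<lambda>i. Z i \<omega>) n ** transpose (kronecker C2 C1)"
      using m11 by (simp add: S_def transpose_scalar mm.scaleR_left mm.scaleR_right)
    then show ?thesis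
      using sample_cov_affine[OF that, of M C1 "\<lambda>i. Z i \<omega>" C2] by (simp add: X_eq spd_symmetric[OF spdC(2)])
  qed
  have sC1: "det (sqrt m11 *\<^sub>R C1) \<noteq> 0"
    using m11 by (intro spd_det_nz spd_scaleR spdC) simp
  have K: "det K \<noteq> 0" unfolding K_def by (intro det_kronecker_nz C sC1)
  \<comment> \<open>For such \<open>n\<close> the covariance is almost surely positive definite, so
    a solution exists and the assumption on \<open>S1\<close> and \<open>S2\<close> applies to
    it.\<close>
  have eq: "AE \<omega> in P. T n \<omega> = ?V n \<omega>" if n: "CARD('q \<times> 'p) < n" for n
    using P.AE_spd_sample_cov[OF assms(5,6,7) indep distr n] assms(13)[of n]
  proof eventually_elim
    case (elim \<omega>)
    have n0: "0 < n" using n by simp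
    have S: "spd (S n \<omega>)" unfolding S_def using elim(1) m11 by (intro spd_scaleR) auto
    have SX: "spd (sample_cov (\<lambda>i. X i \<omega>) n)" unfolding cov[OF n0] by (rule spd_congruence[OF S K])
    have "\<exists>A B. separable_solution (\<lambda>i. X i \<omega>) n A B"
      using separable_fit_exists[OF SX] separable_solution_iff[OF n0] by blast
    then have fit: "separable_fit (sample_cov (\<lambda>i. X i \<omega>) n) (S1 n \<omega>) (S2 n \<omega>)"
      using elim(2) separable_solution_iff[OF n0] by blast
    then have "spd (S1 n \<omega>)" "spd (S2 n \<omega>)" by (auto simp: separable_fit_def)
    then have "(norm (V n \<omega> - mat 1))\<^sup>2 = separability_stat (sample_cov (\<lambda>i. X i \<omega>) n) (kronecker (S2 n \<omega>) (S1 n \<omega>))"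
      unfolding V_def by (rule norm_separability_matrix[OF SX])
    also have "\<dots> = fitted_stat (sample_cov (\<lambda>i. X i \<omega>) n)" by (rule fitted_stat_eq[OF SX fit, symmetric])
    also have "\<dots> = fitted_stat (S n \<omega>)"
      unfolding cov[OF n0] K_def by (rule fitted_stat_congruence[OF S sC1 C(2)])
    finally show ?case by (simp add: T_def)
  qed
  have Z_rv: "Z i \<in> borel_measurable P" for i
    using indep unfolding P.indep_vars_def2 by simp
  have Tm: "T n \<in> borel_measurable P" for n
    unfolding T_def S_def
    by (intro borel_measurable_times borel_measurable_const measurable_compose[OF _ fitted_stat_measurable]
        borel_measurable_scaleR sample_cov_measurable Z_rv)
  have Vm: "?V n \<in> borel_measurable (completion P)" if "CARD('q \<times> 'p) < n" for n
    by (rule measurable_completion_AE[OF Tm eq[OF that]])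
  have distr_eq: "distr P borel (T n) = distr (completion P) borel (?V n)" if n: "CARD('q \<times> 'p) < n" for n
  proof -
    have "distr P borel (T n) = distr (completion P) borel (T n)" by (rule distr_completion[OF Tm, symmetric])
    also have "\<dots> = distr (completion P) borel (?V n)"
      using AE_completion[OF eq[OF n]] by (intro distr_cong_AE) (auto intro: Vm[OF n] measurable_completion[OF Tm])
    finally show ?thesis .
  qed
  have ev: "\<forall>\<^sub>F n in sequentially. distr P borel (T n) = distr (completion P) borel (?V n)"
    using eventually_gt_at_top[of "CARD('q \<times> 'p)"] by eventually_elim (rule distr_eq)
  have "weak_conv_m (\<lambda>n. distr P borel (T n)) (distr (chi_square d1 \<Otimes>\<^sub>M chi_square d2) borel
       (\<lambda>(u, v). (m1122 + m1112) / m11\<^sup>2 * u + (3 * m1122 - m1112) / m11\<^sup>2 * v))"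
    unfolding T_def S_def m11_def m1122_def m1112_def d1_def d2_def
    by (rule fitted_stat_limit[OF assms(10) F assms(7) indep distr assms(1,2,14,15)])
  then have "weak_conv_m (\<lambda>n. distr (completion P) borel (?V n)) (distr (chi_square d1 \<Otimes>\<^sub>M chi_square d2) borel
       (\<lambda>(u, v). (m1122 + m1112) / m11\<^sup>2 * u + (3 * m1122 - m1112) / m11\<^sup>2 * v))"
    by (rule weak_conv_m_eventually_cong[OF ev])
  moreover have "\<forall>\<^sub>F n in sequentially. ?V n \<in> borel_measurable (completion P)"
    using eventually_gt_at_top[of "CARD('q \<times> 'p)"] by eventually_elim (rule Vm)
  ultimately show ?thesis unfolding converges_in_distribution_def by blast
qed

end
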